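(* In the setting described in the context, suppose $(T_{\lambda,\sigma})$ has an anomaly of second order, and let $p=\mathbf E(p_{1,\sigma}^2)$ and $q=2\,\mathbf E(p_{K,\sigma})+\mathbf E(p_{1,\sigma}\,\partial_\theta p_{1,\sigma})$. Then the Fokker–Planck operator $\mathcal L^*=\partial_\theta(\partial_\theta\,p-q)$ has a unique groundstate $\rho$, which is non-negative, normalized and continuous, except possibly in the following cases: (I) $p$ has a zero $\hat\theta$ of order $2$ (and possibly another zero) at which $\partial_\theta p(\hat\theta)=q(\hat\theta)=0$ and $\partial_\theta^2p(\hat\theta)\ge\partial_\theta q(\hat\theta)$; (II) $p$ has a zero $\hat\theta$ of order $4$ at which $\mathbf E(p_{K,\sigma}(\hat\theta))=0$ and $\mathbf E(\partial_\theta p_{K,\sigma}(\hat\theta))\le 0$. Furthermore, the groundstate is infinitely differentiable except possibly at one point $\hat\theta$ at which $p$ has a zero of order $2$ and $\partial_\theta p(\hat\theta)=q(\hat\theta)$, $\partial_\theta^2p(\hat\theta)<\partial_\theta q(\hat\theta)$.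
   Context: Let $(\Sigma,\mathbf p)$ be a probability space and $(T_{\lambda,\sigma})$ a family in $SL(2,\mathbb R)$ (compactly supported for small $\lambda$, with $\lambda$-dependence a power series with nonnegative exponents) such that for a fixed $M\in SL(2,\mathbb R)$: $MT_{\lambda,\sigma}M^{-1}=\pm\exp\big(\sum_{k\ge1}\lambda^{\eta_k}P_{\eta_k,\sigma}\big)$, $P_{\eta_k,\sigma}\in sl(2,\mathbb R)$, $0<\eta_1<\eta_2<\cdots$, with an index $K$ such that $\eta_K=2\eta_1$, $\eta_{K+1}\le\eta_1+\eta_2$, and $\mathbf p(P_{\eta_k,\sigma}=0)<1$ for $k<K$. It is an anomaly of second order if $\mathbf E(P_{\eta_k,\sigma})=0$ for $k=1,\ldots,K-1$. For $P_{\eta_k,\sigma}=\begin{pmatrix}a&b\\c&-a\end{pmatrix}$ put $p_{k,\sigma}(\theta)=c\cos^2\theta-b\sin^2\theta-a\sin(2\theta)$, a function on $S^1_\pi=\mathbb R/\pi\mathbb Z$; $\mathbf E$ is expectation over $\sigma$. Thus $p\ge0$ and $p,q$ are trigonometric polynomials in $e^{\pm2i\theta},e^{\pm4i\theta}$. A groundstate of $\mathcal L^*$ is a function $\rho$ on $S^1_\pi$ spanning its kernel, i.e. a $\pi$-periodic solution of $p\,\rho'+(p'-q)\rho=C$ for some real constant $C$ (the once-integrated equation $\mathcal L^*\rho=0$), normalized by $\int_0^\pi\rho(\theta)\,d\theta=1$. *)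

theory Defs
  imports "HOL-Probability.Probability"
begin

text \<open>For P = ((a,b),(c,-a)) in sl(2,R): p(theta) = c cos^2 theta - b sin^2 theta - a sin(2 theta).\<close>
definition pfun :: "real^2^2 \<Rightarrow> real \<Rightarrow> real" where
  "pfun A \<theta> = A$2$1 * (cos \<theta>)^2 - A$1$2 * (sin \<theta>)^2 - A$1$1 * sin (2*\<theta>)"

definition pcoef :: "'s measure \<Rightarrow> (nat \<Rightarrow> 's \<Rightarrow> real^2^2) \<Rightarrow> real \<Rightarrow> real" where
  "pcoef M P \<theta> = integral\<^sup>L M (\<lambda>\<sigma>. (pfun (P 1 \<sigma>) \<theta>)^2)"

definition qcoef :: "'s measure \<Rightarrow> (nat \<Rightarrow> 's \<Rightarrow> real^2^2) \<Rightarrow> nat \<Rightarrow> real \<Rightarrow> real" where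
  "qcoef M P K \<theta> = 2 * integral\<^sup>L M (\<lambda>\<sigma>. pfun (P K \<sigma>) \<theta>)
      + integral\<^sup>L M (\<lambda>\<sigma>. pfun (P 1 \<sigma>) \<theta> * deriv (pfun (P 1 \<sigma>)) \<theta>)"

definition zero_of_order :: "(real \<Rightarrow> real) \<Rightarrow> real \<Rightarrow> nat \<Rightarrow> bool" where
  "zero_of_order f x n \<longleftrightarrow> (\<forall>j<n. (deriv ^^ j) f x = 0) \<and> (deriv ^^ n) f x \<noteq> 0"

text \<open>Groundstate of L* = d/dtheta (d/dtheta p - q): pi-periodic, integrable, normalized solution
  of the once-integrated equation (p rho)' - q rho = C, taken in integrated (weak) form.\<close>
definition groundstate :: "(real \<Rightarrow> real) \<Rightarrow> (real \<Rightarrow> real) \<Rightarrow> (real \<Rightarrow> real) \<Rightarrow> bool" where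
  "groundstate p q \<rho> \<longleftrightarrow>
     (\<forall>\<theta>. \<rho> (\<theta> + pi) = \<rho> \<theta>) \<and>
     set_integrable lborel {0..pi} \<rho> \<and>
     (LINT t:{0..pi}|lborel. \<rho> t) = 1 \<and>
     (\<exists>C::real. \<forall>\<theta>\<in>{0..pi}.
        p \<theta> * \<rho> \<theta> - p 0 * \<rho> 0 = (LINT t:{0..\<theta>}|lborel. q t * \<rho> t + C))"

definition smooth_at :: "(real \<Rightarrow> real) \<Rightarrow> real \<Rightarrow> bool" where
  "smooth_at f x \<longleftrightarrow> (\<exists>e>0. \<forall>n. \<forall>y\<in>ball x e. (deriv ^^ n) f differentiable (at y))"

end

(* The function u = p rho satisfies u' = (q/p) u + C between consecutive zeros of p, so everything is
   decided by the potential w with w' = q/p. At a zero z of p with q(z) /= 0 the factor exp w blows up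
   on one side, where the condition u(z) = 0 determines u, and is flat on the other, where every
   solution extends continuously. If q(z) = 0, the excluded cases give q'(z) > p''(z); then
   homogeneous solutions extend by 0 from both sides, while an inhomogeneous one behaves like
   1/(x - z), which forces C = 0. Since p is a non-negative quartic form in (cos, sin), it has at
   most two zeros modulo pi, and matching the pieces leaves one solution up to scaling in each sign
   pattern of q. Smoothness at a singular point is a bootstrap: limits come from l'Hopital's rule,
   and the differentiated equation has the same form. *)
theory Submission
  imports Defs
begin

text \<open>Zeros of order 2 and 4 are treated alike, because only an upper bound p(x) \<le> A (x -
  z)^2 is used: it makes the relevant logarithmic derivative at least k/(x - z), whose integral
  diverges. A current at a zero with q = 0 is ruled out by integrability of \<rho>: the weak
  equation would give p \<rho> linear growth and \<rho> a lower bound of size 1/(x - z). Uniqueness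
  is almost everywhere because the equation contains only p \<rho> and an integral, hence does not
  see the value of \<rho> at a zero of p.

  The obstacle to uniqueness would be two zeros, distinct modulo pi, at which q vanishes: each gap
  between them would carry its own homogeneous solution. At such a zero, however, the mean drift e =
  E(p_K) vanishes with positive slope, and e is a quadratic form in (cos, sin), whose slopes at two
  distinct zeros modulo pi are opposite.

  At an order 2 zero with q = 0 the groundstate behaves on each side like a multiple of a real power
  of |x - z|, hence the possible loss of smoothness. At an order 4 zero with q = 0 a factor sin(x -
  z) cancels and the bootstrap applies again.\<close>

section \<open>Singular first-order equations\<close>

text \<open>The difference \<open>y x - k * ln (x - z)\<close> is nondecreasing, so to the left of a
  fixed point \<open>m\<close> the function lies below a constant plus
  \<open>k * ln (x - z)\<close>. The divergences of potentials below, and the contradiction with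
  integrability of a density, are instances of this comparison.\<close>

lemma log_growth_right:
  fixes y y' :: "real \<Rightarrow> real"
  assumes k: "0 < k"
    and der: "\<forall>\<^sub>F x in at_right z. (y has_real_derivative y' x) (at x)"
    and low: "\<forall>\<^sub>F x in at_right z. k / (x - z) \<le> y' x"
  shows "filterlim y at_bot (at_right z)"
proof -
  have "\<forall>\<^sub>F x in at_right z. (y has_real_derivative y' x) (at x) \<and> k / (x - z) \<le> y' x"
    using der low by eventually_elim simp
  then obtain c where c: "z < c"
    and D: "\<And>x. z < x \<Longrightarrow> x < c \<Longrightarrow> (y has_real_derivative y' x) (at x)"
    and L: "\<And>x. z < x \<Longrightarrow> x < c \<Longrightarrow> k / (x - z) \<le> y' x"
    unfolding eventually_at_right_field by blast
  define m where "m = (z + c) / 2"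
  have m: "z < m" "m < c" using c by (auto simp: m_def)
  have bound: "y x \<le> (y m - k * ln (m - z)) + k * ln (x - z)" if x: "z < x" "x \<le> m" for x
  proof -
    have "y x - k * ln (x - z) \<le> y m - k * ln (m - z)"
    proof (rule DERIV_nonneg_imp_nondecreasing[OF x(2)])
      fix t assume t: "x \<le> t" "t \<le> m"
      have "((\<lambda>x. y x - k * ln (x - z)) has_real_derivative (y' t - k / (t - z))) (at t)"
        using t x m by (auto intro!: derivative_eq_intros D)
      moreover have "0 \<le> y' t - k / (t - z)" using L[of t] t x m by simp
      ultimately show "\<exists>d. ((\<lambda>x. y x - k * ln (x - z)) has_real_derivative d) (at t) \<and> 0 \<le> d"
        by blast
    qed
    then show ?thesis by simp
  qed
  have "filterlim (\<lambda>x. x - z) (at_right 0) (at_right z)"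
    by (subst at_right_to_0) (simp add: filterlim_filtermap filterlim_ident)
  then have "filterlim (\<lambda>x. ln (x - z)) at_bot (at_right z)"
    by (rule filterlim_compose[OF ln_at_0])
  then have 1: "filterlim (\<lambda>x. k * ln (x - z)) at_bot (at_right z)"
    using k by (subst filterlim_tendsto_pos_mult_at_bot_iff[of _ k]) auto
  have 2: "filterlim (\<lambda>x. (y m - k * ln (m - z)) + k * ln (x - z)) at_bot (at_right z)"
    by (subst filterlim_tendsto_add_at_bot_iff[OF tendsto_const]) (rule 1)
  have "\<forall>\<^sub>F x in at_right z. y x \<le> (y m - k * ln (m - z)) + k * ln (x - z)"
    unfolding eventually_at_right_field using m bound by (intro exI[of _ m]) auto
  then show ?thesis by (rule filterlim_at_bot_mono[OF 2])
qed

text \<open>With the integrating factor \<open>m = exp y\<close>, where \<open>y\<close> has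
  derivative \<open>b / a\<close>, the derivatives of \<open>m * r\<close> and \<open>m\<close> have
  quotient \<open>f / b\<close>, and l'Hopital's rule gives the limit of \<open>r\<close>. The value
  \<open>f0 / b0\<close> is what a r' + b r = f dictates once a r' drops out. The last assumption
  reflects the sign of \<open>b0\<close>: for \<open>b0 < 0\<close> every solution has this limit,
  for \<open>b0 > 0\<close> the flux \<open>a * r\<close> has to vanish.\<close>

lemma singular_limit_right_pos:
  fixes a a' b f r :: "real \<Rightarrow> real"
  assumes pos: "\<forall>\<^sub>F x in at_right z. 0 < a x"
    and quad: "\<forall>\<^sub>F x in at_right z. a x \<le> A * (x - z)\<^sup>2"
    and da: "\<forall>\<^sub>F x in at_right z. (a has_real_derivative a' x) (at x)"
    and cb: "\<forall>\<^sub>F x in at_right z. isCont b x"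
    and dr: "\<forall>\<^sub>F x in at_right z. (r has_real_derivative (f x - b x * r x) / a x) (at x)"
    and a': "(a' \<longlongrightarrow> 0) (at_right z)"
    and b: "(b \<longlongrightarrow> b0) (at_right z)" "b0 \<noteq> 0"
    and f: "(f \<longlongrightarrow> f0) (at_right z)"
    and ar: "b0 < 0 \<or> ((\<lambda>x. a x * r x) \<longlongrightarrow> 0) (at_right z)"
  shows "(r \<longlongrightarrow> f0 / b0) (at_right z)"
proof -
  have "\<forall>\<^sub>F x in at_right z. 0 < a x \<and> (a has_real_derivative a' x) (at x) \<and> isCont b x"
    using pos da cb by eventually_elim simp
  then obtain c where c: "z < c"
    and P: "\<And>x. z < x \<Longrightarrow> x < c \<Longrightarrow> 0 < a x"
    and DA: "\<And>x. z < x \<Longrightarrow> x < c \<Longrightarrow> (a has_real_derivative a' x) (at x)"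
    and CB: "\<And>x. z < x \<Longrightarrow> x < c \<Longrightarrow> isCont b x"
    unfolding eventually_at_right_field by blast
  have "\<exists>F. \<forall>x. ereal z < ereal x \<longrightarrow> ereal x < ereal c \<longrightarrow> (F has_vector_derivative b x / a x) (at x)"
    using c by (intro einterval_antiderivative)
      (auto intro!: continuous_intros CB DERIV_isCont[OF DA] dest: P)
  then obtain y where y: "\<And>x. z < x \<Longrightarrow> x < c \<Longrightarrow> (y has_real_derivative b x / a x) (at x)"
    by (auto simp: has_real_derivative_iff_has_vector_derivative)
  have near: "\<forall>\<^sub>F x in at_right z. z < x \<and> x < c \<and> x < z + 1"
    using c unfolding eventually_at_right_field by (intro exI[of _ "min c (z+1)"]) auto
  \<comment> \<open>Half of the limit \<open>\<bar>b0\<bar>\<close> is an eventual lower bound, and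
    \<open>\<bar>A\<bar> + 1\<close> replaces \<open>A\<close> to make the denominator
    positive.\<close>
  define k where "k = (\<bar>b0\<bar> / 2) / (\<bar>A\<bar> + 1)"
  have k: "0 < k" using b by (simp add: k_def)
  \<comment> \<open>Within distance 1 of \<open>z\<close> the quadratic bound on \<open>a\<close>
    implies a linear one, which is enough for a logarithmic divergence.\<close>
  have big: "k / (x - z) \<le> t / a x"
    if "z < x" "x < z + 1" "0 < a x" "a x \<le> A * (x - z)\<^sup>2" "\<bar>b0\<bar> / 2 < t" for x t
  proof -
    have "A * (x - z)\<^sup>2 \<le> (\<bar>A\<bar> + 1) * (x - z)\<^sup>2" by (intro mult_right_mono) auto
    also have "\<dots> \<le> (\<bar>A\<bar> + 1) * (x - z)"
      using that by (intro mult_left_mono) (auto simp: power2_eq_square mult_left_le)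
    finally have le: "a x \<le> (\<bar>A\<bar> + 1) * (x - z)" using that by simp
    have "k / (x - z) = (\<bar>b0\<bar> / 2) / ((\<bar>A\<bar> + 1) * (x - z))"
      by (simp add: k_def)
    also have "\<dots> \<le> (\<bar>b0\<bar> / 2) / a x" using le that by (intro divide_left_mono) auto
    also have "\<dots> \<le> t / a x" using that by (intro divide_right_mono) auto
    finally show ?thesis .
  qed
  have ybot: "filterlim Y at_bot (at_right z)"
    if Y: "\<forall>\<^sub>F x in at_right z. (Y has_real_derivative t x / a x) (at x)"
      and t: "(t \<longlongrightarrow> \<bar>b0\<bar>) (at_right z)" for Y t
  proof (rule log_growth_right[OF k Y])
    have "\<forall>\<^sub>F x in at_right z. \<bar>b0\<bar> / 2 < t x"
      using b by (intro order_tendstoD(1)[OF t]) auto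
    then show "\<forall>\<^sub>F x in at_right z. k / (x - z) \<le> t x / a x"
      using near pos quad by eventually_elim (auto intro!: big)
  qed
  define m where "m = (\<lambda>x. exp (y x))"
  have Dy: "\<forall>\<^sub>F x in at_right z. (y has_real_derivative b x / a x) (at x)"
    using near by eventually_elim (auto intro: y)
  have Dm: "\<forall>\<^sub>F x in at_right z. (m has_real_derivative m x * b x / a x) (at x)"
    using Dy unfolding m_def by eventually_elim (auto intro!: derivative_eq_intros)
  have Dmr: "\<forall>\<^sub>F x in at_right z. ((\<lambda>x. m x * r x) has_real_derivative m x * f x / a x) (at x)"
    using Dm dr pos
    by eventually_elim (auto intro!: derivative_eq_intros simp: field_simps)
  have bn: "\<forall>\<^sub>F x in at_right z. b x \<noteq> 0"
    using tendsto_imp_eventually_ne[OF b] .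
  have m'n: "\<forall>\<^sub>F x in at_right z. m x * b x / a x \<noteq> 0"
    using bn pos by eventually_elim (auto simp: m_def)
  have lim: "((\<lambda>x. (m x * f x / a x) / (m x * b x / a x)) \<longlongrightarrow> f0 / b0) (at_right z)"
  proof (rule Lim_transform_eventually)
    show "((\<lambda>x. f x / b x) \<longlongrightarrow> f0 / b0) (at_right z)" using f b by (intro tendsto_divide)
    show "\<forall>\<^sub>F x in at_right z. f x / b x = (m x * f x / a x) / (m x * b x / a x)"
      using bn pos by eventually_elim (auto simp: m_def)
  qed
  have main: "((\<lambda>x. m x * r x / m x) \<longlongrightarrow> f0 / b0) (at_right z)"
  proof (cases "b0 < 0")
    \<comment> \<open>Here \<open>m\<close> tends to infinity, and that form of l'Hopital's rule
      asks for no limit of the numerator.\<close>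
    case True
    have "filterlim (\<lambda>x. - y x) at_bot (at_right z)"
    proof (rule ybot[where t = "\<lambda>x. - b x"])
      show "\<forall>\<^sub>F x in at_right z. ((\<lambda>x. - y x) has_real_derivative - b x / a x) (at x)"
        using Dy by eventually_elim (auto intro!: derivative_eq_intros)
      show "((\<lambda>x. - b x) \<longlongrightarrow> \<bar>b0\<bar>) (at_right z)" using tendsto_minus[OF b(1)] True by simp
    qed
    then have "filterlim y at_top (at_right z)" by (simp add: filterlim_uminus_at_top)
    then have "filterlim m at_top (at_right z)"
      unfolding m_def by (rule filterlim_compose[OF exp_at_top])
    then show ?thesis using m'n Dmr Dm lim
      by (rule lhopital_right_at_top)
  next
    case False
    \<comment> \<open>Here \<open>m\<close> tends to 0, so \<open>m * r\<close> must too. It is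
      split as \<open>m / a\<close> times \<open>a * r\<close>; the logarithm of
      \<open>m / a\<close> has derivative \<open>(b - a') / a\<close>, and since \<open>a'\<close>
      tends to 0 this diverges like the derivative of \<open>y\<close>.\<close>
    then have ar0: "((\<lambda>x. a x * r x) \<longlongrightarrow> 0) (at_right z)" and b0: "0 < b0"
      using ar b by auto
    have e0: "((\<lambda>x. exp (Y x)) \<longlongrightarrow> 0) (at_right z)" if "filterlim Y at_bot (at_right z)" for Y :: "real \<Rightarrow> real"
      using filterlim_compose[OF exp_at_bot that] .
    have m0: "(m \<longlongrightarrow> 0) (at_right z)"
      unfolding m_def using b0 b by (intro e0 ybot[where t = b] Dy) auto
    have "((\<lambda>x. exp (y x - ln (a x))) \<longlongrightarrow> 0) (at_right z)"
    proof (intro e0 ybot[where t = "\<lambda>x. b x - a' x"])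
      show "\<forall>\<^sub>F x in at_right z. ((\<lambda>x. y x - ln (a x)) has_real_derivative (b x - a' x) / a x) (at x)"
        using Dy da pos
        by eventually_elim (auto intro!: derivative_eq_intros simp: field_simps)
      show "((\<lambda>x. b x - a' x) \<longlongrightarrow> \<bar>b0\<bar>) (at_right z)"
        using tendsto_diff[OF b(1) a'] b0 by simp
    qed
    from tendsto_mult[OF this ar0]
    have "((\<lambda>x. exp (y x - ln (a x)) * (a x * r x)) \<longlongrightarrow> 0) (at_right z)" by simp
    moreover have "\<forall>\<^sub>F x in at_right z. exp (y x - ln (a x)) * (a x * r x) = m x * r x"
      using pos by eventually_elim (auto simp: m_def exp_diff)
    ultimately have mr0: "((\<lambda>x. m x * r x) \<longlongrightarrow> 0) (at_right z)"
      by (rule Lim_transform_eventually)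
    have mn: "\<forall>\<^sub>F x in at_right z. m x \<noteq> 0" by (simp add: m_def)
    show ?thesis using mr0 m0 mn m'n Dmr Dm lim by (rule lhopital_right)
  qed
  then show ?thesis by (simp add: m_def)
qed

text \<open>Multiplying \<open>a\<close>, \<open>b\<close> and \<open>f\<close> by the constant
  \<open>s\<close> leaves the equation unchanged and makes the leading coefficient positive. A free
  sign is needed for coefficients that change sign at \<open>z\<close>, such as a multiple of
  sin^3.\<close>

lemma singular_limit_right:
  fixes a a' b f r :: "real \<Rightarrow> real"
  assumes pos: "\<forall>\<^sub>F x in at_right z. 0 < s * a x"
    and quad: "\<forall>\<^sub>F x in at_right z. \<bar>a x\<bar> \<le> A * (x - z)\<^sup>2"
    and da: "\<forall>\<^sub>F x in at_right z. (a has_real_derivative a' x) (at x)"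
    and cb: "\<forall>\<^sub>F x in at_right z. isCont b x"
    and dr: "\<forall>\<^sub>F x in at_right z. (r has_real_derivative (f x - b x * r x) / a x) (at x)"
    and a': "(a' \<longlongrightarrow> 0) (at_right z)"
    and b: "(b \<longlongrightarrow> b0) (at_right z)" "b0 \<noteq> 0"
    and f: "(f \<longlongrightarrow> f0) (at_right z)"
    and ar: "s * b0 < 0 \<or> ((\<lambda>x. a x * r x) \<longlongrightarrow> 0) (at_right z)"
  shows "(r \<longlongrightarrow> f0 / b0) (at_right z)"
proof -
  have s: "s \<noteq> 0"
  proof
    assume "s = 0"
    then have "\<forall>\<^sub>F x in at_right z. False" using pos by simp
    then show False by simp
  qed
  have "(r \<longlongrightarrow> (s * f0) / (s * b0)) (at_right z)"
  proof (rule singular_limit_right_pos[where a = "\<lambda>x. s * a x" and a' = "\<lambda>x. s * a' x"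
        and b = "\<lambda>x. s * b x" and f = "\<lambda>x. s * f x" and A = "\<bar>s\<bar> * A"])
    show "\<forall>\<^sub>F x in at_right z. s * a x \<le> \<bar>s\<bar> * A * (x - z)\<^sup>2"
      using quad
    proof eventually_elim
      case (elim x)
      have "s * a x \<le> \<bar>s\<bar> * \<bar>a x\<bar>" by (metis abs_ge_self abs_mult)
      also have "\<dots> \<le> \<bar>s\<bar> * (A * (x - z)\<^sup>2)" using elim by (intro mult_left_mono) auto
      finally show ?case by (simp add: mult.assoc)
    qed
    show "\<forall>\<^sub>F x in at_right z. ((\<lambda>x. s * a x) has_real_derivative s * a' x) (at x)"
      using da by eventually_elim (rule DERIV_cmult)
    show "\<forall>\<^sub>F x in at_right z. isCont (\<lambda>x. s * b x) x"
      using cb by eventually_elim (intro continuous_intros)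
    show "\<forall>\<^sub>F x in at_right z. (r has_real_derivative (s * f x - s * b x * r x) / (s * a x)) (at x)"
      using dr
    proof eventually_elim
      case (elim x)
      have "(s * f x - s * b x * r x) / (s * a x) = (s * (f x - b x * r x)) / (s * a x)"
        by (simp add: algebra_simps)
      then show ?case using elim s by simp
    qed
    show "s * b0 < 0 \<or> ((\<lambda>x. s * a x * r x) \<longlongrightarrow> 0) (at_right z)"
      using ar tendsto_mult_left[of "\<lambda>x. a x * r x" 0 _ s] by (auto simp: mult.assoc)
  qed (use pos s b f a' in \<open>auto intro!: tendsto_eq_intros\<close>)
  then show ?thesis using s by simp
qed

text \<open>Under x -> -x the derivative changes sign, which is absorbed by negating
  \<open>b\<close> and \<open>f\<close>. Hence the limit is the same, while the sign condition on
  \<open>s * b0\<close> is reversed.\<close>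

lemma singular_limit_left:
  fixes a a' b f r :: "real \<Rightarrow> real"
  assumes pos: "\<forall>\<^sub>F x in at_left z. 0 < s * a x"
    and quad: "\<forall>\<^sub>F x in at_left z. \<bar>a x\<bar> \<le> A * (x - z)\<^sup>2"
    and da: "\<forall>\<^sub>F x in at_left z. (a has_real_derivative a' x) (at x)"
    and cb: "\<forall>\<^sub>F x in at_left z. isCont b x"
    and dr: "\<forall>\<^sub>F x in at_left z. (r has_real_derivative (f x - b x * r x) / a x) (at x)"
    and a': "(a' \<longlongrightarrow> 0) (at_left z)"
    and b: "(b \<longlongrightarrow> b0) (at_left z)" "b0 \<noteq> 0"
    and f: "(f \<longlongrightarrow> f0) (at_left z)"
    and ar: "0 < s * b0 \<or> ((\<lambda>x. a x * r x) \<longlongrightarrow> 0) (at_left z)"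
  shows "(r \<longlongrightarrow> f0 / b0) (at_left z)"
proof -
  have "((\<lambda>x. r (- x)) \<longlongrightarrow> (- f0) / (- b0)) (at_right (- z))"
  proof (rule singular_limit_right[where a = "\<lambda>x. a (- x)" and a' = "\<lambda>x. - a' (- x)"
        and b = "\<lambda>x. - b (- x)" and f = "\<lambda>x. - f (- x)" and A = A and s = s])
    show "\<forall>\<^sub>F x in at_right (- z). 0 < s * a (- x)"
      using pos by (simp add: eventually_at_left_to_right)
    have "\<forall>\<^sub>F x in at_right (- z). \<bar>a (- x)\<bar> \<le> A * (- x - z)\<^sup>2"
      using quad by (simp add: eventually_at_left_to_right)
    then show "\<forall>\<^sub>F x in at_right (- z). \<bar>a (- x)\<bar> \<le> A * (x - - z)\<^sup>2"
      by eventually_elim (simp add: power2_eq_square algebra_simps)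
    have "\<forall>\<^sub>F x in at_right (- z). (a has_real_derivative a' (- x)) (at (- x))"
      using da by (simp add: eventually_at_left_to_right)
    then show "\<forall>\<^sub>F x in at_right (- z). ((\<lambda>x. a (- x)) has_real_derivative - a' (- x)) (at x)"
      by eventually_elim (simp add: DERIV_mirror[symmetric])
    have "\<forall>\<^sub>F x in at_right (- z). isCont b (- x)"
      using cb by (simp add: eventually_at_left_to_right)
    then show "\<forall>\<^sub>F x in at_right (- z). isCont (\<lambda>x. - b (- x)) x"
      by eventually_elim (auto intro!: continuous_intros isCont_o2[where g=b])
    have "\<forall>\<^sub>F x in at_right (- z). (r has_real_derivative (f (- x) - b (- x) * r (- x)) / a (- x)) (at (- x))"
      using dr by (simp add: eventually_at_left_to_right)
    then show "\<forall>\<^sub>F x in at_right (- z). ((\<lambda>x. r (- x)) has_real_derivative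
                 (- f (- x) - - b (- x) * r (- x)) / a (- x)) (at x)"
    proof eventually_elim
      case (elim x)
      have "((\<lambda>x. r (- x)) has_real_derivative (f (- x) - b (- x) * r (- x)) / a (- x) * (- 1)) (at x)"
        using elim by (simp add: DERIV_mirror[symmetric])
      moreover have "(f (- x) - b (- x) * r (- x)) / a (- x) * (- 1)
         = (- f (- x) - - b (- x) * r (- x)) / a (- x)"
        by (simp add: minus_divide_left)
      ultimately show ?case by simp
    qed
    show "((\<lambda>x. - a' (- x)) \<longlongrightarrow> 0) (at_right (- z))"
      using tendsto_minus[OF a'] by (simp add: filterlim_at_left_to_right)
    show "((\<lambda>x. - b (- x)) \<longlongrightarrow> - b0) (at_right (- z))"
      using tendsto_minus[OF b(1)] by (simp add: filterlim_at_left_to_right)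
    show "((\<lambda>x. - f (- x)) \<longlongrightarrow> - f0) (at_right (- z))"
      using tendsto_minus[OF f] by (simp add: filterlim_at_left_to_right)
    show "s * - b0 < 0 \<or> ((\<lambda>x. a (- x) * r (- x)) \<longlongrightarrow> 0) (at_right (- z))"
      using ar by (simp add: filterlim_at_left_to_right)
  qed (use b in auto)
  then show ?thesis by (simp add: filterlim_at_left_to_right)
qed

section \<open>Functions of class C^k and regular linear equations\<close>

text \<open>On an open set this is the class C^n. Differentiability is two-sided and the recursion
  passes to \<open>deriv f\<close>, so that membership for all n yields the iterated derivatives
  occurring in \<open>smooth_at\<close>.\<close>

primrec Ck_on :: "nat \<Rightarrow> (real \<Rightarrow> real) \<Rightarrow> real set \<Rightarrow> bool" where
  "Ck_on 0 f S \<longleftrightarrow> continuous_on S f"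
| "Ck_on (Suc n) f S \<longleftrightarrow> (\<forall>x\<in>S. f differentiable (at x)) \<and> Ck_on n (deriv f) S"

lemma differentiable_transform_open:
  "f differentiable (at x) \<Longrightarrow> open S \<Longrightarrow> x \<in> S \<Longrightarrow> (\<And>y. y \<in> S \<Longrightarrow> f y = g y) \<Longrightarrow> g differentiable (at x)"
  unfolding differentiable_def by (metis has_derivative_transform_within_open)

lemma Ck_on_cong:
  assumes "open S" "\<And>x. x \<in> S \<Longrightarrow> f x = g x"
  shows "Ck_on n f S \<longleftrightarrow> Ck_on n g S"
proof -
  have imp: "Ck_on n g S" if "Ck_on n f S" "\<And>x. x \<in> S \<Longrightarrow> f x = g x" for f g
    using that
  proof (induction n arbitrary: f g)
    case 0
    then show ?case by (simp cong: continuous_on_cong)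
  next
    case (Suc n)
    have "deriv f x = deriv g x" if "x \<in> S" for x
      using Suc.prems(2) assms(1) that
      by (intro deriv_cong_ev) (auto intro: eventually_nhds_in_open[THEN eventually_mono])
    moreover have "g differentiable (at x)" if "x \<in> S" for x
      using Suc.prems assms(1) that
      by (intro differentiable_transform_open[of f x S g]) auto
    ultimately show ?case using Suc by auto
  qed
  show ?thesis using imp[of f g] imp[of g f] assms(2) by auto
qed

lemma Ck_on_SucI:
  assumes "open S" "\<And>x. x \<in> S \<Longrightarrow> (f has_real_derivative f' x) (at x)" "Ck_on n f' S"
  shows "Ck_on (Suc n) f S"
proof -
  have "deriv f x = f' x" if "x \<in> S" for x using assms(2)[OF that] by (rule DERIV_imp_deriv)
  then have "Ck_on n (deriv f) S" using assms by (subst Ck_on_cong[of S _ f']) auto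
  then show ?thesis using assms(2) by (auto simp: real_differentiable_def)
qed

lemma Ck_on_SucD: "Ck_on (Suc n) f S \<Longrightarrow> Ck_on n f S"
proof (induction n arbitrary: f)
  case 0
  then show ?case
    by (auto intro!: continuous_at_imp_continuous_on differentiable_imp_continuous_within)
qed auto

lemma Ck_on_deriv: "Ck_on (Suc n) f S \<Longrightarrow> x \<in> S \<Longrightarrow> (f has_real_derivative deriv f x) (at x)"
  by (simp add: DERIV_deriv_iff_real_differentiable)

lemma Ck_on_continuous: "Ck_on n f S \<Longrightarrow> continuous_on S f"
proof (induction n)
  case (Suc n)
  then show ?case using Ck_on_SucD by blast
qed simp

lemma Ck_on_subset: "Ck_on n f S \<Longrightarrow> T \<subseteq> S \<Longrightarrow> Ck_on n f T"
  by (induction n arbitrary: f) (auto intro: continuous_on_subset)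

lemma Ck_on_const [intro]: "Ck_on n (\<lambda>x. c) S"
  by (induction n arbitrary: c) auto

lemma Ck_on_add:
  assumes "open S" "Ck_on n f S" "Ck_on n g S" shows "Ck_on n (\<lambda>x. f x + g x) S"
  using assms(2,3)
proof (induction n arbitrary: f g)
  case (Suc n)
  show ?case
    by (rule Ck_on_SucI[OF assms(1), where f' = "\<lambda>x. deriv f x + deriv g x"])
       (use Suc in \<open>auto intro!: derivative_eq_intros Ck_on_deriv\<close>)
qed (auto intro: continuous_intros)

lemma Ck_on_mult:
  assumes "open S" "Ck_on n f S" "Ck_on n g S" shows "Ck_on n (\<lambda>x. f x * g x) S"
  using assms(2,3)
proof (induction n arbitrary: f g)
  case (Suc n)
  show ?case
  proof (rule Ck_on_SucI[OF assms(1), where f' = "\<lambda>x. deriv f x * g x + deriv g x * f x"])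
    show "((\<lambda>x. f x * g x) has_real_derivative deriv f x * g x + deriv g x * f x) (at x)" if "x \<in> S" for x
      using that Suc.prems by (intro DERIV_mult Ck_on_deriv)
    show "Ck_on n (\<lambda>x. deriv f x * g x + deriv g x * f x) S"
      using Suc.prems Suc.prems[THEN Ck_on_SucD] by (intro Ck_on_add[OF assms(1)] Suc.IH) auto
  qed
qed (auto intro: continuous_intros)

lemma Ck_on_diff:
  assumes "open S" "Ck_on n f S" "Ck_on n g S" shows "Ck_on n (\<lambda>x. f x - g x) S"
  using Ck_on_add[OF assms(1,2) Ck_on_mult[OF assms(1) Ck_on_const[of n "-1"] assms(3)]] by simp

lemma Ck_on_inverse:
  assumes "open S" "Ck_on n f S" "\<And>x. x \<in> S \<Longrightarrow> f x \<noteq> 0"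
  shows "Ck_on n (\<lambda>x. inverse (f x)) S"
  using assms(2,3)
proof (induction n arbitrary: f)
  case (Suc n)
  show ?case
  proof (rule Ck_on_SucI[OF assms(1),
        where f' = "\<lambda>x. - 1 * (deriv f x * (inverse (f x) * inverse (f x)))"])
    show "((\<lambda>x. inverse (f x)) has_real_derivative
        - 1 * (deriv f x * (inverse (f x) * inverse (f x)))) (at x)" if "x \<in> S" for x
      using DERIV_inverse_fun[OF Ck_on_deriv[OF Suc.prems(1) that] Suc.prems(2)[OF that]]
      by (simp add: mult.commute mult.left_commute)
    show "Ck_on n (\<lambda>x. - 1 * (deriv f x * (inverse (f x) * inverse (f x)))) S"
      using Suc.prems Suc.prems(1)[THEN Ck_on_SucD]
      by (intro Ck_on_mult[OF assms(1)] Ck_on_const Suc.IH) auto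
  qed
qed (auto intro: continuous_intros)

lemma Ck_on_divide:
  assumes "open S" "Ck_on n f S" "Ck_on n g S" "\<And>x. x \<in> S \<Longrightarrow> g x \<noteq> 0"
  shows "Ck_on n (\<lambda>x. f x / g x) S"
  unfolding divide_inverse using assms by (intro Ck_on_mult Ck_on_inverse)

lemma Ck_on_power:
  assumes "open S" "Ck_on n f S" shows "Ck_on n (\<lambda>x. f x ^ m) S"
  by (induction m) (use assms in \<open>auto intro: Ck_on_mult\<close>)

lemma Ck_on_sin_cos: "Ck_on n (\<lambda>x. sin (x - z)) UNIV \<and> Ck_on n (\<lambda>x. cos (x - z)) UNIV"
proof (induction n)
  case (Suc n)
  have "Ck_on (Suc n) (\<lambda>x. sin (x - z)) UNIV"
    by (rule Ck_on_SucI[where f' = "\<lambda>x. cos (x - z)"]) (use Suc in \<open>auto intro!: derivative_eq_intros\<close>)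
  moreover have "Ck_on (Suc n) (\<lambda>x. cos (x - z)) UNIV"
  proof (rule Ck_on_SucI[where f' = "\<lambda>x. - 1 * sin (x - z)"])
    show "Ck_on n (\<lambda>x. - 1 * sin (x - z)) UNIV"
      using Suc by (intro Ck_on_mult) auto
  qed (auto intro!: derivative_eq_intros)
  ultimately show ?case by blast
qed (auto intro!: continuous_intros)

lemma Ck_on_imp_funpow: "Ck_on (m + n) f S \<Longrightarrow> Ck_on n ((deriv ^^ m) f) S"
proof (induction m arbitrary: f)
  case (Suc m)
  then show ?case by (simp add: funpow_swap1)
qed simp

lemma smooth_atI:
  assumes "0 < e" "\<And>n. Ck_on n f (ball x e)"
  shows "smooth_at f x"
proof -
  have "(deriv ^^ n) f differentiable (at y)" if "y \<in> ball x e" for n y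
    using Ck_on_imp_funpow[of n 1 f "ball x e"] assms(2)[of "n + 1"] that by simp
  then show ?thesis unfolding smooth_at_def using assms(1) by blast
qed

text \<open>Bootstrap for a regular equation: if \<open>r\<close> is C^n, then so is the right-hand
  side, and \<open>r\<close> is C^(n+1).\<close>

lemma Ck_on_linear_ode:
  assumes "open S" "\<And>n. Ck_on n A S" "\<And>n. Ck_on n B S"
    and "\<And>x. x \<in> S \<Longrightarrow> (r has_real_derivative A x * r x + B x) (at x)"
  shows "Ck_on n r S"
proof (induction n)
  case 0
  show ?case using DERIV_isCont[OF assms(4)] by (simp add: continuous_at_imp_continuous_on)
next
  case (Suc n)
  show ?case
    by (rule Ck_on_SucI[OF assms(1,4)], assumption) (intro Ck_on_add Ck_on_mult assms(1-3) Suc)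
qed

section \<open>Limits and regularity at a singular point\<close>

text \<open>A singular equation prescribes no derivative at the singular point itself; there the
  difference quotient is evaluated by l'Hopital's rule from the derivatives nearby.\<close>

lemma has_real_derivative_from_limit:
  fixes r r' :: "real \<Rightarrow> real"
  assumes "isCont r z" "\<forall>\<^sub>F x in at z. (r has_real_derivative r' x) (at x)" "(r' \<longlongrightarrow> L) (at z)"
  shows "(r has_real_derivative L) (at z)"
proof -
  have "((\<lambda>x. (r x - r z) / (x - z)) \<longlongrightarrow> L) (at z)"
  proof (rule lhopital[where f' = r' and g' = "\<lambda>_. 1"])
    show "((\<lambda>x. r x - r z) \<longlongrightarrow> 0) (at z)" using assms(1) by (simp add: isCont_def LIM_zero_iff)
    show "((\<lambda>x. x - z) \<longlongrightarrow> 0) (at z)" by (auto intro!: tendsto_eq_intros)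
    show "\<forall>\<^sub>F x in at z. x - z \<noteq> 0" by (auto simp: eventually_at_filter)
    show "\<forall>\<^sub>F x in at z. ((\<lambda>x. r x - r z) has_real_derivative r' x) (at x)"
      using assms(2) by eventually_elim (auto intro!: derivative_eq_intros)
  qed (use assms(3) in \<open>auto intro!: derivative_eq_intros always_eventually\<close>)
  then show ?thesis by (simp add: has_field_derivative_iff)
qed

text \<open>The constants \<open>s\<close> and \<open>t\<close> record the sign of \<open>a\<close>
  on either side and may differ. Assuming that \<open>a * r\<close> tends to 0 settles the
  alternative of the one-sided versions on both sides.\<close>

lemma singular_limit:
  fixes a a' b f r :: "real \<Rightarrow> real"
  assumes right: "\<forall>\<^sub>F x in at_right z. 0 < s * a x" and left: "\<forall>\<^sub>F x in at_left z. 0 < t * a x"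
    and quad: "\<forall>\<^sub>F x in at z. \<bar>a x\<bar> \<le> A * (x - z)\<^sup>2"
    and da: "\<forall>\<^sub>F x in at z. (a has_real_derivative a' x) (at x)"
    and cb: "\<forall>\<^sub>F x in at z. isCont b x"
    and dr: "\<forall>\<^sub>F x in at z. (r has_real_derivative (f x - b x * r x) / a x) (at x)"
    and a': "(a' \<longlongrightarrow> 0) (at z)"
    and b: "(b \<longlongrightarrow> b0) (at z)" "b0 \<noteq> 0"
    and f: "(f \<longlongrightarrow> f0) (at z)"
    and ar: "((\<lambda>x. a x * r x) \<longlongrightarrow> 0) (at z)"
  shows "(r \<longlongrightarrow> f0 / b0) (at z)"
proof -
  have "(r \<longlongrightarrow> f0 / b0) (at_right z)"
    by (rule singular_limit_right[where s=s and a=a and a'=a' and b=b and A=A and f=f])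
       (use assms in \<open>auto simp: eventually_at_split filterlim_at_split\<close>)
  moreover have "(r \<longlongrightarrow> f0 / b0) (at_left z)"
    by (rule singular_limit_left[where s=t and a=a and a'=a' and b=b and A=A and f=f])
       (use assms in \<open>auto simp: eventually_at_split filterlim_at_split\<close>)
  ultimately show ?thesis by (simp add: filterlim_at_split)
qed

text \<open>Differentiating \<open>a r' + b r = f\<close> gives an equation of the same form for \<open>r'\<close> with
  \<open>b + a'\<close> in place of \<open>b\<close>, and \<open>a'\<close> vanishes at the singular point.\<close>
lemma Ck_on_singular_ode:
  fixes a b f r :: "real \<Rightarrow> real"
  assumes U: "open U" "z \<in> U"
    and a: "\<And>n. Ck_on n a U" and a0: "a z = 0" "deriv a z = 0"
    and an: "\<And>x. x \<in> U - {z} \<Longrightarrow> a x \<noteq> 0"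
    and right: "\<forall>\<^sub>F x in at_right z. 0 < s * a x" and left: "\<forall>\<^sub>F x in at_left z. 0 < t * a x"
    and quad: "\<forall>\<^sub>F x in at z. \<bar>a x\<bar> \<le> A * (x - z)\<^sup>2"
    and b: "\<And>n. Ck_on n b U" "b z \<noteq> 0"
    and r: "continuous_on U r"
    and dr: "\<And>x. x \<in> U - {z} \<Longrightarrow> (r has_real_derivative (f x - b x * r x) / a x) (at x)"
    and f: "Ck_on n f U"
  shows "Ck_on n r U"
  using b r dr f
proof (induction n arbitrary: b f r)
  case (Suc n)
  have evU: "\<forall>\<^sub>F x in at z. x \<in> U - {z}"
    using U by (auto simp: eventually_at_topological)
  have evI: "\<forall>\<^sub>F x in at z. Q x" if "\<And>x. x \<in> U - {z} \<Longrightarrow> Q x" for Q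
    using evU by eventually_elim (rule that)
  have da: "(a has_real_derivative deriv a x) (at x)" if "x \<in> U" for x
    using a[of "Suc 0"] that by (rule Ck_on_deriv)
  have db: "(b has_real_derivative deriv b x) (at x)" if "x \<in> U" for x
    using Suc.prems(1)[of "Suc 0"] that by (rule Ck_on_deriv)
  have df: "(f has_real_derivative deriv f x) (at x)" if "x \<in> U" for x
    using Suc.prems(5) that by (rule Ck_on_deriv)
  have cont: "isCont g z" if "continuous_on U g" for g :: "real \<Rightarrow> real"
    using that U by (simp add: continuous_on_eq_continuous_at)
  have lim: "(g \<longlongrightarrow> g z) (at z)" if "continuous_on U g" for g :: "real \<Rightarrow> real"
    using cont[OF that] by (simp add: isCont_def)
  have cb: "\<forall>\<^sub>F x in at z. isCont b x"
    using db by (intro evI DERIV_isCont[OF db]) auto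
  have la: "(a \<longlongrightarrow> 0) (at z)" using lim[OF Ck_on_continuous[OF a]] a0 by simp
  have Cda: "Ck_on n (deriv a) U" for n using a[of "Suc n"] by simp
  have Cdb: "Ck_on n (deriv b) U" for n using Suc.prems(1)[of "Suc n"] by simp
  have la': "(deriv a \<longlongrightarrow> 0) (at z)"
    using lim[OF Ck_on_continuous[OF Cda]] a0 by simp
  have lb: "(b \<longlongrightarrow> b z) (at z)" using Suc.prems(1) by (intro lim Ck_on_continuous)
  have Cdf: "Ck_on n (deriv f) U" using Suc.prems(5) by simp
  have lf: "(f \<longlongrightarrow> f z) (at z)" using Suc.prems(5) by (intro lim Ck_on_continuous)
  have lr: "(r \<longlongrightarrow> r z) (at z)" using Suc.prems(3) by (intro lim)
  \<comment> \<open>The source term \<open>g\<close> of the differentiated equation contains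
    \<open>r\<close> itself, so \<open>r\<close> must already be C^n.\<close>
  have Cr: "Ck_on n r U" 
    by (rule Suc.IH[OF Suc.prems(1-4) Ck_on_SucD[OF Suc.prems(5)]])
  \<comment> \<open>Continuity identifies the singular limit with \<open>r z\<close>, so
    \<open>f - b * r\<close> vanishes at \<open>z\<close>. Away from \<open>z\<close> this numerator
    is \<open>a\<close> times the derivative of \<open>r\<close>; its vanishing is the hypothesis
    needed to apply the limit lemma to that derivative.\<close>
  have "(r \<longlongrightarrow> f z / b z) (at z)"
    using tendsto_mult[OF la lr] Suc.prems(2) da Suc.prems(4)
    by (intro singular_limit[OF right left quad _ cb _ la' lb _ lf] evI) auto
  then have rz: "f z - b z * r z = 0"
    using tendsto_unique[OF _ _ lr] Suc.prems(2) by (auto simp: field_simps)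
  define \<sigma> where "\<sigma> = (\<lambda>x. (f x - b x * r x) / a x)"
  define g where "g = (\<lambda>x. deriv f x - deriv b x * r x)"
  define b1 where "b1 = (\<lambda>x. b x + deriv a x)"
  have Cg: "Ck_on n g U" unfolding g_def using Cdf Cdb Cr U by (intro Ck_on_diff Ck_on_mult)
  have Cb1: "Ck_on m b1 U" for m unfolding b1_def using Cda Suc.prems U by (intro Ck_on_add)
  have b1z: "b1 z \<noteq> 0" using Suc.prems(2) a0 by (simp add: b1_def)
  have d\<sigma>: "(\<sigma> has_real_derivative (g x - b1 x * \<sigma> x) / a x) (at x)" if x: "x \<in> U - {z}" for x
  proof -
    have x': "x \<in> U" and ax: "a x \<noteq> 0" using x an by auto
    have "(\<sigma> has_real_derivative
      ((deriv f x - (deriv b x * r x + (f x - b x * r x) / a x * b x)) * a x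
        - (f x - b x * r x) * deriv a x) / (a x * a x)) (at x)"
      unfolding \<sigma>_def
      by (intro DERIV_divide DERIV_diff DERIV_mult df db da Suc.prems(4) x x' ax)
    moreover have "((deriv f x - (deriv b x * r x + (f x - b x * r x) / a x * b x)) * a x
        - (f x - b x * r x) * deriv a x) / (a x * a x) = (g x - b1 x * \<sigma> x) / a x"
      using ax by (simp add: \<sigma>_def g_def b1_def field_simps)
    ultimately show ?thesis by simp
  qed
  define L where "L = g z / b1 z"
  have l\<sigma>: "(\<sigma> \<longlongrightarrow> L) (at z)" unfolding L_def
  proof (rule singular_limit[OF right left quad _ _ _ la' _ b1z])
    have "((\<lambda>x. f x - b x * r x) \<longlongrightarrow> 0) (at z)"
      using tendsto_diff[OF lf tendsto_mult[OF lb lr]] rz by simp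
    then show "((\<lambda>x. a x * \<sigma> x) \<longlongrightarrow> 0) (at z)"
      by (rule Lim_transform_eventually) (use an in \<open>auto intro!: evI simp: \<sigma>_def\<close>)
    show "\<forall>\<^sub>F x in at z. isCont b1 x"
      using Ck_on_deriv[OF Cb1] by (intro evI DERIV_isCont) auto
  qed (use da d\<sigma> lim[OF Ck_on_continuous[OF Cg]] lim[OF Ck_on_continuous[OF Cb1]] in \<open>auto intro: evI\<close>)
  have drz: "(r has_real_derivative L) (at z)"
    by (rule has_real_derivative_from_limit[OF cont[OF Suc.prems(3)] evI l\<sigma>])
       (auto simp: \<sigma>_def intro: Suc.prems(4))
  \<comment> \<open>\<open>\<tau>\<close> is the derivative of \<open>r\<close> with its value at
    \<open>z\<close> filled in. It is continuous on \<open>U\<close> and solves the differentiated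
    equation off \<open>z\<close>, so the induction hypothesis applies to it.\<close>
  define \<tau> where "\<tau> = (\<lambda>x. if x = z then L else \<sigma> x)"
  have ev\<tau>: "\<forall>\<^sub>F y in nhds x. \<sigma> y = \<tau> y" if "x \<in> U - {z}" for x
    using U that by (intro eventually_nhds_in_open[of "U - {z}", THEN eventually_mono])
      (auto simp: \<tau>_def)
  have d\<tau>: "(\<tau> has_real_derivative (g x - b1 x * \<tau> x) / a x) (at x)" if "x \<in> U - {z}" for x
    using d\<sigma>[OF that] DERIV_cong_ev[OF refl ev\<tau>[OF that] refl] that by (simp add: \<tau>_def)
  have "isCont \<tau> x" if "x \<in> U" for x
  proof (cases "x = z")
    case True
    have "(\<tau> \<longlongrightarrow> L) (at z)" using l\<sigma>
      by (rule Lim_transform_eventually) (auto simp: \<tau>_def eventually_at_filter)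
    then show ?thesis using True by (simp add: isCont_def \<tau>_def)
  next
    case False
    then show ?thesis using d\<tau>[of x] that by (auto intro: DERIV_isCont)
  qed
  then have "continuous_on U \<tau>" by (auto intro: continuous_at_imp_continuous_on)
  then have "Ck_on n \<tau> U" using d\<tau> Cg b1z Cb1 by (intro Suc.IH[of b1 \<tau> g]) auto
  then show ?case
    by (rule Ck_on_SucI[OF U(1), rotated]) (auto simp: \<tau>_def \<sigma>_def drz Suc.prems(4))
qed simp

section \<open>Solutions between zeros of the diffusion coefficient\<close>

text \<open>Deliberately weaker than a positive lower bound: numerators with a positive limit and
  numerators with a simple zero then meet one common hypothesis of linear growth.\<close>

lemma eventually_ge_linear_right:
  fixes N :: "real \<Rightarrow> real"
  assumes "(N \<longlongrightarrow> l) (at_right z)" "0 < l"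
  shows "\<forall>\<^sub>F x in at_right z. l / 2 * (x - z) \<le> N x"
proof -
  have "\<forall>\<^sub>F x in at_right z. z < x \<and> x < z + 1"
    unfolding eventually_at_right_field by (intro exI[of _ "z+1"]) auto
  moreover have "\<forall>\<^sub>F x in at_right z. l / 2 < N x"
    using assms by (intro order_tendstoD(1)[OF assms(1)]) auto
  ultimately show ?thesis
  proof eventually_elim
    case (elim x)
    have "l / 2 * (x - z) \<le> l / 2 * 1" using elim assms by (intro mult_left_mono) auto
    then show ?case using elim by simp
  qed
qed

lemma antiderivative_exists:
  fixes f :: "real \<Rightarrow> real"
  assumes "\<alpha> < \<beta>" "\<And>x. \<alpha> < x \<Longrightarrow> x < \<beta> \<Longrightarrow> isCont f x"
  shows "\<exists>F. \<forall>x. \<alpha> < x \<longrightarrow> x < \<beta> \<longrightarrow> (F has_real_derivative f x) (at x)"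
  using einterval_antiderivative[of "ereal \<alpha>" "ereal \<beta>" f] assms
  by (auto simp: has_real_derivative_iff_has_vector_derivative)

lemma eventually_at_right_gapI: "\<alpha> < \<beta> \<Longrightarrow> (\<And>x. \<alpha> < x \<Longrightarrow> x < \<beta> \<Longrightarrow> Q x) \<Longrightarrow> \<forall>\<^sub>F x in at_right \<alpha>. Q x"
  for \<alpha> \<beta> :: real
  unfolding eventually_at_right_field by blast

lemma eventually_at_left_gapI: "\<alpha> < \<beta> \<Longrightarrow> (\<And>x. \<alpha> < x \<Longrightarrow> x < \<beta> \<Longrightarrow> Q x) \<Longrightarrow> \<forall>\<^sub>F x in at_left \<beta>. Q x"
  for \<alpha> \<beta> :: real
  unfolding eventually_at_left_field by blast

text \<open>The excluded cases enter through \<open>degenerate\<close>: (q - p')/p is the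
  logarithmic derivative of exp w / p, and a positive slope of q - p' at a common zero makes that
  function decay there from both sides. \<open>quad\<close> makes the argument independent of the
  order of the zero.\<close>

locale fokker_planck =
  fixes p p' q q' :: "real \<Rightarrow> real"
  assumes dp: "\<And>x. (p has_real_derivative p' x) (at x)"
    and dq: "\<And>x. (q has_real_derivative q' x) (at x)"
    and cp': "\<And>x. isCont p' x"
    and per: "\<And>x. p (x + pi) = p x" "\<And>x. p' (x + pi) = p' x" "\<And>x. q (x + pi) = q x"
    and nonneg: "\<And>x. 0 \<le> p x"
    and quad: "\<And>z. p z = 0 \<Longrightarrow> \<exists>A. \<forall>x. p x \<le> A * (x - z)\<^sup>2"
    and degenerate: "\<And>z. p z = 0 \<Longrightarrow> q z = 0 \<Longrightarrow>
      \<exists>B>0. ((\<lambda>x. q x - p' x) has_real_derivative B) (at z)"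
begin

text \<open>Reversing the orientation keeps \<open>p\<close>, changes the sign of the drift
  \<open>q\<close> and preserves the slope \<open>B\<close> in \<open>degenerate\<close>. It
  converts statements about one end of a gap into statements about the other.\<close>

lemma reflect: "fokker_planck (\<lambda>x. p (- x)) (\<lambda>x. - p' (- x)) (\<lambda>x. - q (- x)) (\<lambda>x. q' (- x))"
proof
  fix x
  show "((\<lambda>x. p (- x)) has_real_derivative - p' (- x)) (at x)"
    using dp[of "- x"] by (simp add: DERIV_mirror[symmetric])
  show "((\<lambda>x. - q (- x)) has_real_derivative q' (- x)) (at x)"
    using DERIV_minus[of "\<lambda>x. q (- x)" "- q' (- x)" x UNIV] dq[of "- x"]
    by (simp add: DERIV_mirror[symmetric])
  show "isCont (\<lambda>x. - p' (- x)) x"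
    by (rule continuous_minus[OF isCont_o2[OF continuous_minus[OF continuous_ident] cp']])
  show "p (- (x + pi)) = p (- x)" "- p' (- (x + pi)) = - p' (- x)" "- q (- (x + pi)) = - q (- x)"
    using per[of "- (x + pi)"] by (simp_all only: minus_add_distrib add.assoc add.left_inverse add_0_right)
  show "0 \<le> p (- x)" by (rule nonneg)
next
  fix z assume z: "p (- z) = 0"
  then obtain A where "\<forall>x. p x \<le> A * (x - - z)\<^sup>2" using quad by blast
  then have "p (- x) \<le> A * (- x - - z)\<^sup>2" for x by blast
  then show "\<exists>A. \<forall>x. p (- x) \<le> A * (x - z)\<^sup>2"
    by (intro exI[of _ A]) (metis add_uminus_conv_diff add.commute minus_minus power2_commute)
  assume "- q (- z) = 0"
  then have "q (- z) = 0" by simp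
  with z obtain B where "B > 0" "((\<lambda>x. q x - p' x) has_real_derivative B) (at (- z))"
    using degenerate by blast
  then show "\<exists>B>0. ((\<lambda>x. - q (- x) - - p' (- x)) has_real_derivative B) (at z)"
    using DERIV_minus[of "\<lambda>x. q (- x) - p' (- x)" "- B" z UNIV]
    by (intro exI[of _ B]) (simp add: DERIV_mirror)
qed

lemma p'_zero: "p z = 0 \<Longrightarrow> p' z = 0"
  using DERIV_local_min[OF dp zero_less_one, of z] nonneg by simp

lemma cp: "isCont p x" and cq: "isCont q x"
  using dp dq DERIV_isCont by blast+

text \<open>A numerator of at least linear size is divided by a denominator of at most quadratic
  size, so the quotient is not integrable at \<open>z\<close>.\<close>

lemma linear_growth_right:
  assumes pos: "\<forall>\<^sub>F x in at_right z. 0 < p x" and z: "p z = 0" and c: "0 < c"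
    and N: "\<forall>\<^sub>F x in at_right z. c * (x - z) \<le> N x"
  shows "\<exists>k>0. \<forall>\<^sub>F x in at_right z. k / (x - z) \<le> N x / p x"
proof -
  obtain A where A: "\<And>x. p x \<le> A * (x - z)\<^sup>2" using quad[OF z] by blast
  have k: "0 < c / (\<bar>A\<bar> + 1)" using c by simp
  have "\<forall>\<^sub>F x in at_right z. z < x" by (simp add: eventually_at_filter)
  then have "\<forall>\<^sub>F x in at_right z. c / (\<bar>A\<bar> + 1) / (x - z) \<le> N x / p x"
    using pos N
  proof eventually_elim
    case (elim x)
    have "A * (x - z)\<^sup>2 \<le> (\<bar>A\<bar> + 1) * (x - z)\<^sup>2" by (intro mult_right_mono) auto
    then have le: "p x \<le> (\<bar>A\<bar> + 1) * (x - z)\<^sup>2" using A[of x] by simp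
    have "c / (\<bar>A\<bar> + 1) / (x - z) = c * (x - z) / ((\<bar>A\<bar> + 1) * (x - z)\<^sup>2)"
      using elim by (simp add: power2_eq_square)
    also have "\<dots> \<le> c * (x - z) / p x" using le elim c by (intro divide_left_mono) auto
    also have "\<dots> \<le> N x / p x" using elim by (intro divide_right_mono) auto
    finally show ?case .
  qed
  then show ?thesis using k by blast
qed

text \<open>Since \<open>p'\<close> vanishes at \<open>z\<close>, the numerator tends to
  \<open>q z\<close>; when that is 0, the positive slope \<open>B\<close> takes over.\<close>

lemma attracting_right:
  assumes pos: "\<forall>\<^sub>F x in at_right z. 0 < p x" and z: "p z = 0" and qz: "0 \<le> q z"
  shows "\<exists>k>0. \<forall>\<^sub>F x in at_right z. k / (x - z) \<le> (q x - p' x) / p x"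
proof (cases "q z = 0")
  case False
  have "isCont (\<lambda>x. q x - p' x) z" by (intro continuous_intros cq cp')
  then have "((\<lambda>x. q x - p' x) \<longlongrightarrow> q z - p' z) (at_right z)"
    by (simp add: isCont_def filterlim_at_split)
  then have "((\<lambda>x. q x - p' x) \<longlongrightarrow> q z) (at_right z)" using p'_zero[OF z] by simp
  from eventually_ge_linear_right[OF this] show ?thesis
    using False qz by (intro linear_growth_right[OF pos z, of "q z / 2"]) auto
next
  case True
  then obtain B where B: "B > 0" and D: "((\<lambda>x. q x - p' x) has_real_derivative B) (at z)"
    using degenerate z by blast
  have "((\<lambda>x. (q x - p' x - (q z - p' z)) / (x - z)) \<longlongrightarrow> B) (at_right z)"
    using D by (simp add: has_field_derivative_iff filterlim_at_split)
  then have "\<forall>\<^sub>F x in at_right z. B / 2 < (q x - p' x) / (x - z)"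
    using B True p'_zero[OF z] by (intro order_tendstoD(1)[of _ B]) auto
  moreover have "\<forall>\<^sub>F x in at_right z. z < x" by (simp add: eventually_at_filter)
  ultimately have "\<forall>\<^sub>F x in at_right z. B / 2 * (x - z) \<le> q x - p' x"
    by eventually_elim (simp add: field_simps)
  then show ?thesis using B by (intro linear_growth_right[OF pos z, of "B / 2"]) auto
qed

text \<open>The quotient is the derivative of - w. For \<open>q z < 0\<close> it is exp (- w) that
  decays, and exp w blows up.\<close>

lemma repelling_right:
  assumes pos: "\<forall>\<^sub>F x in at_right z. 0 < p x" and z: "p z = 0" and qz: "q z < 0"
  shows "\<exists>k>0. \<forall>\<^sub>F x in at_right z. k / (x - z) \<le> - q x / p x"
proof -
  have "((\<lambda>x. - q x) \<longlongrightarrow> - q z) (at_right z)"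
    using tendsto_minus[OF cq[of z, unfolded isCont_def]] by (simp add: filterlim_at_split)
  from eventually_ge_linear_right[OF this] show ?thesis
    using qz by (intro linear_growth_right[OF pos z, of "- q z / 2"]) auto
qed

definition potential where
  "potential \<alpha> \<beta> w \<longleftrightarrow> (\<forall>x. \<alpha> < x \<longrightarrow> x < \<beta> \<longrightarrow> (w has_real_derivative q x / p x) (at x))"

lemma potentialD: "potential \<alpha> \<beta> w \<Longrightarrow> \<alpha> < x \<Longrightarrow> x < \<beta> \<Longrightarrow> (w has_real_derivative q x / p x) (at x)"
  by (simp add: potential_def)

end

locale gap = fokker_planck +
  fixes \<alpha> \<beta> :: real
  assumes ab: "\<alpha> < \<beta>" and pos: "\<And>x. \<alpha> < x \<Longrightarrow> x < \<beta> \<Longrightarrow> 0 < p x"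
    and zero: "p \<alpha> = 0" "p \<beta> = 0"
begin

lemma potential_exists: "\<exists>w. potential \<alpha> \<beta> w"
  unfolding potential_def using ab pos
  by (intro antiderivative_exists) (auto intro!: continuous_intros cq cp simp: less_imp_neq[symmetric])

lemma gap_reflect:
  "gap (\<lambda>x. p (- x)) (\<lambda>x. - p' (- x)) (\<lambda>x. - q (- x)) (\<lambda>x. q' (- x)) (- \<beta>) (- \<alpha>)"
  by (intro gap.intro gap_axioms.intro reflect) (use ab pos zero in auto)

lemma potential_reflect:
  assumes "potential \<alpha> \<beta> w"
  shows "fokker_planck.potential (\<lambda>x. p (- x)) (\<lambda>x. - q (- x)) (- \<beta>) (- \<alpha>) (\<lambda>x. w (- x))"
  unfolding fokker_planck.potential_def[OF reflect]
  using potentialD[OF assms] by (auto simp: DERIV_mirror[symmetric])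

lemma pos_right: "\<forall>\<^sub>F x in at_right \<alpha>. 0 < p x" by (rule eventually_at_right_gapI[OF ab pos])

text \<open>Decay is needed for the density exp w / p, not merely for exp w; the logarithm
  \<open>w - ln p\<close> of the density has the derivative estimated in
  \<open>attracting_right\<close>.\<close>

lemma homogeneous_limit_right:
  assumes "0 \<le> q \<alpha>" "potential \<alpha> \<beta> w"
  shows "((\<lambda>x. exp (w x) / p x) \<longlongrightarrow> 0) (at_right \<alpha>)"
proof -
  obtain k where "0 < k" and "\<forall>\<^sub>F x in at_right \<alpha>. k / (x - \<alpha>) \<le> (q x - p' x) / p x"
    using attracting_right[OF pos_right zero(1) assms(1)] by blast
  moreover have "\<forall>\<^sub>F x in at_right \<alpha>. ((\<lambda>x. w x - ln (p x)) has_real_derivative (q x - p' x) / p x) (at x)"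
    using pos by (intro eventually_at_right_gapI[OF ab])
      (rule derivative_eq_intros potentialD[OF assms(2)] dp refl | simp add: diff_divide_distrib)+
  ultimately have "filterlim (\<lambda>x. w x - ln (p x)) at_bot (at_right \<alpha>)"
    by (intro log_growth_right)
  then have "((\<lambda>x. exp (w x - ln (p x))) \<longlongrightarrow> 0) (at_right \<alpha>)"
    by (rule filterlim_compose[OF exp_at_bot])
  then show ?thesis
    by (rule Lim_transform_eventually) (use pos in \<open>auto intro!: eventually_at_right_gapI[OF ab] simp: exp_diff\<close>)
qed

text \<open>Homogeneous fluxes are multiples of exp w, which blows up at this end. Multiplication by
  exp (- w) therefore shows that a flux vanishing at the end has coefficient 0.\<close>

lemma exp_potential_limit_right:
  assumes "q \<alpha> < 0" "potential \<alpha> \<beta> w"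
  shows "((\<lambda>x. exp (- w x)) \<longlongrightarrow> 0) (at_right \<alpha>)"
proof -
  obtain k where "0 < k" and "\<forall>\<^sub>F x in at_right \<alpha>. k / (x - \<alpha>) \<le> - q x / p x"
    using repelling_right[OF pos_right zero(1) assms(1)] by blast
  moreover have "\<forall>\<^sub>F x in at_right \<alpha>. ((\<lambda>x. - w x) has_real_derivative - q x / p x) (at x)"
    by (intro eventually_at_right_gapI[OF ab]) (auto intro!: derivative_eq_intros potentialD[OF assms(2)])
  ultimately have "filterlim (\<lambda>x. - w x) at_bot (at_right \<alpha>)"
    by (intro log_growth_right)
  then show ?thesis by (rule filterlim_compose[OF exp_at_bot])
qed

lemma homogeneous_limit_left:
  assumes "q \<beta> \<le> 0" "potential \<alpha> \<beta> w"
  shows "((\<lambda>x. exp (w x) / p x) \<longlongrightarrow> 0) (at_left \<beta>)"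
  using gap.homogeneous_limit_right[OF gap_reflect _ potential_reflect[OF assms(2)]] assms(1)
  by (simp add: filterlim_at_left_to_right)

lemma exp_potential_limit_left:
  assumes "0 < q \<beta>" "potential \<alpha> \<beta> w"
  shows "((\<lambda>x. exp (- w x)) \<longlongrightarrow> 0) (at_left \<beta>)"
  using gap.exp_potential_limit_right[OF gap_reflect _ potential_reflect[OF assms(2)]] assms(1)
  by (simp add: filterlim_at_left_to_right)

lemma homogeneous_solution:
  assumes "0 \<le> q \<alpha>" "q \<beta> \<le> 0"
  shows "\<exists>h. (\<forall>x. \<alpha> < x \<longrightarrow> x < \<beta> \<longrightarrow> 0 < h x \<and>
            (h has_real_derivative (0 - (p' x - q x) * h x) / p x) (at x))
          \<and> (h \<longlongrightarrow> 0) (at_right \<alpha>) \<and> (h \<longlongrightarrow> 0) (at_left \<beta>)"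
proof -
  obtain w where w: "potential \<alpha> \<beta> w" using potential_exists by blast
  have "((\<lambda>x. exp (w x) / p x) has_real_derivative (0 - (p' x - q x) * (exp (w x) / p x)) / p x) (at x)"
    if x: "\<alpha> < x" "x < \<beta>" for x
    using pos[OF x]
    by (auto intro!: derivative_eq_intros potentialD[OF w x] dp simp: field_simps)
  then show ?thesis
    using pos homogeneous_limit_right[OF assms(1) w] homogeneous_limit_left[OF assms(2) w]
    by (intro exI[of _ "\<lambda>x. exp (w x) / p x"]) auto
qed

text \<open>Variation of constants: the flux is exp w times the integral of exp (- w) from
  \<open>x\<close> to \<open>\<beta>\<close>. Since exp w blows up at \<open>\<beta>\<close>, no
  other constant of integration lets the flux vanish there. The current is -1 because the integral
  decreases in \<open>x\<close>, and the end values 1/q balance -1 against - q h where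
  \<open>p\<close> and \<open>p'\<close> vanish.\<close>

lemma driven_solution_pos:
  assumes q: "0 < q \<alpha>" "0 < q \<beta>"
  shows "\<exists>h. (\<forall>x. \<alpha> < x \<longrightarrow> x < \<beta> \<longrightarrow> 0 < h x \<and>
            (h has_real_derivative (- 1 - (p' x - q x) * h x) / p x) (at x))
          \<and> (h \<longlongrightarrow> 1 / q \<alpha>) (at_right \<alpha>) \<and> (h \<longlongrightarrow> 1 / q \<beta>) (at_left \<beta>)"
proof -
  obtain w where w: "potential \<alpha> \<beta> w" using potential_exists by blast
  \<comment> \<open>The integrand is continued by 0 beyond \<open>\<beta>\<close>, so that its
    antiderivative is defined and differentiable at \<open>\<beta>\<close>.\<close>
  define g where "g = (\<lambda>x. if x < \<beta> then exp (- w x) else 0)"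
  have e0: "((\<lambda>x. exp (- w x)) \<longlongrightarrow> 0) (at_left \<beta>)" by (rule exp_potential_limit_left[OF q(2) w])
  have cg: "isCont g x" if x: "\<alpha> < x" for x
  proof -
    consider "x < \<beta>" | "x = \<beta>" | "\<beta> < x" by linarith
    then show ?thesis
    proof cases
      case 1
      have "isCont (\<lambda>x. exp (- w x)) x"
        using DERIV_isCont[OF potentialD[OF w x 1]] by (intro continuous_intros)
      moreover have "\<forall>\<^sub>F y in nhds x. exp (- w y) = g y"
        using 1 by (intro eventually_nhds_in_open[of "{..<\<beta>}", THEN eventually_mono]) (auto simp: g_def)
      ultimately show ?thesis by (simp add: isCont_cong)
    next
      case 2
      have "(g \<longlongrightarrow> 0) (at_left \<beta>)"
        by (rule Lim_transform_eventually[OF e0]) (auto simp: g_def eventually_at_filter)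
      moreover have "(g \<longlongrightarrow> 0) (at_right \<beta>)"
        by (rule Lim_transform_eventually[OF tendsto_const[of 0]]) (auto simp: g_def eventually_at_filter)
      ultimately show ?thesis using 2 by (simp add: isCont_def filterlim_at_split g_def)
    next
      case 3
      have "\<forall>\<^sub>F y in nhds x. g y = (\<lambda>_. 0) y"
        using 3 by (intro eventually_nhds_in_open[of "{\<beta><..}", THEN eventually_mono]) (auto simp: g_def)
      from isCont_cong[OF this] show ?thesis by simp
    qed
  qed
  then have "\<exists>F. \<forall>x. \<alpha> < x \<longrightarrow> x < \<beta> + 1 \<longrightarrow> (F has_real_derivative g x) (at x)"
    using ab by (intro antiderivative_exists) auto
  then obtain F where F: "\<And>x. \<alpha> < x \<Longrightarrow> x < \<beta> + 1 \<Longrightarrow> (F has_real_derivative g x) (at x)" by blast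
  have Fg: "(F has_real_derivative exp (- w x)) (at x)" if "\<alpha> < x" "x < \<beta>" for x
    using F[of x] that by (simp add: g_def)
  have Fpos: "F x < F \<beta>" if x: "\<alpha> < x" "x < \<beta>" for x
  proof (rule DERIV_pos_imp_increasing_open[OF x(2)])
    fix t assume "x < t" "t < \<beta>"
    then show "\<exists>y. (F has_real_derivative y) (at t) \<and> 0 < y" using Fg[of t] x by auto
  next
    show "continuous_on {x..\<beta>} F"
      using x by (intro continuous_at_imp_continuous_on ballI DERIV_isCont[OF F]) auto
  qed
  \<comment> \<open>\<open>F \<beta> - F x\<close> is the integral of exp (- w) from
    \<open>x\<close> to \<open>\<beta>\<close>.\<close>
  define u where "u = (\<lambda>x. (F \<beta> - F x) * exp (w x))"
  have du: "(u has_real_derivative q x / p x * u x - 1) (at x)" if x: "\<alpha> < x" "x < \<beta>" for x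
    unfolding u_def
    by (rule derivative_eq_intros Fg[OF x] potentialD[OF w x] refl)+
       (simp add: exp_minus field_simps)
  define h where "h = (\<lambda>x. u x / p x)"
  have dh: "(h has_real_derivative (- 1 - (p' x - q x) * h x) / p x) (at x)" if x: "\<alpha> < x" "x < \<beta>" for x
    unfolding h_def using pos[OF x]
    by (auto intro!: derivative_eq_intros du[OF x] dp simp: field_simps)
  have hpos: "0 < h x" if x: "\<alpha> < x" "x < \<beta>" for x
    using Fpos[OF x] pos[OF x] by (simp add: h_def u_def)
  have CF: "isCont F \<beta>" using F[of \<beta>] ab by (auto intro: DERIV_isCont)
  have qnz: "\<forall>\<^sub>F x in at_left \<beta>. 0 < q x"
    using cq[of \<beta>] q by (intro order_tendstoD(1)[of q "q \<beta>"]) (auto simp: isCont_def filterlim_at_split)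
  \<comment> \<open>Numerator and denominator both tend to 0; in the quotient of derivatives the
    exponentials cancel and p / q remains, which vanishes at \<open>\<beta>\<close>.\<close>
  have "((\<lambda>x. (F \<beta> - F x) / exp (- w x)) \<longlongrightarrow> 0) (at_left \<beta>)"
  proof (rule lhopital_left[OF _ e0, where f' = "\<lambda>x. - exp (- w x)" and g' = "\<lambda>x. - (q x / p x) * exp (- w x)"])
    show "((\<lambda>x. F \<beta> - F x) \<longlongrightarrow> 0) (at_left \<beta>)"
      using CF by (auto simp: isCont_def filterlim_at_split intro!: tendsto_eq_intros)
    show "\<forall>\<^sub>F x in at_left \<beta>. ((\<lambda>x. F \<beta> - F x) has_real_derivative - exp (- w x)) (at x)"
      by (intro eventually_at_left_gapI[OF ab]) (auto intro!: derivative_eq_intros Fg)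
    show "\<forall>\<^sub>F x in at_left \<beta>. ((\<lambda>x. exp (- w x)) has_real_derivative - (q x / p x) * exp (- w x)) (at x)"
      by (intro eventually_at_left_gapI[OF ab]) (auto intro!: derivative_eq_intros potentialD[OF w])
    have P: "\<forall>\<^sub>F x in at_left \<beta>. 0 < p x" by (rule eventually_at_left_gapI[OF ab pos])
    show "\<forall>\<^sub>F x in at_left \<beta>. - (q x / p x) * exp (- w x) \<noteq> 0"
      using P qnz by eventually_elim simp
    have "((\<lambda>x. p x / q x) \<longlongrightarrow> p \<beta> / q \<beta>) (at_left \<beta>)"
      using cp[of \<beta>] cq[of \<beta>] q by (intro tendsto_divide) (auto simp: isCont_def filterlim_at_split)
    moreover have "\<forall>\<^sub>F x in at_left \<beta>. p x / q x = - exp (- w x) / (- (q x / p x) * exp (- w x))"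
      using P qnz by eventually_elim simp
    ultimately have "((\<lambda>x. - exp (- w x) / (- (q x / p x) * exp (- w x))) \<longlongrightarrow> p \<beta> / q \<beta>) (at_left \<beta>)"
      by (rule Lim_transform_eventually)
    then show "((\<lambda>x. - exp (- w x) / (- (q x / p x) * exp (- w x))) \<longlongrightarrow> 0) (at_left \<beta>)"
      by (simp only: zero(2) div_0)
  qed simp
  then have u0: "(u \<longlongrightarrow> 0) (at_left \<beta>)" by (simp add: u_def exp_minus divide_inverse)
  have tends: "(f \<longlongrightarrow> f z) (at_right z)" "(f \<longlongrightarrow> f z) (at_left z)" if "isCont f z" for f :: "real \<Rightarrow> real" and z
    using that by (auto simp: isCont_def filterlim_at_split)
  have Cb: "isCont (\<lambda>x. p' x - q x) z" for z by (intro continuous_intros cp' cq)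
  obtain A1 where A1: "\<And>x. p x \<le> A1 * (x - \<alpha>)\<^sup>2" using quad[OF zero(1)] by blast
  obtain A2 where A2: "\<And>x. p x \<le> A2 * (x - \<beta>)\<^sup>2" using quad[OF zero(2)] by blast
  \<comment> \<open>At \<open>\<alpha>\<close> the zeroth-order coefficient is
    \<open>- q \<alpha> < 0\<close> and every solution has this limit. At \<open>\<beta>\<close> the
    same sign is the unfavourable one, and the vanishing of \<open>u\<close> has to be
    supplied.\<close>
  have "(h \<longlongrightarrow> - 1 / (p' \<alpha> - q \<alpha>)) (at_right \<alpha>)"
  proof (rule singular_limit_right[where a = p and s = 1 and a' = p' and f = "\<lambda>_. - 1" and A = A1])
    show "\<forall>\<^sub>F x in at_right \<alpha>. (h has_real_derivative (- 1 - (p' x - q x) * h x) / p x) (at x)"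
      using dh by (intro eventually_at_right_gapI[OF ab])
    show "(p' \<longlongrightarrow> 0) (at_right \<alpha>)" using tends(1)[OF cp'[of \<alpha>]] p'_zero[OF zero(1)] by simp
    show "((\<lambda>x. p' x - q x) \<longlongrightarrow> p' \<alpha> - q \<alpha>) (at_right \<alpha>)" by (rule tends(1)[OF Cb])
  qed (use pos_right dp Cb A1 nonneg q p'_zero zero in auto)
  moreover have "(h \<longlongrightarrow> - 1 / (p' \<beta> - q \<beta>)) (at_left \<beta>)"
  proof (rule singular_limit_left[where a = p and s = 1 and a' = p' and f = "\<lambda>_. - 1" and A = A2])
    show "\<forall>\<^sub>F x in at_left \<beta>. (h has_real_derivative (- 1 - (p' x - q x) * h x) / p x) (at x)"
      using dh by (intro eventually_at_left_gapI[OF ab])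
    show "(p' \<longlongrightarrow> 0) (at_left \<beta>)" using tends(2)[OF cp'[of \<beta>]] p'_zero[OF zero(2)] by simp
    show "((\<lambda>x. p' x - q x) \<longlongrightarrow> p' \<beta> - q \<beta>) (at_left \<beta>)" by (rule tends(2)[OF Cb])
    show "\<forall>\<^sub>F x in at_left \<beta>. 0 < 1 * p x" using pos by (intro eventually_at_left_gapI[OF ab]) auto
    have "((\<lambda>x. p x * h x) \<longlongrightarrow> 0) (at_left \<beta>)"
      by (rule Lim_transform_eventually[OF u0])
        (rule eventually_at_left_gapI[OF ab], use pos in \<open>force simp: h_def\<close>)
    then show "0 < 1 * (p' \<beta> - q \<beta>) \<or> ((\<lambda>x. p x * h x) \<longlongrightarrow> 0) (at_left \<beta>)" by blast
  qed (use dp Cb A2 nonneg q p'_zero zero in auto)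
  ultimately show ?thesis using dh hpos p'_zero zero by (intro exI[of _ h]) auto
qed

text \<open>Reflection changes the sign of the derivative, which turns the current -1 into
  1.\<close>

lemma driven_solution_neg:
  assumes q: "q \<alpha> < 0" "q \<beta> < 0"
  shows "\<exists>h. (\<forall>x. \<alpha> < x \<longrightarrow> x < \<beta> \<longrightarrow> 0 < h x \<and>
            (h has_real_derivative (1 - (p' x - q x) * h x) / p x) (at x))
          \<and> (h \<longlongrightarrow> - 1 / q \<alpha>) (at_right \<alpha>) \<and> (h \<longlongrightarrow> - 1 / q \<beta>) (at_left \<beta>)"
proof -
  obtain h where h: "\<And>x. - \<beta> < x \<Longrightarrow> x < - \<alpha> \<Longrightarrow> 0 < h x \<and>
      (h has_real_derivative (- 1 - (- p' (- x) - - q (- x)) * h x) / p (- x)) (at x)"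
    and l: "(h \<longlongrightarrow> 1 / - q \<beta>) (at_right (- \<beta>))" "(h \<longlongrightarrow> 1 / - q \<alpha>) (at_left (- \<alpha>))"
    using gap.driven_solution_pos[OF gap_reflect] q by auto
  have "((\<lambda>x. h (- x)) has_real_derivative (1 - (p' x - q x) * h (- x)) / p x) (at x)"
    if x: "\<alpha> < x" "x < \<beta>" for x
  proof -
    have "(h has_real_derivative (- 1 - (- p' x - - q x) * h (- x)) / p x) (at (- x))"
      using h[of "- x"] x by simp
    then have "((\<lambda>x. h (- x)) has_real_derivative - ((- 1 - (- p' x - - q x) * h (- x)) / p x)) (at x)"
      by (simp only: DERIV_mirror)
    moreover have "- ((- 1 - (- p' x - - q x) * h (- x)) / p x) = (1 - (p' x - q x) * h (- x)) / p x"
      by (simp add: minus_divide_left algebra_simps del: minus_divide_left[symmetric])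
    ultimately show ?thesis by simp
  qed
  then show ?thesis using h l
    by (intro exI[of _ "\<lambda>x. h (- x)"]) (auto simp: filterlim_at_left_to_right)
qed

lemma potential_factor:
  assumes w: "potential \<alpha> \<beta> w" and x: "\<alpha> < x" "x < \<beta>"
    and v: "(v has_real_derivative q x / p x * v x + C) (at x)"
  shows "((\<lambda>x. v x * exp (- w x)) has_real_derivative C * exp (- w x)) (at x)"
  by (rule derivative_eq_intros potentialD[OF w x] v refl)+ (simp add: algebra_simps)

lemma homogeneous_constant:
  assumes w: "potential \<alpha> \<beta> w"
    and v: "\<And>x. \<alpha> < x \<Longrightarrow> x < \<beta> \<Longrightarrow> (v has_real_derivative q x / p x * v x) (at x)"
  shows "\<exists>D. \<forall>x. \<alpha> < x \<longrightarrow> x < \<beta> \<longrightarrow> v x = D * exp (w x)"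
proof -
  have "\<exists>D. \<forall>x\<in>{\<alpha><..<\<beta>}. v x * exp (- w x) = D"
  proof (rule has_field_derivative_zero_constant)
    fix x assume "x \<in> {\<alpha><..<\<beta>}"
    then have "((\<lambda>x. v x * exp (- w x)) has_real_derivative 0) (at x)"
      using potential_factor[OF w, of x v 0] v by auto
    then show "((\<lambda>x. v x * exp (- w x)) has_real_derivative 0) (at x within {\<alpha><..<\<beta>})"
      by (rule has_field_derivative_at_within)
  qed simp
  then obtain D where D: "\<And>x. \<alpha> < x \<Longrightarrow> x < \<beta> \<Longrightarrow> v x * exp (- w x) = D" by auto
  have "v x = D * exp (w x)" if "\<alpha> < x" "x < \<beta>" for x
    using D[OF that] by (auto simp: exp_minus field_simps)
  then show ?thesis by blast
qed

text \<open>The coefficient of exp w in \<open>v\<close> equals v exp (- w), a product of two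
  factors that both tend to 0 at \<open>\<alpha>\<close>.\<close>

lemma homogeneous_zero_right:
  assumes v: "\<And>x. \<alpha> < x \<Longrightarrow> x < \<beta> \<Longrightarrow> (v has_real_derivative q x / p x * v x) (at x)"
    and c: "(v \<longlongrightarrow> 0) (at_right \<alpha>)" and q: "q \<alpha> < 0" and x: "\<alpha> < x" "x < \<beta>"
  shows "v x = 0"
proof -
  obtain w where w: "potential \<alpha> \<beta> w" using potential_exists by blast
  obtain D where D: "\<And>x. \<alpha> < x \<Longrightarrow> x < \<beta> \<Longrightarrow> v x = D * exp (w x)"
    using homogeneous_constant[OF w v] by blast
  have "((\<lambda>x. v x * exp (- w x)) \<longlongrightarrow> 0 * 0) (at_right \<alpha>)"
    by (intro tendsto_mult c exp_potential_limit_right[OF q w])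
  moreover have "\<forall>\<^sub>F x in at_right \<alpha>. v x * exp (- w x) = D"
    by (intro eventually_at_right_gapI[OF ab]) (simp add: D exp_minus)
  ultimately have "((\<lambda>x. D) \<longlongrightarrow> 0 * 0) (at_right \<alpha>)"
    by (rule Lim_transform_eventually)
  then have "D = 0" by (simp add: tendsto_const_iff)
  then show ?thesis using D[OF x] by simp
qed

lemma homogeneous_zero_left:
  assumes v: "\<And>x. \<alpha> < x \<Longrightarrow> x < \<beta> \<Longrightarrow> (v has_real_derivative q x / p x * v x) (at x)"
    and c: "(v \<longlongrightarrow> 0) (at_left \<beta>)" and q: "0 < q \<beta>" and x: "\<alpha> < x" "x < \<beta>"
  shows "v x = 0"
proof -
  have "((\<lambda>x. v (- x)) has_real_derivative - q (- x) / p (- x) * v (- x)) (at x)"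
    if "- \<beta> < x" "x < - \<alpha>" for x
  proof -
    have "(v has_real_derivative q (- x) / p (- x) * v (- x)) (at (- x))" using v[of "- x"] that by simp
    then show ?thesis by (simp add: DERIV_mirror)
  qed
  from gap.homogeneous_zero_right[OF gap_reflect this, of "- x"] show ?thesis
    using c q x by (simp add: filterlim_at_left_to_right)
qed

text \<open>The product u exp (- w) vanishes at both ends and has derivative C exp (- w), which has
  a fixed sign unless C = 0; Rolle's theorem decides.\<close>

lemma repelling_both_ends:
  assumes u: "\<And>x. \<alpha> < x \<Longrightarrow> x < \<beta> \<Longrightarrow> (u has_real_derivative q x / p x * u x + C) (at x)"
    and l: "(u \<longlongrightarrow> 0) (at_right \<alpha>)" "(u \<longlongrightarrow> 0) (at_left \<beta>)" and q: "q \<alpha> < 0" "0 < q \<beta>"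
  shows "C = 0"
proof -
  obtain w where w: "potential \<alpha> \<beta> w" using potential_exists by blast
  define \<phi> where "\<phi> = (\<lambda>x. u x * exp (- w x))"
  have d: "(\<phi> has_real_derivative C * exp (- w x)) (at x)" if "\<alpha> < x" "x < \<beta>" for x
    unfolding \<phi>_def using potential_factor[OF w that u[OF that]] .
  have r: "(\<phi> \<longlongrightarrow> 0) (at_right \<alpha>)"
    using tendsto_mult[OF l(1) exp_potential_limit_right[OF q(1) w]] by (simp add: \<phi>_def)
  have lf: "(\<phi> \<longlongrightarrow> 0) (at_left \<beta>)"
    using tendsto_mult[OF l(2) exp_potential_limit_left[OF q(2) w]] by (simp add: \<phi>_def)
  \<comment> \<open>Rolle's theorem needs values at the end points, where \<open>w\<close> is not
    controlled; the limit 0 is put in.\<close>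
  define \<psi> where "\<psi> = (\<lambda>x. if \<alpha> < x \<and> x < \<beta> then \<phi> x else 0)"
  have ev: "\<forall>\<^sub>F y in nhds x. \<phi> y = \<psi> y" if "\<alpha> < x" "x < \<beta>" for x
    using that by (intro eventually_nhds_in_open[of "{\<alpha><..<\<beta>}", THEN eventually_mono]) (auto simp: \<psi>_def)
  have d': "(\<psi> has_real_derivative C * exp (- w x)) (at x)" if "\<alpha> < x" "x < \<beta>" for x
    using d[OF that] DERIV_cong_ev[OF refl ev[OF that] refl] by simp
  have "continuous_on {\<alpha>..\<beta>} \<psi>"
  proof (rule continuous_on_IccI[OF _ _ _ ab])
    show "(\<psi> \<longlongrightarrow> \<psi> \<alpha>) (at_right \<alpha>)"
      by (rule Lim_transform_eventually) (use r in \<open>auto simp: \<psi>_def intro!: eventually_at_right_gapI[OF ab]\<close>)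
    show "(\<psi> \<longlongrightarrow> \<psi> \<beta>) (at_left \<beta>)"
      by (rule Lim_transform_eventually) (use lf in \<open>auto simp: \<psi>_def intro!: eventually_at_left_gapI[OF ab]\<close>)
    show "\<psi> \<midarrow>x\<rightarrow> \<psi> x" if "\<alpha> < x" "x < \<beta>" for x
      using DERIV_isCont[OF d'[OF that]] by (simp add: isCont_def)
  qed
  then obtain \<xi> where "\<alpha> < \<xi>" "\<xi> < \<beta>" "(\<psi> has_real_derivative 0) (at \<xi>)"
    using Rolle[OF ab, of \<psi>] d' by (fastforce simp: \<psi>_def real_differentiable_def)
  then show ?thesis using DERIV_unique[OF d'] by fastforce
qed

end

section \<open>Weak and classical stationary solutions\<close>

lemma periodic_pi_int:
  fixes f :: "real \<Rightarrow> 'a"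
  assumes "\<And>x. f (x + pi) = f x"
  shows "f (x + of_int k * pi) = f x"
proof (induction k rule: int_induct[where k = 0])
  case (step1 i)
  then show ?case using assms[of "x + of_int i * pi"] by (simp add: algebra_simps)
next
  case (step2 i)
  then show ?case using assms[of "x + of_int (i - 1) * pi"] by (simp add: algebra_simps)
qed simp

lemma pi_translate_exists: "\<exists>k::int. a \<le> x + of_int k * pi \<and> x + of_int k * pi < a + pi"
proof (intro exI[of _ "- \<lfloor>(x - a) / pi\<rfloor>"])
  have "of_int \<lfloor>(x - a) / pi\<rfloor> * pi \<le> x - a"
    using of_int_floor_le[of "(x - a) / pi"] by (simp only: pos_le_divide_eq[OF pi_gt_zero])
  moreover have "x - a < (of_int \<lfloor>(x - a) / pi\<rfloor> + 1) * pi"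
    using real_of_int_floor_add_one_gt[of "(x - a) / pi"] by (simp only: pos_divide_less_eq[OF pi_gt_zero])
  ultimately show "a \<le> x + of_int (- \<lfloor>(x - a) / pi\<rfloor>) * pi \<and> x + of_int (- \<lfloor>(x - a) / pi\<rfloor>) * pi < a + pi"
    by (simp add: algebra_simps)
qed

lemma set_lborel_translate:
  fixes f :: "real \<Rightarrow> real"
  assumes "\<And>x. f (x - t) = f x"
  shows "set_integrable lborel {a..b} f \<Longrightarrow> set_integrable lborel {a + t..b + t} f"
    and "(LINT x:{a + t..b + t}|lborel. f x) = (LINT x:{a..b}|lborel. f x)"
proof -
  have eq: "(\<lambda>x. indicator {a + t..b + t} x *\<^sub>R f x)
      = (\<lambda>x. (\<lambda>y. indicator {a..b} y *\<^sub>R f y) (- t + 1 * x))"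
    using assms by (auto simp: indicator_def fun_eq_iff)
  show "set_integrable lborel {a..b} f \<Longrightarrow> set_integrable lborel {a + t..b + t} f"
    unfolding set_integrable_def eq by (rule lborel_integrable_real_affine) auto
  show "(LINT x:{a + t..b + t}|lborel. f x) = (LINT x:{a..b}|lborel. f x)"
    unfolding set_lebesgue_integral_def eq
    using lborel_integral_real_affine[of 1 "\<lambda>y. indicator {a..b} y *\<^sub>R f y" "- t"] by simp
qed

lemma set_integrable_continuous_mult:
  fixes f g :: "real \<Rightarrow> real"
  assumes f: "set_integrable lborel {a..b} f" and g: "continuous_on UNIV g"
  shows "set_integrable lborel {a..b} (\<lambda>x. g x * f x)"
proof -
  have "compact (g ` {a..b})"
    using g by (intro compact_continuous_image continuous_on_subset[OF g]) auto
  then obtain B where B: "\<And>x. x \<in> {a..b} \<Longrightarrow> \<bar>g x\<bar> \<le> B"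
    using compact_imp_bounded bounded_real by (metis imageI)
  have [measurable]: "g \<in> borel_measurable lborel"
    using borel_measurable_continuous_onI[OF g] by simp
  have fi: "integrable lborel (\<lambda>x. indicator {a..b} x *\<^sub>R f x)" using f by (simp add: set_integrable_def)
  have [measurable]: "(\<lambda>x. indicator {a..b} x *\<^sub>R f x) \<in> borel_measurable lborel"
    by (rule borel_measurable_integrable[OF fi])
  have "integrable lborel (\<lambda>x. g x * (indicator {a..b} x *\<^sub>R f x))"
  proof (rule Bochner_Integration.integrable_bound[OF integrable_mult_right[OF fi, of B]])
    show "AE x in lborel. norm (g x * (indicator {a..b} x *\<^sub>R f x)) \<le> norm (B * (indicator {a..b} x *\<^sub>R f x))"
    proof (rule AE_I2)
      fix x
      show "norm (g x * (indicator {a..b} x *\<^sub>R f x)) \<le> norm (B * (indicator {a..b} x *\<^sub>R f x))"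
        using B[of x] abs_ge_self[of B] by (cases "x \<in> {a..b}")
          (auto simp: abs_mult intro!: mult_right_mono intro: order_trans)
    qed
  qed measurable
  then show ?thesis unfolding set_integrable_def by (simp add: mult.left_commute)
qed

context fokker_planck
begin

text \<open>At a zero of \<open>p\<close> the equation is singular and only continuity is demanded,
  so a solution may be assembled gap by gap.\<close>

definition solution where
  "solution C \<rho> \<longleftrightarrow> (\<forall>x. \<rho> (x + pi) = \<rho> x) \<and> (\<forall>x. isCont \<rho> x) \<and>
     (\<forall>x. p x \<noteq> 0 \<longrightarrow> (\<rho> has_real_derivative (C - (p' x - q x) * \<rho> x) / p x) (at x))"

text \<open>Intervals of length at most one suffice, since everything below is local.\<close>
definition weak_solution where
  "weak_solution C \<rho> \<longleftrightarrow> (\<forall>x. \<rho> (x + pi) = \<rho> x) \<and>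
     (\<forall>x y. x \<le> y \<longrightarrow> y \<le> x + 1 \<longrightarrow> set_integrable lborel {x..y} \<rho> \<and>
        p y * \<rho> y - p x * \<rho> x = integral {x..y} (\<lambda>t. q t * \<rho> t + C))"

lemma continuous_on_q: "continuous_on S q"
  by (simp add: continuous_at_imp_continuous_on cq)

lemma flux_integrable:
  assumes "set_integrable lborel {x..y} \<rho>"
  shows "set_integrable lborel {x..y} (\<lambda>t. q t * \<rho> t + C)"
  by (intro set_integral_add set_integrable_continuous_mult assms continuous_on_q
      borel_integrable_atLeastAtMost' continuous_on_const)

text \<open>The definition of a groundstate speaks of the single interval from 0 to pi, whose end
  points may be zeros of \<open>p\<close>. Subtraction, translation by multiples of pi and joining
  at these multiples give the equation around every point.\<close>

lemma groundstate_imp_weak_solution: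
  assumes "groundstate p q \<rho>"
  shows "\<exists>C. weak_solution C \<rho>"
proof -
  have per\<rho>: "\<And>x. \<rho> (x + pi) = \<rho> x" and int0: "set_integrable lborel {0..pi} \<rho>"
    using assms by (auto simp: groundstate_def)
  obtain C where C: "\<And>\<theta>. 0 \<le> \<theta> \<Longrightarrow> \<theta> \<le> pi \<Longrightarrow>
      p \<theta> * \<rho> \<theta> - p 0 * \<rho> 0 = (LINT t:{0..\<theta>}|lborel. q t * \<rho> t + C)"
    using assms by (auto simp: groundstate_def)
  define f where "f = (\<lambda>t. q t * \<rho> t + C)"
  define W where "W = (\<lambda>x y. set_integrable lborel {x..y} \<rho> \<and> p y * \<rho> y - p x * \<rho> x = integral {x..y} f)"
  have fint: "set_integrable lborel {x..y} f" if "set_integrable lborel {x..y} \<rho>" for x y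
    unfolding f_def by (rule flux_integrable[OF that])
  have W0: "W x y" if xy: "0 \<le> x" "x \<le> y" "y \<le> pi" for x y
  proof -
    have s: "set_integrable lborel {x..y} \<rho>" if "0 \<le> x" "y \<le> pi" for x y
      by (rule set_integrable_subset[OF int0]) (use that in auto)
    have e: "p x * \<rho> x - p 0 * \<rho> 0 = integral {0..x} f" if "0 \<le> x" "x \<le> pi" for x
      using C[of x] that set_borel_integral_eq_integral(2)[OF fint[OF s[of 0 x]]] by (simp add: f_def)
    have "integral {0..x} f + integral {x..y} f = integral {0..y} f"
      using xy set_borel_integral_eq_integral(1)[OF fint[OF s[of 0 y]]]
      by (intro Henstock_Kurzweil_Integration.integral_combine) auto
    then show ?thesis using e[of x] e[of y] s[of x y] xy by (simp add: W_def)
  qed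
  have Wk: "W x y" if xy: "of_int k * pi \<le> x" "x \<le> y" "y \<le> of_int k * pi + pi" for x y and k :: int
  proof -
    define t where "t = of_int k * pi"
    have W1: "W (x - t) (y - t)" using xy by (intro W0) (auto simp: t_def)
    have perk: "g (z - t) = g z" if "\<And>z. g (z + pi) = g z" for g :: "real \<Rightarrow> real" and z
      using periodic_pi_int[of g z "- k"] that by (simp add: t_def)
    have perf: "f (z - t) = f z" for z
      using perk[of q, OF per(3)] perk[of \<rho>, OF per\<rho>] by (simp add: f_def)
    have s: "set_integrable lborel {x..y} \<rho>"
      using set_lborel_translate(1)[of \<rho> t "x - t" "y - t", OF perk[of \<rho>, OF per\<rho>]] W1 by (simp add: W_def)
    have "integral {x..y} f = integral {x - t..y - t} f"
      using set_lborel_translate(2)[of f t "x - t" "y - t", OF perf] W1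
        set_borel_integral_eq_integral(2)[OF fint[OF s]]
        set_borel_integral_eq_integral(2)[OF fint, of "x - t" "y - t"] by (simp add: W_def)
    then show ?thesis
      using W1 s perk[of \<rho>, OF per\<rho>] perk[of p, OF per(1)] by (simp add: W_def)
  qed
  have join: "W x z" if "W x y" "W y z" "x \<le> y" "y \<le> z" for x y z
  proof -
    have "{x..z} = {x..y} \<union> {y..z}" using that by auto
    then have s: "set_integrable lborel {x..z} \<rho>"
      using that by (auto simp: W_def intro!: set_integrable_Un)
    moreover have "integral {x..y} f + integral {y..z} f = integral {x..z} f"
      using that set_borel_integral_eq_integral(1)[OF fint[OF s]]
      by (intro Henstock_Kurzweil_Integration.integral_combine)
    ultimately show ?thesis using that by (simp add: W_def)
  qed
  \<comment> \<open>An interval of length at most 1 < pi has at most one multiple of pi in its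
    interior, so at most two pieces are joined.\<close>
  have "W x y" if xy: "x \<le> y" "y \<le> x + 1" for x y
  proof -
    obtain j where j: "0 \<le> x + of_int j * pi" "x + of_int j * pi < 0 + pi"
      using pi_translate_exists[of 0 x] by blast
    define k where "k = - j"
    have k: "of_int k * pi \<le> x" "x < of_int k * pi + pi" using j by (auto simp: k_def)
    show ?thesis
    proof (cases "y \<le> of_int k * pi + pi")
      case True
      then show ?thesis using Wk k xy by blast
    next
      case False
      have "W x (of_int k * pi + pi)" using k by (intro Wk[of k]) auto
      moreover have e: "of_int (k + 1) * pi = of_int k * pi + pi" by (simp add: distrib_right)
      have "y \<le> of_int k * pi + pi + pi" using k xy pi_gt3 by linarith
      then have "W (of_int k * pi + pi) y"
        using False by (intro Wk[of "k + 1"]) (use e in linarith)+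
      ultimately show ?thesis using False k by (intro join[of x "of_int k * pi + pi" y]) auto
    qed
  qed
  then show ?thesis using per\<rho> unfolding weak_solution_def W_def f_def by blast
qed

text \<open>The flux is an indefinite integral up to a constant. Its continuity at a zero of
  \<open>p\<close> is the boundary condition, flux 0, for the analysis of the gaps.\<close>

lemma weak_solution_isCont:
  assumes "weak_solution C \<rho>"
  shows "isCont (\<lambda>x. p x * \<rho> x) x"
proof -
  define a where "a = x - 1/2"
  define f where "f = (\<lambda>t. q t * \<rho> t + C)"
  have "set_integrable lborel {a..a+1} \<rho>" using assms by (simp add: weak_solution_def)
  then have "f integrable_on {a..a+1}" unfolding f_def
    by (intro set_borel_integral_eq_integral flux_integrable)
  then have "continuous_on {a..a+1} (\<lambda>y. p a * \<rho> a + integral {a..y} f)"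
    by (intro continuous_intros indefinite_integral_continuous_1)
  moreover have "p y * \<rho> y = p a * \<rho> a + integral {a..y} f" if "y \<in> {a..a+1}" for y
  proof -
    have "p y * \<rho> y - p a * \<rho> a = integral {a..y} f"
      using assms that unfolding weak_solution_def f_def by auto
    then show ?thesis by linarith
  qed
  ultimately have "continuous_on {a..a+1} (\<lambda>y. p y * \<rho> y)"
    by (metis (no_types, lifting) continuous_on_cong)
  then show ?thesis
    by (rule continuous_on_interior) (simp add: a_def)
qed

text \<open>Where p > 0, dividing the continuous flux by \<open>p\<close> shows that \<rho> is
  continuous; hence so is the integrand, and the fundamental theorem of calculus applies.\<close>

lemma weak_solution_deriv:
  assumes "weak_solution C \<rho>" and "p x \<noteq> 0"
  shows "((\<lambda>x. p x * \<rho> x) has_real_derivative q x / p x * (p x * \<rho> x) + C) (at x)"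
proof -
  have "0 < p x" using assms(2) nonneg[of x] by simp
  moreover have "(p \<longlongrightarrow> p x) (nhds x)"
    using cp[of x] by (simp add: isCont_def tendsto_at_iff_tendsto_nhds)
  ultimately have "\<forall>\<^sub>F y in nhds x. 0 < p y" by (intro order_tendstoD(1))
  then obtain e where e: "0 < e" "\<And>y. dist y x < e \<Longrightarrow> 0 < p y"
    unfolding eventually_nhds_metric by blast
  \<comment> \<open>The radius keeps \<open>p\<close> positive on the closed interval and its length
    at most 1, as \<open>weak_solution\<close> requires.\<close>
  define d where "d = min (e / 2) (1 / 2)"
  have d: "0 < d" "d \<le> 1/2" "d < e" using e by (auto simp: d_def)
  define a b where "a = x - d" and "b = x + d"
  define f where "f = (\<lambda>t. q t * \<rho> t + C)"
  have pn: "p y \<noteq> 0" if "y \<in> {a..b}" for y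
    using e(2)[of y] that d by (force simp: a_def b_def dist_real_def)
  have "continuous_on {a..b} (\<lambda>y. (p y * \<rho> y) / p y)"
    using pn by (intro continuous_on_divide continuous_at_imp_continuous_on ballI
      weak_solution_isCont[OF assms(1)] cp) auto
  moreover have "(p y * \<rho> y) / p y = \<rho> y" if "y \<in> {a..b}" for y using pn[OF that] by simp
  ultimately have "continuous_on {a..b} \<rho>" by (metis (no_types, lifting) continuous_on_cong)
  then have cf: "continuous_on {a..b} f" unfolding f_def by (intro continuous_intros continuous_on_q)
  have x: "x \<in> {a..b}" "x \<in> {a<..<b}" using d by (auto simp: a_def b_def)
  have "((\<lambda>y. integral {a..y} f) has_real_derivative f x) (at x within {a..b})"
    by (rule integral_has_real_derivative[OF cf x(1)])
  then have "((\<lambda>y. integral {a..y} f) has_real_derivative f x) (at x)"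
    using x by (metis at_within_Icc_at greaterThanLessThan_iff)
  then have D: "((\<lambda>y. p a * \<rho> a + integral {a..y} f) has_real_derivative f x) (at x)"
    using DERIV_add[OF DERIV_const[of "p a * \<rho> a"]] by fastforce
  have "p y * \<rho> y = p a * \<rho> a + integral {a..y} f" if "y \<in> {a<..<b}" for y
  proof -
    have "a \<le> y" "y \<le> a + 1" using that d by (auto simp: a_def b_def)
    then have "p y * \<rho> y - p a * \<rho> a = integral {a..y} f"
      using assms(1) unfolding weak_solution_def f_def by blast
    then show ?thesis by linarith
  qed
  then have "\<forall>\<^sub>F y in nhds x. p y * \<rho> y = p a * \<rho> a + integral {a..y} f"
    using x by (intro eventually_nhds_in_open[of "{a<..<b}", THEN eventually_mono]) auto
  from DERIV_cong_ev[OF refl this refl] D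
  have "((\<lambda>x. p x * \<rho> x) has_real_derivative f x) (at x)" by blast
  then show ?thesis using assms(2) by (simp add: f_def)
qed

text \<open>If the current \<open>C\<close> did not vanish, then \<open>p \<rho>\<close> would grow linearly at the zero \<open>z\<close> and
  \<open>\<rho>\<close> would have a non-integrable singularity there, because \<open>p\<close> vanishes quadratically.\<close>
lemma weak_solution_current_zero:
  assumes weak: "weak_solution C \<rho>" and z: "p z = 0" "q z = 0"
    and pos: "\<forall>\<^sub>F x in at_right z. 0 < p x"
  shows "C = 0"
proof (rule ccontr)
  assume "C \<noteq> 0"
  \<comment> \<open>The sign of the current, so that one growth argument serves both signs.\<close>
  define s where "s = sgn C"
  have s: "s * C = \<bar>C\<bar>" "\<bar>s\<bar> = 1" using \<open>C \<noteq> 0\<close> by (auto simp: s_def sgn_if)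
  have Cpos: "0 < \<bar>C\<bar>" using \<open>C \<noteq> 0\<close> by simp
  define u where "u = (\<lambda>x. p x * \<rho> x)"
  have sint: "set_integrable lborel {x..y} \<rho>" if "x \<le> y" "y \<le> x + 1" for x y
    using weak that by (simp add: weak_solution_def)
  have hk: "g integrable_on {x..y}" if "set_integrable lborel {x..y} g" for g :: "real \<Rightarrow> real" and x y
    using that by (rule set_borel_integral_eq_integral)
  have limR: "((\<lambda>x. integral {z..x} g) \<longlongrightarrow> 0) (at_right z)" if "g integrable_on {z..z+1}" for g :: "real \<Rightarrow> real"
  proof -
    have "continuous_on {z..z+1} (\<lambda>x. integral {z..x} g)"
      using that by (rule indefinite_integral_continuous_1)
    then have "((\<lambda>x. integral {z..x} g) \<longlongrightarrow> integral {z..z} g) (at z within {z..z+1})"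
      unfolding continuous_on_def by (rule bspec) simp
    then show ?thesis by (simp add: at_within_Icc_at_right)
  qed
  have ab1: "set_integrable lborel {z..x} (\<lambda>t. \<bar>\<rho> t\<bar>)" if "z \<le> x" "x \<le> z + 1" for x
    using set_integrable_abs[OF sint[OF that]] .
  \<comment> \<open>\<open>q\<close> vanishes at \<open>z\<close> and is differentiable there, so it
    is at most of linear size.\<close>
  obtain c where c: "0 < c" "\<forall>\<^sub>F x in at z. \<bar>q x\<bar> \<le> c * \<bar>x - z\<bar>"
  proof -
    have "((\<lambda>x. (q x - q z) / (x - z)) \<longlongrightarrow> q' z) (at z)" using dq[of z] by (simp add: has_field_derivative_iff)
    then have "((\<lambda>x. \<bar>q x / (x - z)\<bar>) \<longlongrightarrow> \<bar>q' z\<bar>) (at z)" using z by (intro tendsto_rabs) simp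
    then have "\<forall>\<^sub>F x in at z. \<bar>q x / (x - z)\<bar> < \<bar>q' z\<bar> + 1" by (rule order_tendstoD) simp
    moreover have "\<forall>\<^sub>F x in at z. x \<noteq> z" by (simp add: eventually_at_filter)
    ultimately have "\<forall>\<^sub>F x in at z. \<bar>q x\<bar> \<le> (\<bar>q' z\<bar> + 1) * \<bar>x - z\<bar>"
      by eventually_elim (simp add: field_simps abs_divide)
    then show thesis using that[of "\<bar>q' z\<bar> + 1"] by auto
  qed
  then have "\<forall>\<^sub>F x in at_right z. \<bar>q x\<bar> \<le> c * \<bar>x - z\<bar>" by (simp add: eventually_at_split)
  then obtain b where b: "z < b" "\<And>x. z < x \<Longrightarrow> x < b \<Longrightarrow> \<bar>q x\<bar> \<le> c * \<bar>x - z\<bar>"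
    unfolding eventually_at_right_field by blast
  \<comment> \<open>With this threshold the drift term amounts to at most half of the current term
    \<open>C * (x - z)\<close>.\<close>
  have small: "\<forall>\<^sub>F x in at_right z. integral {z..x} (\<lambda>t. \<bar>\<rho> t\<bar>) < \<bar>C\<bar> / (2 * c)"
    using limR[OF hk[OF ab1]] c Cpos by (intro order_tendstoD) auto
  have near: "\<forall>\<^sub>F x in at_right z. z < x \<and> x < b \<and> x < z + 1"
    using b unfolding eventually_at_right_field by (intro exI[of _ "min b (z+1)"]) auto
  have lower: "\<forall>\<^sub>F x in at_right z. \<bar>C\<bar> / 2 * (x - z) \<le> s * u x"
    using small near
  proof eventually_elim
    case (elim x)
    have si: "set_integrable lborel {z..x} \<rho>" using elim by (intro sint) auto
    have qi: "(\<lambda>t. q t * \<rho> t) integrable_on {z..x}"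
      by (intro hk set_integrable_continuous_mult si continuous_on_q)
    have "u x = integral {z..x} (\<lambda>t. q t * \<rho> t + C)"
      using weak[unfolded weak_solution_def, THEN conjunct2, rule_format, of z x] elim z
      by (simp add: u_def)
    also have "\<dots> = integral {z..x} (\<lambda>t. q t * \<rho> t) + C * (x - z)"
      using elim qi by (subst Henstock_Kurzweil_Integration.integral_add) auto
    finally have ux: "u x = integral {z..x} (\<lambda>t. q t * \<rho> t) + C * (x - z)" .
    have "norm (integral {z..x} (\<lambda>t. q t * \<rho> t)) \<le> integral {z..x} (\<lambda>t. c * (x - z) * \<bar>\<rho> t\<bar>)"
    proof (rule integral_norm_bound_integral[OF qi])
      show "(\<lambda>t. c * (x - z) * \<bar>\<rho> t\<bar>) integrable_on {z..x}"
        using hk[OF ab1[of x]] elim by (intro integrable_on_mult_right) auto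
      fix t assume t: "t \<in> {z..x}"
      have "\<bar>q t\<bar> \<le> c * (x - z)"
      proof (cases "t = z")
        case True
        then show ?thesis using z c elim by simp
      next
        case False
        then have "\<bar>q t\<bar> \<le> c * \<bar>t - z\<bar>" using b(2)[of t] t elim by auto
        also have "\<dots> \<le> c * (x - z)" using t c by (intro mult_left_mono) auto
        finally show ?thesis .
      qed
      then show "norm (q t * \<rho> t) \<le> c * (x - z) * \<bar>\<rho> t\<bar>"
        by (simp add: abs_mult mult_right_mono)
    qed
    also have "\<dots> = c * (x - z) * integral {z..x} (\<lambda>t. \<bar>\<rho> t\<bar>)" by simp
    also have "\<dots> \<le> c * (x - z) * (\<bar>C\<bar> / (2 * c))" using elim c by (intro mult_left_mono) auto
    also have "\<dots> = \<bar>C\<bar> / 2 * (x - z)" using c by simp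
    finally have I: "\<bar>integral {z..x} (\<lambda>t. q t * \<rho> t)\<bar> \<le> \<bar>C\<bar> / 2 * (x - z)" by simp
    have "\<bar>s * integral {z..x} (\<lambda>t. q t * \<rho> t)\<bar> \<le> \<bar>C\<bar> / 2 * (x - z)"
      using I s by (simp add: abs_mult)
    moreover have "s * u x = s * integral {z..x} (\<lambda>t. q t * \<rho> t) + \<bar>C\<bar> * (x - z)"
      unfolding ux s(1)[symmetric] by (simp add: distrib_left mult.assoc)
    ultimately show ?case by (simp add: field_simps abs_if split: if_splits)
  qed
  obtain k where k: "0 < k" "\<forall>\<^sub>F x in at_right z. k / (x - z) \<le> s * u x / p x"
    using linear_growth_right[OF pos z(1) _ lower] Cpos by auto
  have low: "\<forall>\<^sub>F x in at_right z. k / (x - z) \<le> s * \<rho> x"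
    using k(2) pos by eventually_elim (simp add: u_def)
  \<comment> \<open>Where p > 0 the density is continuous. The base point of the integral is moved
    to some \<open>m > z\<close> so that only such points are involved.\<close>
  have Rder: "\<forall>\<^sub>F x in at_right z. ((\<lambda>x. s * integral {z..x} \<rho>) has_real_derivative s * \<rho> x) (at x)"
  proof -
    obtain e where e: "z < e" "\<And>x. z < x \<Longrightarrow> x < e \<Longrightarrow> 0 < p x"
      using pos unfolding eventually_at_right_field by blast
    have "((\<lambda>x. s * integral {z..x} \<rho>) has_real_derivative s * \<rho> x) (at x)"
      if x: "z < x" "x < min e (z + 1)" for x
    proof -
      have cr: "isCont \<rho> y" if "z < y" "y < e" for y
      proof -
        have "isCont (\<lambda>y. (p y * \<rho> y) / p y) y"
          using weak_solution_isCont[OF weak] cp e(2)[OF that] by (intro continuous_divide) auto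
        moreover have "\<forall>\<^sub>F t in nhds y. (p t * \<rho> t) / p t = \<rho> t"
          using that e(2) by (intro eventually_nhds_in_open[of "{z<..<e}", THEN eventually_mono])
            (auto dest!: e(2))
        ultimately show ?thesis by (simp add: isCont_cong)
      qed
      define m where "m = (z + x) / 2"
      define n where "n = (x + min e (z + 1)) / 2"
      have mn: "z < m" "m < x" "x < n" "n < e" "n < z + 1" using x by (auto simp: m_def n_def)
      have "((\<lambda>y. integral {m..y} \<rho>) has_real_derivative \<rho> x) (at x within {m..n})"
        using mn by (intro integral_has_real_derivative continuous_at_imp_continuous_on ballI cr) auto
      then have D: "((\<lambda>y. integral {m..y} \<rho>) has_real_derivative \<rho> x) (at x)"
        using mn by (metis at_within_Icc_at)
      have "integral {z..y} \<rho> = integral {z..m} \<rho> + integral {m..y} \<rho>" if "y \<in> {m<..<n}" for y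
        using that mn hk[OF sint[of z y]]
        by (intro Henstock_Kurzweil_Integration.integral_combine[symmetric]) auto
      then have "\<forall>\<^sub>F y in nhds x. integral {z..y} \<rho> = integral {z..m} \<rho> + integral {m..y} \<rho>"
        using mn by (intro eventually_nhds_in_open[of "{m<..<n}", THEN eventually_mono]) auto
      from DERIV_cong_ev[OF refl this refl] D
      have "((\<lambda>y. integral {z..y} \<rho>) has_real_derivative \<rho> x) (at x)"
        using DERIV_add[OF DERIV_const[of "integral {z..m} \<rho>"] D] by simp
      then show ?thesis by (rule DERIV_cmult)
    qed
    then show ?thesis using e unfolding eventually_at_right_field by (intro exI[of _ "min e (z + 1)"]) auto
  qed
  \<comment> \<open>The lower bound k/(x - z) on the density drives its integral from
    \<open>z\<close> to minus infinity as x tends to z, although an indefinite integral tends to 0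
    there.\<close>
  have "filterlim (\<lambda>x. s * integral {z..x} \<rho>) at_bot (at_right z)"
    by (rule log_growth_right[OF k(1) Rder low])
  moreover have "((\<lambda>x. s * integral {z..x} \<rho>) \<longlongrightarrow> s * 0) (at_right z)"
    by (intro tendsto_mult_left limR hk sint) auto
  ultimately show False
    using not_tendsto_and_filterlim_at_infinity[of "at_right z"] filterlim_at_bot_imp_at_infinity
    by (metis trivial_limit_at_right_real)
qed

lemma solution_deriv:
  assumes "solution C \<rho>" "p x \<noteq> 0"
  shows "((\<lambda>x. p x * \<rho> x) has_real_derivative q x / p x * (p x * \<rho> x) + C) (at x)"
proof -
  have "(\<rho> has_real_derivative (C - (p' x - q x) * \<rho> x) / p x) (at x)"
    using assms by (simp add: solution_def)
  from DERIV_mult[OF dp this] show ?thesis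
    by (rule back_subst) (use assms(2) in \<open>simp add: field_simps\<close>)
qed

end

section \<open>From continuous solutions to unique groundstates\<close>

locale fokker_planck_finite = fokker_planck +
  assumes finite_zeros: "\<And>a b. finite {x \<in> {a..b}. p x = 0}"
begin

text \<open>The flux is continuous, and differentiable off the zeros of \<open>p\<close>. Finitely
  many exceptional points are harmless in the fundamental theorem of calculus.\<close>

lemma solution_imp_groundstate:
  assumes sol: "solution C \<rho>" and nn: "\<And>x. 0 \<le> \<rho> x" and J: "integral {0..pi} \<rho> = 1"
  shows "groundstate p q \<rho>"
proof -
  have per\<rho>: "\<And>x. \<rho> (x + pi) = \<rho> x" and c: "\<And>x. isCont \<rho> x"
    using sol by (auto simp: solution_def)
  have co: "continuous_on S \<rho>" for S using c by (simp add: continuous_at_imp_continuous_on)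
  have int: "set_integrable lborel {x..y} \<rho>" for x y
    by (rule borel_integrable_atLeastAtMost'[OF co])
  have "p \<theta> * \<rho> \<theta> - p 0 * \<rho> 0 = (LINT t:{0..\<theta>}|lborel. q t * \<rho> t + C)" if "\<theta> \<in> {0..pi}" for \<theta>
  proof -
    have "((\<lambda>t. q t * \<rho> t + C) has_integral (p \<theta> * \<rho> \<theta> - p 0 * \<rho> 0)) {0..\<theta>}"
    proof (rule fundamental_theorem_of_calculus_interior_strong[OF finite_zeros[of 0 \<theta>]])
      show "continuous_on {0..\<theta>} (\<lambda>x. p x * \<rho> x)"
        by (intro continuous_intros co) (simp add: continuous_at_imp_continuous_on cp)
      fix x assume x: "x \<in> {0<..<\<theta>} - {x \<in> {0..\<theta>}. p x = 0}"
      then have "((\<lambda>x. p x * \<rho> x) has_real_derivative q x * \<rho> x + C) (at x)"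
        using solution_deriv[OF sol, of x] by auto
      then show "((\<lambda>x. p x * \<rho> x) has_vector_derivative q x * \<rho> x + C) (at x)"
        by (simp add: has_real_derivative_iff_has_vector_derivative)
    qed (use that in auto)
    then show ?thesis
      using set_borel_integral_eq_integral(2)[OF flux_integrable[OF int, of 0 \<theta> C]]
      by (simp add: integral_unique)
  qed
  then show ?thesis
    unfolding groundstate_def using per\<rho> int set_borel_integral_eq_integral(2)[OF int] J by auto
qed

lemma AE_nonzero: "AE x in lborel. p x \<noteq> 0"
proof -
  have "{x. p x = 0} \<subseteq> (\<Union>n::nat. {x \<in> {- real n..real n}. p x = 0})"
  proof
    fix x assume "x \<in> {x. p x = 0}"
    moreover have "x \<in> {- real (nat \<lceil>\<bar>x\<bar>\<rceil>)..real (nat \<lceil>\<bar>x\<bar>\<rceil>)}"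
      using real_nat_ceiling_ge[of "\<bar>x\<bar>"] unfolding atLeastAtMost_iff by linarith
    ultimately show "x \<in> (\<Union>n::nat. {x \<in> {- real n..real n}. p x = 0})" by blast
  qed
  moreover have "countable (\<Union>n::nat. {x \<in> {- real n..real n}. p x = 0})"
    by (rule countable_UN, simp, rule countable_finite[OF finite_zeros])
  ultimately have "countable {x. p x = 0}" by (rule countable_subset)
  then have "{x. p x = 0} \<in> null_sets lborel" by (rule countable_imp_null_set_lborel)
  from AE_not_in[OF this] show ?thesis by simp
qed

text \<open>Reduces existence and uniqueness to one nonnegative nonzero solution of which every weak
  solution is a multiple off the zeros of \<open>p\<close>. The fact that the current vanishes as
  soon as a zero with q = 0 exists is passed on, because smoothness at an order 4 zero depends on
  it.\<close>

lemma unique_groundstate: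
  assumes sol: "solution C \<rho>" and nn: "\<And>x. 0 \<le> \<rho> x" and ne: "\<rho> x0 \<noteq> 0"
    and proportional: "\<And>C1 \<rho>1. weak_solution C1 \<rho>1 \<Longrightarrow> \<exists>\<kappa>. \<forall>x. p x \<noteq> 0 \<longrightarrow> \<rho>1 x = \<kappa> * \<rho> x"
    and C: "\<And>z. p z = 0 \<Longrightarrow> q z = 0 \<Longrightarrow> C = 0"
  shows "\<exists>C \<rho>. solution C \<rho> \<and> groundstate p q \<rho> \<and> (\<forall>x. 0 \<le> \<rho> x) \<and>
    (\<forall>\<rho>'. groundstate p q \<rho>' \<longrightarrow> (AE x in lborel. \<rho>' x = \<rho> x)) \<and>
    (\<forall>z. p z = 0 \<longrightarrow> q z = 0 \<longrightarrow> C = 0)"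
proof -
  have per\<rho>: "\<And>x. \<rho> (x + pi) = \<rho> x" and c: "\<And>x. isCont \<rho> x"
    using sol by (auto simp: solution_def)
  have co: "continuous_on S \<rho>" for S using c by (simp add: continuous_at_imp_continuous_on)
  define J where "J = integral {0..pi} \<rho>"
  obtain k :: int where k: "0 \<le> x0 + of_int k * pi" "x0 + of_int k * pi < 0 + pi"
    using pi_translate_exists by blast
  have "\<rho> (x0 + of_int k * pi) \<noteq> 0" using ne periodic_pi_int[of \<rho>] per\<rho> by simp
  \<comment> \<open>A nonnegative continuous function with vanishing integral over a period would
    vanish on that period.\<close>
  then have "J \<noteq> 0" unfolding J_def
    using integral_eq_0_iff[OF co, of 0 pi] nn k by force
  moreover have "0 \<le> J" unfolding J_def using nn integrable_continuous_real[OF co]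
    by (intro Henstock_Kurzweil_Integration.integral_nonneg) auto
  ultimately have J: "0 < J" by simp
  define r where "r = (\<lambda>x. \<rho> x / J)"
  have solr: "solution (C / J) r"
    unfolding solution_def
  proof (intro conjI allI impI)
    show "r (x + pi) = r x" "isCont r x" for x
      unfolding r_def using per\<rho> c J by (auto intro!: continuous_intros)
    fix x assume "p x \<noteq> 0"
    then have "(\<rho> has_real_derivative (C - (p' x - q x) * \<rho> x) / p x) (at x)"
      using sol by (simp add: solution_def)
    from DERIV_cdivide[OF this, of J]
    show "(r has_real_derivative (C / J - (p' x - q x) * r x) / p x) (at x)"
      unfolding r_def by (rule back_subst) (use J in \<open>simp add: field_simps\<close>)
  qed
  have nr: "0 \<le> r x" for x using nn J by (simp add: r_def)
  have Jr: "integral {0..pi} r = 1" using J by (simp add: r_def J_def)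
  have gr: "groundstate p q r" using solution_imp_groundstate[OF solr nr Jr] .
  have "AE x in lborel. \<rho>' x = r x" if g: "groundstate p q \<rho>'" for \<rho>'
  proof -
    obtain \<kappa> where \<kappa>: "\<And>x. p x \<noteq> 0 \<Longrightarrow> \<rho>' x = \<kappa> * \<rho> x"
      using groundstate_imp_weak_solution[OF g] proportional by blast
    have \<kappa>': "\<rho>' x = \<kappa> * J * r x" if "p x \<noteq> 0" for x using \<kappa>[OF that] J by (simp add: r_def)
    have ae: "AE x in lborel. indicator {0..pi} x *\<^sub>R \<rho>' x = indicator {0..pi} x *\<^sub>R (\<kappa> * J * r x)"
      using AE_nonzero by (rule eventually_mono) (simp add: \<kappa>')
    have "set_integrable lborel {0..pi} \<rho>'" "set_integrable lborel {0..pi} (\<lambda>x. \<kappa> * J * r x)"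
      using g gr by (auto simp: groundstate_def)
    then have "(LINT x:{0..pi}|lborel. \<rho>' x) = (LINT x:{0..pi}|lborel. \<kappa> * J * r x)"
      unfolding set_lebesgue_integral_def set_integrable_def
      by (intro integral_cong_AE ae) (auto dest: borel_measurable_integrable)
    \<comment> \<open>Both densities have integral 1, which fixes the factor.\<close>
    then have "\<kappa> * J = 1" using g gr by (simp add: groundstate_def)
    then have "\<rho>' x = r x" if "p x \<noteq> 0" for x using \<kappa>'[OF that] by simp
    then show ?thesis using AE_nonzero by (auto elim: eventually_mono)
  qed
  then show ?thesis using solr gr nr C by (intro exI[of _ "C / J"] exI[of _ r]) fastforce
qed

end

section \<open>Gluing solutions across the zeros\<close>

context fokker_planck
begin

text \<open>The period is cut at a zero of \<open>p\<close>, so that at the junction only the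
  equality of the two one-sided limits has to be checked.\<close>

lemma periodic_extension_solution:
  assumes z: "p \<alpha> = 0"
    and cH: "\<And>x. \<alpha> < x \<Longrightarrow> x < \<alpha> + pi \<Longrightarrow> isCont H x"
    and right: "(H \<longlongrightarrow> H \<alpha>) (at_right \<alpha>)" and left: "(H \<longlongrightarrow> H \<alpha>) (at_left (\<alpha> + pi))"
    and dH: "\<And>x. \<alpha> < x \<Longrightarrow> x < \<alpha> + pi \<Longrightarrow> p x \<noteq> 0 \<Longrightarrow>
      (H has_real_derivative (C - (p' x - q x) * H x) / p x) (at x)"
  shows "\<exists>\<rho>. solution C \<rho> \<and> (\<forall>x. \<alpha> \<le> x \<longrightarrow> x < \<alpha> + pi \<longrightarrow> \<rho> x = H x)"
proof -
  define \<rho> where "\<rho> = (\<lambda>x. H (x - of_int \<lfloor>(x - \<alpha>) / pi\<rfloor> * pi))"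
  have per\<rho>: "\<rho> (x + pi) = \<rho> x" for x
  proof -
    have "(x + pi - \<alpha>) / pi = (x - \<alpha>) / pi + 1" by (simp add: field_simps)
    then have "\<lfloor>(x + pi - \<alpha>) / pi\<rfloor> = \<lfloor>(x - \<alpha>) / pi\<rfloor> + 1" by simp
    then show ?thesis by (simp add: \<rho>_def algebra_simps)
  qed
  have \<rho>H: "\<rho> x = H x" if "\<alpha> \<le> x" "x < \<alpha> + pi" for x
  proof -
    have "\<lfloor>(x - \<alpha>) / pi\<rfloor> = 0" using that by (intro floor_unique) (auto simp: pos_divide_less_eq)
    then show ?thesis by (simp add: \<rho>_def)
  qed
  have evin: "\<forall>\<^sub>F y in nhds x. H y = \<rho> y" if "\<alpha> < x" "x < \<alpha> + pi" for x
    using that by (intro eventually_nhds_in_open[of "{\<alpha><..<\<alpha>+pi}", THEN eventually_mono]) (auto simp: \<rho>H)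
  have c0: "isCont \<rho> x" if x: "\<alpha> \<le> x" "x < \<alpha> + pi" for x
  proof (cases "x = \<alpha>")
    case False
    then show ?thesis using cH[of x] isCont_cong[OF evin[of x]] x by auto
  next
    case True
    have "\<forall>\<^sub>F x in at_right \<alpha>. H x = \<rho> x"
      unfolding eventually_at_right_field by (intro exI[of _ "\<alpha> + pi"]) (auto simp: \<rho>H)
    then have R: "(\<rho> \<longlongrightarrow> H \<alpha>) (at_right \<alpha>)" by (rule Lim_transform_eventually[OF right])
    have "filterlim (\<lambda>y. y + pi) (at_left (\<alpha> + pi)) (at_left \<alpha>)"
      unfolding filterlim_at
      by (auto intro!: tendsto_eq_intros simp: eventually_at_filter)
    then have "((\<lambda>y. H (y + pi)) \<longlongrightarrow> H \<alpha>) (at_left \<alpha>)" by (rule filterlim_compose[OF left])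
    moreover have "\<forall>\<^sub>F y in at_left \<alpha>. H (y + pi) = \<rho> y"
      unfolding eventually_at_left_field
    proof (intro exI[of _ "\<alpha> - pi"] conjI allI impI)
      fix y assume "\<alpha> - pi < y" "y < \<alpha>"
      then have "H (y + pi) = \<rho> (y + pi)" by (intro \<rho>H[symmetric]) auto
      then show "H (y + pi) = \<rho> y" by (simp add: per\<rho>)
    qed simp
    ultimately have L: "(\<rho> \<longlongrightarrow> H \<alpha>) (at_left \<alpha>)" by (rule Lim_transform_eventually)
    show ?thesis using R L True \<rho>H[of \<alpha>] by (simp add: isCont_def filterlim_at_split)
  qed
  have shift: "\<rho> = (\<lambda>y. \<rho> (y + of_int k * pi))" for k :: int
    using periodic_pi_int[of \<rho>] per\<rho> by auto
  have "isCont \<rho> x" for x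
  proof -
    obtain k :: int where k: "\<alpha> \<le> x + of_int k * pi" "x + of_int k * pi < \<alpha> + pi"
      using pi_translate_exists by blast
    have "isCont (\<lambda>y. \<rho> (y + of_int k * pi)) x"
      using isCont_o2[of x "\<lambda>y. y + of_int k * pi" \<rho>] c0[OF k] by simp
    then show ?thesis using shift[of k] by simp
  qed
  moreover have "(\<rho> has_real_derivative (C - (p' x - q x) * \<rho> x) / p x) (at x)" if px: "p x \<noteq> 0" for x
  proof -
    obtain k :: int where k: "\<alpha> \<le> x + of_int k * pi" "x + of_int k * pi < \<alpha> + pi"
      using pi_translate_exists by blast
    define y where "y = x + of_int k * pi"
    have e: "p y = p x" "p' y = p' x" "q y = q x" "\<rho> y = \<rho> x"
      using periodic_pi_int[of p] periodic_pi_int[of p'] periodic_pi_int[of q] periodic_pi_int[of \<rho>] per per\<rho>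
      by (auto simp: y_def)
    have y: "\<alpha> < y" "y < \<alpha> + pi" using k px e z by (auto simp: y_def order_le_less)
    have "(H has_real_derivative (C - (p' y - q y) * H y) / p y) (at y)"
      using dH[OF y] px e by simp
    then have "(\<rho> has_real_derivative (C - (p' x - q x) * \<rho> x) / p x) (at y)"
      using DERIV_cong_ev[OF refl evin[OF y] refl] \<rho>H[of y] y e by simp
    then have "((\<lambda>t. \<rho> (t + of_int k * pi)) has_real_derivative (C - (p' x - q x) * \<rho> x) / p x) (at x)"
      unfolding y_def by (simp add: DERIV_shift)
    then show ?thesis using shift[of k] by simp
  qed
  ultimately have "solution C \<rho>" using per\<rho> by (simp add: solution_def)
  then show ?thesis using \<rho>H by blast
qed

text \<open>The case \<open>\<beta> = \<alpha> + pi\<close> stands for a single zero modulo pi: the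
  second gap is then empty, the hypotheses on \<open>h2\<close> are vacuous, and the two boundary
  values must agree.\<close>

lemma two_gap_solution:
  assumes ab: "\<alpha> < \<beta>" "\<beta> \<le> \<alpha> + pi" and z: "p \<alpha> = 0" "p \<beta> = 0"
    and h1: "\<And>x. \<alpha> < x \<Longrightarrow> x < \<beta> \<Longrightarrow>
      0 \<le> h1 x \<and> (h1 has_real_derivative (C - (p' x - q x) * h1 x) / p x) (at x)"
    and h2: "\<And>x. \<beta> < x \<Longrightarrow> x < \<alpha> + pi \<Longrightarrow>
      0 \<le> h2 x \<and> (h2 has_real_derivative (C - (p' x - q x) * h2 x) / p x) (at x)"
    and l1: "(h1 \<longlongrightarrow> va) (at_right \<alpha>)" "(h1 \<longlongrightarrow> vb) (at_left \<beta>)"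
    and l2: "\<beta> < \<alpha> + pi \<Longrightarrow> (h2 \<longlongrightarrow> vb) (at_right \<beta>)" "\<beta> < \<alpha> + pi \<Longrightarrow> (h2 \<longlongrightarrow> va) (at_left (\<alpha> + pi))"
    and v: "0 \<le> va" "0 \<le> vb" "\<beta> = \<alpha> + pi \<Longrightarrow> vb = va"
  shows "\<exists>\<rho>. solution C \<rho> \<and> (\<forall>x. 0 \<le> \<rho> x) \<and> (\<forall>x. \<alpha> < x \<longrightarrow> x < \<beta> \<longrightarrow> \<rho> x = h1 x)
    \<and> (\<forall>x. \<beta> < x \<longrightarrow> x < \<alpha> + pi \<longrightarrow> \<rho> x = h2 x)"
proof -
  define H where "H = (\<lambda>x. if x \<le> \<alpha> then va else if x < \<beta> then h1 x else if x = \<beta> then vb else h2 x)"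
  have H1: "H x = h1 x" if "\<alpha> < x" "x < \<beta>" for x using that by (simp add: H_def)
  have H2: "H x = h2 x" if "\<beta> < x" for x using that ab by (simp add: H_def)
  have e1: "\<forall>\<^sub>F y in nhds x. h1 y = H y" if "\<alpha> < x" "x < \<beta>" for x
    using that by (intro eventually_nhds_in_open[of "{\<alpha><..<\<beta>}", THEN eventually_mono]) (auto simp: H1)
  have e2: "\<forall>\<^sub>F y in nhds x. h2 y = H y" if "\<beta> < x" for x
    using that by (intro eventually_nhds_in_open[of "{\<beta><..}", THEN eventually_mono]) (auto simp: H2)
  have d1: "(H has_real_derivative (C - (p' x - q x) * H x) / p x) (at x)" if "\<alpha> < x" "x < \<beta>" for x
    using h1[OF that] DERIV_cong_ev[OF refl e1[OF that] refl] H1[OF that] by simp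
  have d2: "(H has_real_derivative (C - (p' x - q x) * H x) / p x) (at x)" if "\<beta> < x" "x < \<alpha> + pi" for x
    using h2[OF that] DERIV_cong_ev[OF refl e2[OF that(1)] refl] H2[OF that(1)] by simp
  have r1: "(H \<longlongrightarrow> va) (at_right \<alpha>)"
    by (rule Lim_transform_eventually[OF l1(1)]) (rule eventually_at_right_gapI[OF ab(1)], simp add: H1)
  have r2: "(H \<longlongrightarrow> vb) (at_left \<beta>)"
    by (rule Lim_transform_eventually[OF l1(2)]) (rule eventually_at_left_gapI[OF ab(1)], simp add: H1)
  have "\<exists>\<rho>. solution C \<rho> \<and> (\<forall>x. \<alpha> \<le> x \<longrightarrow> x < \<alpha> + pi \<longrightarrow> \<rho> x = H x)"
  proof (rule periodic_extension_solution[OF z(1)])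
    show "(H \<longlongrightarrow> H \<alpha>) (at_right \<alpha>)" using r1 by (simp add: H_def)
    show "(H \<longlongrightarrow> H \<alpha>) (at_left (\<alpha> + pi))"
    proof (cases "\<beta> = \<alpha> + pi")
      case True
      then show ?thesis using r2 v by (simp add: H_def)
    next
      case False
      then have lt: "\<beta> < \<alpha> + pi" using ab by simp
      have "(H \<longlongrightarrow> va) (at_left (\<alpha> + pi))"
        by (rule Lim_transform_eventually[OF l2(2)[OF lt]]) (rule eventually_at_left_gapI[OF lt], simp add: H2)
      then show ?thesis by (simp add: H_def)
    qed
    fix x assume x: "\<alpha> < x" "x < \<alpha> + pi"
    show "isCont H x"
    proof (cases "x = \<beta>")
      case True
      then have lt: "\<beta> < \<alpha> + pi" using x by simp
      have "(H \<longlongrightarrow> vb) (at_right \<beta>)"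
        by (rule Lim_transform_eventually[OF l2(1)[OF lt]]) (rule eventually_at_right_gapI[OF lt], simp add: H2)
      then show ?thesis using True r2 ab by (simp add: isCont_def filterlim_at_split H_def)
    next
      case False
      then show ?thesis using d1[of x] d2[of x] x DERIV_isCont by (cases "x < \<beta>") force+
    qed
    assume "p x \<noteq> 0"
    then have "x \<noteq> \<beta>" using z by auto
    then show "(H has_real_derivative (C - (p' x - q x) * H x) / p x) (at x)"
      using d1[of x] d2[of x] x by (cases "x < \<beta>") auto
  qed
  then obtain \<rho> where sol: "solution C \<rho>" and \<rho>: "\<And>x. \<alpha> \<le> x \<Longrightarrow> x < \<alpha> + pi \<Longrightarrow> \<rho> x = H x"
    by blast
  have Hnn: "0 \<le> H x" if "\<alpha> \<le> x" "x < \<alpha> + pi" for x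
    using that h1[of x] h2[of x] v ab by (auto simp: H_def)
  have "0 \<le> \<rho> x" for x
  proof -
    obtain k :: int where k: "\<alpha> \<le> x + of_int k * pi" "x + of_int k * pi < \<alpha> + pi"
      using pi_translate_exists by blast
    have "\<rho> x = \<rho> (x + of_int k * pi)" using sol periodic_pi_int[of \<rho>] by (auto simp: solution_def)
    then show ?thesis using \<rho>[OF k] Hnn[OF k] by simp
  qed
  then show ?thesis using sol \<rho> H1 H2 ab by (intro exI[of _ \<rho>]) auto
qed

lemma proportional_by_period:
  fixes r \<rho> :: "real \<Rightarrow> real"
  assumes "\<And>x. r (x + pi) = r x" "\<And>x. \<rho> (x + pi) = \<rho> x"
    and "\<And>x. \<alpha> \<le> x \<Longrightarrow> x < \<alpha> + pi \<Longrightarrow> p x \<noteq> 0 \<Longrightarrow> r x = \<kappa> * \<rho> x"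
  shows "\<forall>x. p x \<noteq> 0 \<longrightarrow> r x = \<kappa> * \<rho> x"
proof (intro allI impI)
  fix x assume px: "p x \<noteq> 0"
  obtain k :: int where k: "\<alpha> \<le> x + of_int k * pi" "x + of_int k * pi < \<alpha> + pi"
    using pi_translate_exists by blast
  then show "r x = \<kappa> * \<rho> x"
    using assms(3)[OF k] px periodic_pi_int[of p] per periodic_pi_int[of r] periodic_pi_int[of \<rho>] assms(1,2)
    by simp
qed

lemma weak_solution_limit:
  assumes "weak_solution C \<rho>" "p z = 0"
  shows "((\<lambda>x. p x * \<rho> x) \<longlongrightarrow> 0) (at_right z)" "((\<lambda>x. p x * \<rho> x) \<longlongrightarrow> 0) (at_left z)"
  using weak_solution_isCont[OF assms(1), of z] assms(2) by (auto simp: isCont_def filterlim_at_split)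

end

section \<open>Groundstates for each sign pattern of the drift\<close>

context fokker_planck_finite
begin

text \<open>The drift points in the same direction at all zeros of the diffusion coefficient, so a nonzero
  current \<open>C\<close> circulates.\<close>
lemma rotating_groundstate:
  assumes ab: "\<alpha> < \<beta>" "\<beta> \<le> \<alpha> + pi" and z: "p \<alpha> = 0" "p \<beta> = 0"
    and pos1: "\<And>x. \<alpha> < x \<Longrightarrow> x < \<beta> \<Longrightarrow> 0 < p x"
    and pos2: "\<And>x. \<beta> < x \<Longrightarrow> x < \<alpha> + pi \<Longrightarrow> 0 < p x"
    and sgn: "(0 < q \<alpha> \<and> 0 < q \<beta>) \<or> (q \<alpha> < 0 \<and> q \<beta> < 0)"
  shows "\<exists>C \<rho>. solution C \<rho> \<and> groundstate p q \<rho> \<and> (\<forall>x. 0 \<le> \<rho> x) \<and>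
    (\<forall>\<rho>'. groundstate p q \<rho>' \<longrightarrow> (AE x in lborel. \<rho>' x = \<rho> x)) \<and>
    (\<forall>z. p z = 0 \<longrightarrow> q z = 0 \<longrightarrow> C = 0)"
proof -
  \<comment> \<open>A normalization of the current; its sign is opposite to that of
    \<open>q\<close>, which makes the boundary values \<open>- C / q\<close> positive.\<close>
  define C where "C = - sgn (q \<alpha>)"
  have C: "C \<noteq> 0" using sgn by (auto simp: C_def sgn_if)
  have Cq: "0 < - C / q \<alpha>" "0 < - C / q \<beta>" using sgn by (auto simp: C_def sgn_if)
  have z2: "p (\<alpha> + pi) = 0" "q (\<alpha> + pi) = q \<alpha>" using per z by auto
  interpret g1: gap p p' q q' \<alpha> \<beta>
    by unfold_locales (use ab z pos1 in auto)
  have g2: "gap p p' q q' \<beta> (\<alpha> + pi)" if "\<beta> < \<alpha> + pi"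
    by unfold_locales (use that z z2 pos2 in auto)
  have driven: "\<exists>h. (\<forall>x. a < x \<longrightarrow> x < b \<longrightarrow> 0 < h x \<and>
            (h has_real_derivative (C - (p' x - q x) * h x) / p x) (at x))
          \<and> (h \<longlongrightarrow> - C / q a) (at_right a) \<and> (h \<longlongrightarrow> - C / q b) (at_left b)"
    if g: "gap p p' q q' a b" and s: "q a = q \<alpha> \<and> q b = q \<beta> \<or> q a = q \<beta> \<and> q b = q \<alpha>" for a b
  proof -
    consider "0 < q a" "0 < q b" "C = - 1" | "q a < 0" "q b < 0" "C = 1"
      using s sgn by (auto simp: C_def)
    then show ?thesis
      using gap.driven_solution_pos[OF g] gap.driven_solution_neg[OF g] by cases auto
  qed
  obtain h1 where h1: "\<And>x. \<alpha> < x \<Longrightarrow> x < \<beta> \<Longrightarrow> 0 < h1 x \<and>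
            (h1 has_real_derivative (C - (p' x - q x) * h1 x) / p x) (at x)"
    and l1: "(h1 \<longlongrightarrow> - C / q \<alpha>) (at_right \<alpha>)" "(h1 \<longlongrightarrow> - C / q \<beta>) (at_left \<beta>)"
    using driven[OF g1.gap_axioms] by blast
  have "\<exists>h2. (\<forall>x. \<beta> < x \<longrightarrow> x < \<alpha> + pi \<longrightarrow> 0 < h2 x \<and>
            (h2 has_real_derivative (C - (p' x - q x) * h2 x) / p x) (at x))
    \<and> (\<beta> < \<alpha> + pi \<longrightarrow> (h2 \<longlongrightarrow> - C / q \<beta>) (at_right \<beta>) \<and> (h2 \<longlongrightarrow> - C / q \<alpha>) (at_left (\<alpha> + pi)))"
  proof (cases "\<beta> < \<alpha> + pi")
    case True
    then show ?thesis using driven[OF g2[OF True]] z2 by auto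
  qed auto
  then obtain h2 where h2: "\<And>x. \<beta> < x \<Longrightarrow> x < \<alpha> + pi \<Longrightarrow> 0 < h2 x \<and>
            (h2 has_real_derivative (C - (p' x - q x) * h2 x) / p x) (at x)"
    and l2: "\<beta> < \<alpha> + pi \<Longrightarrow> (h2 \<longlongrightarrow> - C / q \<beta>) (at_right \<beta>)"
      "\<beta> < \<alpha> + pi \<Longrightarrow> (h2 \<longlongrightarrow> - C / q \<alpha>) (at_left (\<alpha> + pi))" by blast
  have "\<exists>\<rho>. solution C \<rho> \<and> (\<forall>x. 0 \<le> \<rho> x) \<and> (\<forall>x. \<alpha> < x \<longrightarrow> x < \<beta> \<longrightarrow> \<rho> x = h1 x)
    \<and> (\<forall>x. \<beta> < x \<longrightarrow> x < \<alpha> + pi \<longrightarrow> \<rho> x = h2 x)"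
    by (rule two_gap_solution[OF ab z _ _ l1 l2]) (use h1 h2 Cq z2 in \<open>auto simp: less_imp_le\<close>)
  then obtain \<rho> where sol: "solution C \<rho>" and nn: "\<And>x. 0 \<le> \<rho> x"
    and \<rho>1: "\<And>x. \<alpha> < x \<Longrightarrow> x < \<beta> \<Longrightarrow> \<rho> x = h1 x" by blast
  have per\<rho>: "\<And>x. \<rho> (x + pi) = \<rho> x" using sol by (simp add: solution_def)
  define x0 where "x0 = (\<alpha> + \<beta>) / 2"
  have x0: "\<alpha> < x0" "x0 < \<beta>" using ab by (auto simp: x0_def)
  show ?thesis
  proof (rule unique_groundstate[OF sol nn])
    show "\<rho> x0 \<noteq> 0" using \<rho>1[OF x0] h1[OF x0] by simp
    \<comment> \<open>Vacuous: every zero of \<open>p\<close> is a translate of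
      \<open>\<alpha>\<close> or \<open>\<beta>\<close>, where \<open>q\<close> does not
      vanish.\<close>
    show "C = 0" if "p x = 0" "q x = 0" for x
    proof -
      obtain k :: int where k: "\<alpha> \<le> x + of_int k * pi" "x + of_int k * pi < \<alpha> + pi"
        using pi_translate_exists by blast
      have "p (x + of_int k * pi) = 0" "q (x + of_int k * pi) = 0"
        using periodic_pi_int[of p] periodic_pi_int[of q] per that by auto
      then have False using k pos1[of "x + of_int k * pi"] pos2[of "x + of_int k * pi"] sgn
        by (cases "x + of_int k * pi" \<beta> rule: linorder_cases; cases "x + of_int k * pi = \<alpha>") auto
      then show ?thesis ..
    qed
    fix C1 r assume weak: "weak_solution C1 r"
    have perr: "\<And>x. r (x + pi) = r x" using weak by (simp add: weak_solution_def)
    \<comment> \<open>With this factor the currents cancel in the difference \<open>v\<close> of the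
      fluxes, which solves the homogeneous equation.\<close>
    define \<kappa> where "\<kappa> = C1 / C"
    define v where "v = (\<lambda>x. p x * r x - \<kappa> * (p x * \<rho> x))"
    have dv: "(v has_real_derivative q x / p x * v x) (at x)" if "p x \<noteq> 0" for x
      unfolding v_def
      by (rule DERIV_cong[OF DERIV_diff[OF weak_solution_deriv[OF weak that]
              DERIV_cmult[OF solution_deriv[OF sol that]]]])
         (use C in \<open>simp add: \<kappa>_def algebra_simps\<close>)
    have lv: "(v \<longlongrightarrow> 0) (at_right y)" "(v \<longlongrightarrow> 0) (at_left y)" if "p y = 0" for y
    proof -
      have "isCont \<rho> y" using sol by (simp add: solution_def)
      then have "isCont v y" unfolding v_def
        by (intro continuous_intros weak_solution_isCont[OF weak] cp)
      then show "(v \<longlongrightarrow> 0) (at_right y)" "(v \<longlongrightarrow> 0) (at_left y)"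
        using that by (auto simp: isCont_def filterlim_at_split v_def)
    qed
    \<comment> \<open>With \<open>q\<close> of one sign, every gap has an end at which exp w blows
      up: the left one for q < 0, the right one for q > 0.\<close>
    have v0: "v x = 0" if g: "gap p p' q q' a b" and s: "q a < 0 \<or> 0 < q b" and x: "a < x" "x < b" for a b x
    proof -
      have d: "(v has_real_derivative q x / p x * v x) (at x)" if "a < x" "x < b" for x
        using gap.pos[OF g that] by (intro dv) simp
      show ?thesis
        using gap.homogeneous_zero_right[OF g d lv(1)[OF gap.zero(1)[OF g]] _ x]
          gap.homogeneous_zero_left[OF g d lv(2)[OF gap.zero(2)[OF g]] _ x] s by blast
    qed
    have "r x = \<kappa> * \<rho> x" if "\<alpha> \<le> x" "x < \<alpha> + pi" "p x \<noteq> 0" for x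
    proof -
      have "x \<noteq> \<alpha>" "x \<noteq> \<beta>" using that z by auto
      then consider "\<alpha> < x" "x < \<beta>" | "\<beta> < x" "x < \<alpha> + pi" using \<open>\<alpha> \<le> x\<close> \<open>x < \<alpha> + pi\<close> by linarith
      then have "v x = 0"
      proof cases
        case 1
        then show ?thesis using v0[OF g1.gap_axioms] sgn by blast
      next
        case 2
        then have lt: "\<beta> < \<alpha> + pi" by simp
        show ?thesis using v0[OF g2[OF lt] _ 2] sgn z2 by auto
      qed
      then have "p x * (r x - \<kappa> * \<rho> x) = 0" by (simp add: v_def algebra_simps)
      then show ?thesis using that by simp
    qed
    then show "\<exists>\<kappa>. \<forall>x. p x \<noteq> 0 \<longrightarrow> r x = \<kappa> * \<rho> x"
      using proportional_by_period[of r \<rho> \<alpha> \<kappa>, OF perr per\<rho>] by blast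
  qed
qed

text \<open>Here the drift points inwards at both ends of \<open>(\<alpha>, \<beta>)\<close>, and the mass concentrates on this
  interval with vanishing current.\<close>
lemma trapping_groundstate:
  assumes ab: "\<alpha> < \<beta>" "\<beta> \<le> \<alpha> + pi" and z: "p \<alpha> = 0" "p \<beta> = 0"
    and pos1: "\<And>x. \<alpha> < x \<Longrightarrow> x < \<beta> \<Longrightarrow> 0 < p x"
    and pos2: "\<And>x. \<beta> < x \<Longrightarrow> x < \<alpha> + pi \<Longrightarrow> 0 < p x"
    and inward: "0 \<le> q \<alpha>" "q \<beta> \<le> 0"
    and outward: "\<beta> < \<alpha> + pi \<Longrightarrow> q \<beta> < 0 \<or> 0 < q \<alpha>"
    and current: "q \<alpha> = 0 \<or> q \<beta> = 0 \<or> (\<beta> < \<alpha> + pi \<and> q \<beta> < 0 \<and> 0 < q \<alpha>)"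
  shows "\<exists>C \<rho>. solution C \<rho> \<and> groundstate p q \<rho> \<and> (\<forall>x. 0 \<le> \<rho> x) \<and>
    (\<forall>\<rho>'. groundstate p q \<rho>' \<longrightarrow> (AE x in lborel. \<rho>' x = \<rho> x)) \<and>
    (\<forall>z. p z = 0 \<longrightarrow> q z = 0 \<longrightarrow> C = 0)"
proof -
  have z2: "p (\<alpha> + pi) = 0" "q (\<alpha> + pi) = q \<alpha>" using per z by auto
  interpret g1: gap p p' q q' \<alpha> \<beta>
    by unfold_locales (use ab z pos1 in auto)
  have g2: "gap p p' q q' \<beta> (\<alpha> + pi)" if "\<beta> < \<alpha> + pi"
    by unfold_locales (use that z z2 pos2 in auto)
  obtain h1 where h1: "\<And>x. \<alpha> < x \<Longrightarrow> x < \<beta> \<Longrightarrow> 0 < h1 x \<and>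
            (h1 has_real_derivative (0 - (p' x - q x) * h1 x) / p x) (at x)"
    and l1: "(h1 \<longlongrightarrow> 0) (at_right \<alpha>)" "(h1 \<longlongrightarrow> 0) (at_left \<beta>)"
    using g1.homogeneous_solution[OF inward] by blast
  \<comment> \<open>The other gap receives the zero function; this glues continuously because
    \<open>h1\<close> tends to 0 at both ends.\<close>
  have "\<exists>\<rho>. solution 0 \<rho> \<and> (\<forall>x. 0 \<le> \<rho> x) \<and> (\<forall>x. \<alpha> < x \<longrightarrow> x < \<beta> \<longrightarrow> \<rho> x = h1 x)
    \<and> (\<forall>x. \<beta> < x \<longrightarrow> x < \<alpha> + pi \<longrightarrow> \<rho> x = (\<lambda>_. 0) x)"
    by (rule two_gap_solution[OF ab z _ _ l1]) (use h1 in \<open>auto simp: less_imp_le\<close>)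
  then obtain \<rho> where sol: "solution 0 \<rho>" and nn: "\<And>x. 0 \<le> \<rho> x"
    and \<rho>1: "\<And>x. \<alpha> < x \<Longrightarrow> x < \<beta> \<Longrightarrow> \<rho> x = h1 x"
    and \<rho>2: "\<And>x. \<beta> < x \<Longrightarrow> x < \<alpha> + pi \<Longrightarrow> \<rho> x = 0" by auto
  have per\<rho>: "\<And>x. \<rho> (x + pi) = \<rho> x" using sol by (simp add: solution_def)
  define x0 where "x0 = (\<alpha> + \<beta>) / 2"
  have x0: "\<alpha> < x0" "x0 < \<beta>" using ab by (auto simp: x0_def)
  show ?thesis
  proof (rule unique_groundstate[OF sol nn])
    show "\<rho> x0 \<noteq> 0" using \<rho>1[OF x0] h1[OF x0] by simp
    fix C1 r assume weak: "weak_solution C1 r"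
    have perr: "\<And>x. r (x + pi) = r x" using weak by (simp add: weak_solution_def)
    define u where "u = (\<lambda>x. p x * r x)"
    have du: "(u has_real_derivative q x / p x * u x + C1) (at x)" if "p x \<noteq> 0" for x
      unfolding u_def by (rule weak_solution_deriv[OF weak that])
    have lu: "(u \<longlongrightarrow> 0) (at_right y)" "(u \<longlongrightarrow> 0) (at_left y)" if "p y = 0" for y
      unfolding u_def using weak_solution_limit[OF weak that] by blast+
    \<comment> \<open>A zero with q = 0 forbids a current by integrability. If both ends are
      strictly inward, the complementary gap is repelling at both of its ends, and Rolle's theorem
      forbids the current.\<close>
    have C1: "C1 = 0"
    proof -
      consider "q \<alpha> = 0" | "q \<alpha> \<noteq> 0" "q \<beta> = 0" | "\<beta> < \<alpha> + pi" "q \<beta> < 0" "0 < q \<alpha>"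
        using current by blast
      then show ?thesis
      proof cases
        case 1
        then show ?thesis using weak_solution_current_zero[OF weak z(1) _ g1.pos_right] by blast
      next
        case 2
        show ?thesis
        proof (cases "\<beta> < \<alpha> + pi")
          case True
          then show ?thesis
            using weak_solution_current_zero[OF weak z(2) _ gap.pos_right[OF g2[OF True]]] 2 by blast
        next
          case False
          then have "\<beta> = \<alpha> + pi" using ab by simp
          then show ?thesis using 2 z2 by simp
        qed
      next
        case 3
        note g = g2[OF 3(1)]
        show ?thesis
          by (rule gap.repelling_both_ends[OF g _ lu(1)[OF z(2)] lu(2)[OF z2(1)] 3(2)])
             (use 3 z2 du pos2 in \<open>auto simp: less_imp_neq[symmetric]\<close>)
      qed
    qed
    then have du0: "(u has_real_derivative q x / p x * u x) (at x)" if "p x \<noteq> 0" for x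
      using du[OF that] by simp
    have d\<rho>0: "((\<lambda>x. p x * \<rho> x) has_real_derivative q x / p x * (p x * \<rho> x)) (at x)" if "p x \<noteq> 0" for x
      using solution_deriv[OF sol that] by simp
    \<comment> \<open>On the trapping gap the fluxes of \<open>r\<close> and \<open>\<rho>\<close>
      solve the same homogeneous equation, so both are multiples of exp w, and the ratio of the
      coefficients is the factor sought.\<close>
    obtain w where w: "potential \<alpha> \<beta> w" using g1.potential_exists by blast
    obtain D where D: "\<And>x. \<alpha> < x \<Longrightarrow> x < \<beta> \<Longrightarrow> u x = D * exp (w x)"
      using g1.homogeneous_constant[OF w du0] pos1 by (metis less_irrefl)
    obtain E where E: "\<And>x. \<alpha> < x \<Longrightarrow> x < \<beta> \<Longrightarrow> p x * \<rho> x = E * exp (w x)"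
      using g1.homogeneous_constant[OF w d\<rho>0] pos1 by (metis less_irrefl)
    have "0 < p x0 * \<rho> x0" using \<rho>1[OF x0] h1[OF x0] pos1[OF x0] by simp
    then have E0: "E \<noteq> 0" using E[OF x0] by auto
    define \<kappa> where "\<kappa> = D / E"
    have "r x = \<kappa> * \<rho> x" if "\<alpha> \<le> x" "x < \<alpha> + pi" "p x \<noteq> 0" for x
    proof -
      have "x \<noteq> \<alpha>" "x \<noteq> \<beta>" using that z by auto
      then consider "\<alpha> < x" "x < \<beta>" | "\<beta> < x" "x < \<alpha> + pi" using \<open>\<alpha> \<le> x\<close> \<open>x < \<alpha> + pi\<close> by linarith
      then have "u x = \<kappa> * (p x * \<rho> x)"
      proof cases
        case 1
        then show ?thesis using D E E0 by (simp add: \<kappa>_def)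
      next
        case 2
        then have lt: "\<beta> < \<alpha> + pi" by simp
        note g = g2[OF lt]
        have d: "(u has_real_derivative q x / p x * u x) (at x)" if "\<beta> < x" "x < \<alpha> + pi" for x
          using pos2[OF that] by (intro du0) simp
        \<comment> \<open>By \<open>outward\<close> at least one end of the complementary gap is
          strictly repelling, which forces the flux to vanish throughout it.\<close>
        have "u x = 0"
          using gap.homogeneous_zero_right[OF g d lu(1)[OF z(2)] _ 2]
            gap.homogeneous_zero_left[OF g d lu(2)[OF z2(1)] _ 2] outward[OF lt] z2 by auto
        then show ?thesis using \<rho>2[OF 2] by simp
      qed
      then have "p x * (r x - \<kappa> * \<rho> x) = 0" by (simp add: u_def algebra_simps)
      then show ?thesis using that by simp
    qed
    then show "\<exists>\<kappa>. \<forall>x. p x \<noteq> 0 \<longrightarrow> r x = \<kappa> * \<rho> x"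
      using proportional_by_period[of r \<rho> \<alpha> \<kappa>, OF perr per\<rho>] by blast
  qed simp
qed

text \<open>Periodicity replaces the boundary conditions. Over one period exp w gains the factor exp
  W and the integral of exp (- w) over a window of length pi gains exp (- W), so their product is
  periodic and positive; it is the flux, with current exp (- W) - 1.\<close>

lemma nondegenerate_groundstate:
  assumes pos: "\<And>x. 0 < p x"
  shows "\<exists>C \<rho>. solution C \<rho> \<and> groundstate p q \<rho> \<and> (\<forall>x. 0 \<le> \<rho> x) \<and>
    (\<forall>\<rho>'. groundstate p q \<rho>' \<longrightarrow> (AE x in lborel. \<rho>' x = \<rho> x)) \<and>
    (\<forall>z. p z = 0 \<longrightarrow> q z = 0 \<longrightarrow> C = 0)"
proof -
  have pn: "p x \<noteq> 0" for x using pos[of x] by simp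
  have anti: "\<exists>F. \<forall>x. (F has_real_derivative f x) (at x)" if "\<And>x. isCont f x" for f :: "real \<Rightarrow> real"
    using einterval_antiderivative[of "-\<infinity>" "\<infinity>" f] that
    by (auto simp: has_real_derivative_iff_has_vector_derivative)
  obtain w where w: "\<And>x. (w has_real_derivative q x / p x) (at x)"
    using anti[of "\<lambda>x. q x / p x"] pn by (auto intro!: continuous_intros cq cp)
  obtain F where F: "\<And>x. (F has_real_derivative exp (- w x)) (at x)"
    using anti[of "\<lambda>x. exp (- w x)"] DERIV_isCont[OF w] by (auto intro!: continuous_intros)
  have sh: "((\<lambda>x. f (x + pi)) has_real_derivative f' (x + pi)) (at x)"
    if "\<And>x. (f has_real_derivative f' x) (at x)" for f f' :: "real \<Rightarrow> real" and x
    using that[of "x + pi"] by (simp add: DERIV_shift)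
  define W where "W = w pi - w 0"
  have wper: "w (x + pi) = w x + W" for x
  proof -
    have "((\<lambda>x. w (x + pi) - w x) has_real_derivative 0) (at x)" for x
      using DERIV_diff[OF sh[OF w] w, of x] per by simp
    from DERIV_isconst_all[of "\<lambda>x. w (x + pi) - w x" x 0] this show ?thesis by (simp add: W_def)
  qed
  \<comment> \<open>The integral of exp (- w) from \<open>x\<close> to
    \<open>x + pi\<close>.\<close>
  define S where "S = (\<lambda>x. F (x + pi) - F x)"
  have dS: "(S has_real_derivative (exp (- W) - 1) * exp (- w x)) (at x)" for x
    unfolding S_def
    by (rule DERIV_cong[OF DERIV_diff[OF sh[OF F] F]])
       (simp only: wper, simp add: exp_add[symmetric] left_diff_distrib)
  have Spos: "0 < S x" for x
    using DERIV_pos_imp_increasing[of x "x + pi" F] F by (fastforce simp: S_def)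
  have Sper: "S (x + pi) = exp (- W) * S x" for x
  proof -
    have d0: "((\<lambda>x. F (x + pi) - exp (- W) * F x) has_real_derivative 0) (at x)" for x
      by (rule DERIV_cong[OF DERIV_diff[OF sh[OF F] DERIV_cmult[OF F]]]) (simp add: wper exp_add[symmetric])
    have "F (x + pi + pi) - exp (- W) * F (x + pi) = F (x + pi) - exp (- W) * F x"
      using DERIV_isconst_all[OF allI[OF d0], of "x + pi" x] by simp
    then show ?thesis by (simp add: S_def algebra_simps)
  qed
  define C where "C = exp (- W) - 1"
  define u where "u = (\<lambda>x. exp (w x) * S x)"
  have du: "(u has_real_derivative q x / p x * u x + C) (at x)" for x
    unfolding u_def
    by (rule DERIV_cong[OF DERIV_mult[OF DERIV_fun_exp[OF w] dS]]) (simp add: C_def exp_minus field_simps)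
  have uper: "u (x + pi) = u x" for x
    by (simp add: u_def wper Sper exp_add exp_minus)
  have upos: "0 < u x" for x using Spos by (simp add: u_def)
  define \<rho> where "\<rho> = (\<lambda>x. u x / p x)"
  have d\<rho>: "(\<rho> has_real_derivative (C - (p' x - q x) * \<rho> x) / p x) (at x)" for x
    unfolding \<rho>_def
    by (rule DERIV_cong[OF DERIV_divide[OF du dp pn]]) (use pn[of x] in \<open>simp add: field_simps\<close>)
  have per\<rho>: "\<rho> (x + pi) = \<rho> x" for x by (simp add: \<rho>_def uper per)
  have sol: "solution C \<rho>"
    unfolding solution_def using per\<rho> d\<rho> DERIV_isCont[OF d\<rho>] by blast
  have \<rho>pos: "0 < \<rho> x" for x using upos pos by (simp add: \<rho>_def)
  show ?thesis
  proof (rule unique_groundstate[OF sol])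
    show "0 \<le> \<rho> x" for x using \<rho>pos less_imp_le by blast
    show "\<rho> 0 \<noteq> 0" using \<rho>pos[of 0] by simp
    show "C = 0" if "p z = 0" for z using that pn by simp
    fix C1 r assume weak: "weak_solution C1 r"
    define g where "g = (\<lambda>x. p x * r x * exp (- w x))"
    have dg: "(g has_real_derivative C1 * exp (- w x)) (at x)" for x
      unfolding g_def
      by (rule DERIV_cong[OF DERIV_mult[OF weak_solution_deriv[OF weak pn] DERIV_fun_exp[OF DERIV_minus[OF w]]]])
         (simp add: algebra_simps)
    have d0: "((\<lambda>x. g x - C1 * F x) has_real_derivative 0) (at x)" for x
      by (rule DERIV_cong[OF DERIV_diff[OF dg DERIV_cmult[OF F]]]) simp
    have const: "g x - C1 * F x = g y - C1 * F y" for x y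
      by (rule DERIV_isconst_all[OF allI[OF d0]])
    have gper: "g (x + pi) = exp (- W) * g x" for x
      using weak by (simp add: g_def weak_solution_def per wper exp_minus exp_add)
    \<comment> \<open>Comparing \<open>g - C1 * F\<close> at \<open>x\<close> and
      \<open>x + pi\<close> turns the quasi-periodicity of \<open>g\<close> into proportionality to
      \<open>S\<close>, as long as \<open>C\<close> is nonzero.\<close>
    have key: "C * g x = C1 * S x" for x
      using const[of "x + pi" x] gper[of x] by (simp add: S_def C_def algebra_simps)
    have gS: "r x = g x / S x * \<rho> x" for x
      using Spos[of x] pn[of x] by (simp add: g_def \<rho>_def u_def exp_minus)
    have "\<exists>\<kappa>. \<forall>x. g x = \<kappa> * S x"
    proof (cases "C = 0")
      case False
      then have "g x = C1 / C * S x" for x using key[of x] by (simp add: field_simps)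
      then show ?thesis by blast
    next
      \<comment> \<open>Now exp w is periodic and the relation only gives \<open>C1 = 0\<close>; but
        then \<open>g\<close> and \<open>S\<close> are both constant.\<close>
      case True
      then have "C1 = 0" using key[of 0] Spos[of 0] by simp
      have S0: "S x = S 0" for x
        using DERIV_isconst_all[of S x 0] dS True by (simp add: C_def)
      have "g x = g 0 / S 0 * S x" for x using const[of x 0] Spos[of 0] S0[of x] \<open>C1 = 0\<close> by simp
      then show ?thesis by blast
    qed
    then obtain \<kappa> where \<kappa>: "\<And>x. g x = \<kappa> * S x" by blast
    have "r x = \<kappa> * \<rho> x" for x using gS[of x] \<kappa>[of x] Spos[of x] by simp
    then show "\<exists>\<kappa>. \<forall>x. p x \<noteq> 0 \<longrightarrow> r x = \<kappa> * \<rho> x" by blast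
  qed
qed

end

section \<open>Trigonometric coefficients\<close>

lemma quadratic_nonneg:
  fixes a b c :: real
  assumes "\<And>t. 0 \<le> a * t\<^sup>2 + b * t + c"
  shows "0 \<le> a" "a = 0 \<Longrightarrow> b = 0"
proof -
  have c: "0 \<le> c" using assms[of 0] by simp
  show "0 \<le> a"
  proof (rule ccontr)
    assume "\<not> 0 \<le> a"
    \<comment> \<open>At \<open>t\<close> and \<open>- t\<close> the quadratic term equals
      \<open>- (c + 1)\<close>, and the linear terms cancel in the sum of the two values.\<close>
    define t where "t = sqrt ((c + 1) / - a)"
    have "t\<^sup>2 = (c + 1) / - a" using c \<open>\<not> 0 \<le> a\<close> by (simp add: t_def divide_nonneg_neg)
    then have "a * t\<^sup>2 = - (c + 1)" using \<open>\<not> 0 \<le> a\<close> by simp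
    then show False using assms[of t] assms[of "- t"] by simp
  qed
  show "b = 0" if "a = 0"
  proof (rule ccontr)
    assume "b \<noteq> 0"
    then show False using assms[of "- (c + 1) / b"] that by simp
  qed
qed

text \<open>Substituting \<open>cos x = t * sin x\<close> and dividing by a power of sin x turns an
  inequality for a form in (cos, sin) into a polynomial inequality in an arbitrary real
  \<open>t\<close>.\<close>

lemma angle_with_cot:
  fixes t :: real
  obtains x where "0 < sin x" "cos x = t * sin x"
proof
  show "0 < sin (pi / 2 - arctan t)" 
    using arctan_bounded[of t] by (simp add: sin_diff cos_gt_zero_pi)
  have "sin (arctan t) = t * cos (arctan t)"
    using tan_arctan[of t] cos_arctan_not_zero[of t] by (simp add: tan_def field_simps)
  then show "cos (pi / 2 - arctan t) = t * sin (pi / 2 - arctan t)"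
    by (simp add: cos_diff sin_diff)
qed

text \<open>\<open>e\<close> stands for the mean drift E(p_K), and \<open>q_eq\<close> uses that
  E(p_1 p_1') is half the derivative of p. Forms in (cos, sin) are invariant under rotation, so
  \<open>quartic\<close> and \<open>quadratic\<close> are stated around every base point; Taylor
  coefficients at a zero can then be read off directly.\<close>

locale trig_coefficients =
  fixes p e q :: "real \<Rightarrow> real"
  assumes quartic: "\<And>z. \<exists>g0 g1 g2 g3 g4. \<forall>x. p (z + x) =
      g0 * cos x ^ 4 + g1 * (cos x ^ 3 * sin x) + g2 * ((cos x)\<^sup>2 * (sin x)\<^sup>2)
      + g3 * (cos x * sin x ^ 3) + g4 * sin x ^ 4"
    and quadratic: "\<And>z. \<exists>h0 h1 h2. \<forall>x. e (z + x) =
      h0 * (cos x)\<^sup>2 + h1 * (cos x * sin x) + h2 * (sin x)\<^sup>2"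
    and q_eq: "\<And>x. q x = 2 * e x + deriv p x / 2"
    and p_nonneg: "\<And>x. 0 \<le> p x"
    and p_nonzero: "\<exists>x. p x \<noteq> 0"
    and excl_2: "\<And>z. zero_of_order p z 2 \<Longrightarrow> q z = 0 \<Longrightarrow> (deriv ^^ 2) p z < deriv q z"
    and excl_4: "\<And>z. zero_of_order p z 4 \<Longrightarrow> e z = 0 \<Longrightarrow> 0 < deriv e z"
begin

lemma Ck_sin [intro]: "Ck_on n sin UNIV" and Ck_cos [intro]: "Ck_on n cos UNIV"
  using Ck_on_sin_cos[of n 0] by auto

lemma Ck_p: "Ck_on n p UNIV"
proof -
  obtain g0 g1 g2 g3 g4 where g: "\<And>x. p (0 + x) =
      g0 * cos x ^ 4 + g1 * (cos x ^ 3 * sin x) + g2 * ((cos x)\<^sup>2 * (sin x)\<^sup>2)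
      + g3 * (cos x * sin x ^ 3) + g4 * sin x ^ 4" using quartic[of 0] by blast
  have "Ck_on n (\<lambda>x. g0 * cos x ^ 4 + g1 * (cos x ^ 3 * sin x) + g2 * ((cos x)\<^sup>2 * (sin x)\<^sup>2)
      + g3 * (cos x * sin x ^ 3) + g4 * sin x ^ 4) UNIV"
    by (intro Ck_on_add Ck_on_mult Ck_on_power Ck_on_const Ck_sin Ck_cos open_UNIV)
  then show ?thesis using g by (subst Ck_on_cong[OF open_UNIV]) auto
qed

lemma Ck_e: "Ck_on n e UNIV"
proof -
  obtain h0 h1 h2 where g: "\<And>x. e (0 + x) =
      h0 * (cos x)\<^sup>2 + h1 * (cos x * sin x) + h2 * (sin x)\<^sup>2" using quadratic[of 0] by blast
  have "Ck_on n (\<lambda>x. h0 * (cos x)\<^sup>2 + h1 * (cos x * sin x) + h2 * (sin x)\<^sup>2) UNIV"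
    by (intro Ck_on_add Ck_on_mult Ck_on_power Ck_on_const Ck_sin Ck_cos open_UNIV)
  then show ?thesis using g by (subst Ck_on_cong[OF open_UNIV]) auto
qed

lemma Ck_p': "Ck_on n (deriv p) UNIV"
  using Ck_p[of "Suc n"] by simp

lemma Ck_q: "Ck_on n q UNIV"
proof -
  have "Ck_on n (\<lambda>x. 2 * e x + deriv p x * (1 / 2)) UNIV"
    by (intro Ck_on_add Ck_on_mult Ck_on_const Ck_e Ck_p' open_UNIV)
  then show ?thesis using q_eq by (subst Ck_on_cong[OF open_UNIV]) auto
qed

lemma dp: "(p has_real_derivative deriv p x) (at x)"
  and ddp: "(deriv p has_real_derivative (deriv ^^ 2) p x) (at x)"
  and de: "(e has_real_derivative deriv e x) (at x)"
  and dq: "(q has_real_derivative deriv q x) (at x)"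
  using Ck_on_deriv[OF Ck_p[of "Suc 0"]] Ck_on_deriv[OF Ck_p'[of "Suc 0"]]
    Ck_on_deriv[OF Ck_e[of "Suc 0"]] Ck_on_deriv[OF Ck_q[of "Suc 0"]]
  by (simp_all add: numeral_2_eq_2)

lemma deriv_q: "deriv q z = 2 * deriv e z + (deriv ^^ 2) p z / 2"
proof -
  have "((\<lambda>x. 2 * e x + deriv p x / 2) has_real_derivative 2 * deriv e z + (deriv ^^ 2) p z / 2) (at z)"
    by (intro DERIV_add DERIV_cmult DERIV_cdivide de ddp)
  then show ?thesis using DERIV_imp_deriv q_eq by (metis (no_types, lifting) ext)
qed

lemma per_p: "p (x + pi) = p x"
proof -
  obtain g0 g1 g2 g3 g4 where g: "\<And>x. p (0 + x) =
      g0 * cos x ^ 4 + g1 * (cos x ^ 3 * sin x) + g2 * ((cos x)\<^sup>2 * (sin x)\<^sup>2)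
      + g3 * (cos x * sin x ^ 3) + g4 * sin x ^ 4" using quartic[of 0] by blast
  show ?thesis using g[of x] g[of "x + pi"] by (simp add: cos_add sin_add)
qed

lemma per_e: "e (x + pi) = e x"
proof -
  obtain h0 h1 h2 where g: "\<And>x. e (0 + x) =
      h0 * (cos x)\<^sup>2 + h1 * (cos x * sin x) + h2 * (sin x)\<^sup>2" using quadratic[of 0] by blast
  show ?thesis using g[of x] g[of "x + pi"] by (simp add: cos_add sin_add)
qed

lemma per_p': "deriv p (x + pi) = deriv p x"
proof -
  have "((\<lambda>y. p (y + pi)) has_real_derivative deriv p (x + pi)) (at x)"
    using dp[of "x + pi"] by (simp add: DERIV_shift)
  then show ?thesis using dp[of x] by (simp add: per_p DERIV_unique)
qed

lemma per_q: "q (x + pi) = q x"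
  by (simp add: q_eq per_e per_p')

lemma p'_zero: "p z = 0 \<Longrightarrow> deriv p z = 0"
  using DERIV_local_min[OF dp zero_less_one, of z] p_nonneg by simp

section \<open>Zeros of p and the drift at them\<close>

text \<open>The coefficients of cos^4 and cos^3 sin are p(z) and p'(z), both 0 at a minimum, so
  sin^2 factors out and leaves a nonnegative quadratic form. If its leading coefficient vanishes,
  nonnegativity kills the mixed term and p is a positive multiple of sin^4; zeros thus have order 2
  or 4.\<close>

lemma zero_expansion:
  assumes z: "p z = 0"
  shows "\<exists>a b c. (\<forall>x. p (z + x) = (sin x)\<^sup>2 * (a * (cos x)\<^sup>2 + b * (cos x * sin x) + c * (sin x)\<^sup>2)) \<and>
    0 \<le> a \<and> (a = 0 \<longrightarrow> b = 0 \<and> 0 < c)"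
proof -
  obtain g0 a0 a b c where g: "\<And>x. p (z + x) =
      g0 * cos x ^ 4 + a0 * (cos x ^ 3 * sin x) + a * ((cos x)\<^sup>2 * (sin x)\<^sup>2)
      + b * (cos x * sin x ^ 3) + c * sin x ^ 4" using quartic[of z] by blast
  have g0: "g0 = 0" using g[of 0] z by simp
  have "((\<lambda>x. p (z + x)) has_real_derivative a0) (at 0)"
    unfolding g by (rule derivative_eq_intros refl | simp add: g0)+
  then have "(p has_real_derivative a0) (at z)"
    using DERIV_shift[of p a0 0 z] by (simp add: add.commute)
  then have a0: "a0 = 0" using p'_zero[OF z] DERIV_unique[OF dp] by metis
  have f: "p (z + x) = (sin x)\<^sup>2 * (a * (cos x)\<^sup>2 + b * (cos x * sin x) + c * (sin x)\<^sup>2)" for x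
    unfolding g by (simp add: g0 a0 algebra_simps power2_eq_square power3_eq_cube power4_eq_xxxx)
  have nn: "0 \<le> a * t\<^sup>2 + b * t + c" for t
  proof -
    obtain x where x: "0 < sin x" "cos x = t * sin x" by (rule angle_with_cot)
    have "p (z + x) = sin x ^ 4 * (a * t\<^sup>2 + b * t + c)"
      unfolding f x(2) by (simp add: algebra_simps power2_eq_square power4_eq_xxxx)
    then show ?thesis using p_nonneg[of "z + x"] x by (simp add: zero_le_mult_iff)
  qed
  have "0 < c" if "a = 0"
  proof (rule ccontr)
    assume "\<not> 0 < c"
    then have "c = 0" using nn[of 0] by simp
    then have "p (z + x) = 0" for x using f[of x] that quadratic_nonneg(2)[OF nn that] by simp
    then have "p x = 0" for x using add.commute diff_add_cancel by metis
    then show False using p_nonzero by simp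
  qed
  then show ?thesis using f quadratic_nonneg[OF nn] by blast
qed

lemma second_derivative_at_zero:
  assumes f: "\<And>x. p (z + x) = (sin x)\<^sup>2 * (a * (cos x)\<^sup>2 + b * (cos x * sin x) + c * (sin x)\<^sup>2)"
  shows "(deriv ^^ 2) p z = 2 * a"
proof -
  define Q where "Q = (\<lambda>x. a * (cos x)\<^sup>2 + b * (cos x * sin x) + c * (sin x)\<^sup>2)"
  define Q' where "Q' = (\<lambda>x. - 2 * a * (cos x * sin x) + b * ((cos x)\<^sup>2 - (sin x)\<^sup>2) + 2 * c * (sin x * cos x))"
  have dQ: "(Q has_real_derivative Q' x) (at x)" for x
    unfolding Q_def Q'_def
    by (rule derivative_eq_intros refl)+ (simp add: algebra_simps power2_eq_square)
  have "(p has_real_derivative 2 * sin (x - z) * cos (x - z) * Q (x - z) + (sin (x - z))\<^sup>2 * Q' (x - z)) (at x)" for x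
  proof -
    have "p = (\<lambda>x. (sin (x - z))\<^sup>2 * Q (x - z))" using f[of "_ - z"] by (auto simp: Q_def)
    then show ?thesis
      by (auto intro!: derivative_eq_intros DERIV_chain'[where g = Q, OF _ dQ])
  qed
  then have "deriv p = (\<lambda>x. 2 * sin (x - z) * cos (x - z) * Q (x - z) + (sin (x - z))\<^sup>2 * Q' (x - z))"
    by (intro ext DERIV_imp_deriv)
  \<comment> \<open>The value of this derivative is irrelevant, since it is multiplied by sin^2,
    which vanishes at \<open>z\<close>.\<close>
  moreover have "\<exists>D. (Q' has_real_derivative D) (at 0)"
    unfolding Q'_def by (rule exI) (rule derivative_eq_intros refl)+
  then obtain D where "(Q' has_real_derivative D) (at (z - z))" by auto
  then have "((\<lambda>x. 2 * sin (x - z) * cos (x - z) * Q (x - z) + (sin (x - z))\<^sup>2 * Q' (x - z))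
      has_real_derivative 2 * Q 0) (at z)"
    by (auto intro!: derivative_eq_intros DERIV_chain'[where g = Q, OF _ dQ] DERIV_chain'[where g = Q'])
  ultimately have "deriv (deriv p) z = 2 * Q 0" by (simp add: DERIV_imp_deriv)
  then show ?thesis by (simp add: Q_def numeral_2_eq_2)
qed

lemma order_2_zero:
  assumes f: "\<And>x. p (z + x) = (sin x)\<^sup>2 * (a * (cos x)\<^sup>2 + b * (cos x * sin x) + c * (sin x)\<^sup>2)"
    and a: "a \<noteq> 0"
  shows "zero_of_order p z 2"
proof -
  have "p z = 0" using f[of 0] by simp
  then show ?thesis
    using p'_zero a second_derivative_at_zero[OF f]
    by (auto simp: zero_of_order_def numeral_2_eq_2 less_Suc_eq)
qed

lemma order_4_zero:
  assumes f: "\<And>x. p (z + x) = c * sin x ^ 4" and c: "c \<noteq> 0"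
  shows "zero_of_order p z 4"
proof -
  let ?s = "\<lambda>x. sin (x - z)" and ?c = "\<lambda>x. cos (x - z)"
  have p: "p = (\<lambda>x. c * ?s x ^ 4)" using f[of "_ - z"] by auto
  have d1: "deriv p = (\<lambda>x. c * (4 * ?s x ^ 3 * ?c x))"
    unfolding p by (intro ext DERIV_imp_deriv) (auto intro!: derivative_eq_intros)
  have d2: "deriv (deriv p) = (\<lambda>x. c * (12 * ?s x ^ 2 * ?c x ^ 2 - 4 * ?s x ^ 4))"
    unfolding d1 by (intro ext DERIV_imp_deriv, (rule derivative_eq_intros refl)+)
      (simp add: algebra_simps power2_eq_square power3_eq_cube power4_eq_xxxx)
  have d3: "deriv (deriv (deriv p)) = (\<lambda>x. c * (24 * ?s x * ?c x ^ 3 - 40 * ?s x ^ 3 * ?c x))"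
    unfolding d2 by (intro ext DERIV_imp_deriv, (rule derivative_eq_intros refl)+)
      (simp add: algebra_simps power2_eq_square power3_eq_cube power4_eq_xxxx)
  have d4: "deriv (deriv (deriv (deriv p))) z = 24 * c"
    unfolding d3 by (intro DERIV_imp_deriv) (auto intro!: derivative_eq_intros)
  show ?thesis
    using c p'_zero
    by (auto simp: zero_of_order_def numeral_eq_Suc less_Suc_eq d4)
       (simp_all add: p, simp_all add: p[symmetric] d1, simp_all add: d1[symmetric] d2,
         simp_all add: d2[symmetric] d3)
qed

text \<open>Both exclusions lead to the same inequality: at a zero of order 4 one has p'' = 0, so q'
  = 2 e', and e' > 0 is what the second exclusion leaves.\<close>

lemma drift_derivative:
  assumes z: "p z = 0" "q z = 0"
  shows "(deriv ^^ 2) p z < deriv q z"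
proof -
  obtain a b c where f: "\<And>x. p (z + x) = (sin x)\<^sup>2 * (a * (cos x)\<^sup>2 + b * (cos x * sin x) + c * (sin x)\<^sup>2)"
    and a: "a = 0 \<longrightarrow> b = 0 \<and> 0 < c" using zero_expansion[OF z(1)] by blast
  show ?thesis
  proof (cases "a = 0")
    case False
    then show ?thesis using excl_2[OF order_2_zero[OF f]] z by simp
  next
    case True
    then have "zero_of_order p z 4"
      using a f by (intro order_4_zero[of z c]) (auto simp: power2_eq_square power4_eq_xxxx)
    moreover have "e z = 0" using q_eq[of z] z p'_zero by simp
    ultimately show ?thesis
      using excl_4[of z] second_derivative_at_zero[OF f] True by (simp add: deriv_q)
  qed
qed

text \<open>From p'' < q' = 2 e' + p''/2 it follows that e' > p''/4 \<ge> 0 at every zero of p with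
  q = 0, whereas a nonzero quadratic form in (cos, sin) has slopes of opposite sign at two distinct
  zeros.\<close>

lemma degenerate_zero_unique:
  assumes z: "p z = 0" "q z = 0" and y: "p y = 0" "q y = 0"
  shows "\<exists>k::int. y = z + of_int k * pi"
proof -
  have e'pos: "0 < deriv e t" if "p t = 0" "q t = 0" for t
  proof -
    obtain a b c where f: "\<And>x. p (t + x) = (sin x)\<^sup>2 * (a * (cos x)\<^sup>2 + b * (cos x * sin x) + c * (sin x)\<^sup>2)"
      and a: "0 \<le> a" using zero_expansion[of t] \<open>p t = 0\<close> by blast
    show ?thesis using drift_derivative[OF that] second_derivative_at_zero[OF f] a by (simp add: deriv_q)
  qed
  have e0: "e z = 0" "e y = 0" using q_eq z y p'_zero by auto
  define x where "x = y - z"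
  have "sin x = 0"
  proof (rule ccontr)
    assume s: "sin x \<noteq> 0"
    obtain h0 h1 h2 where h: "\<And>x. e (z + x) = h0 * (cos x)\<^sup>2 + h1 * (cos x * sin x) + h2 * (sin x)\<^sup>2"
      using quadratic[of z] by blast
    have h0: "h0 = 0" using h[of 0] e0 by simp
    \<comment> \<open>As sin x is nonzero, the other linear factor of \<open>e\<close> vanishes at
      \<open>y\<close>; inserting this into the derivative gives \<open>- h1\<close>, against
      \<open>h1\<close> at \<open>z\<close>.\<close>
    have "sin x * (h1 * cos x + h2 * sin x) = 0"
      using h[of x] e0 h0 by (simp add: x_def algebra_simps power2_eq_square)
    then have h2: "h2 * sin x = - h1 * cos x" using s by simp
    have d: "deriv e (z + t) = h1 * ((cos t)\<^sup>2 - (sin t)\<^sup>2) + 2 * h2 * sin t * cos t" for t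
    proof -
      have "((\<lambda>t. e (z + t)) has_real_derivative h1 * ((cos t)\<^sup>2 - (sin t)\<^sup>2) + 2 * h2 * sin t * cos t) (at t)"
        unfolding h h0 by (rule derivative_eq_intros refl)+ (simp add: algebra_simps power2_eq_square)
      then have "(e has_real_derivative h1 * ((cos t)\<^sup>2 - (sin t)\<^sup>2) + 2 * h2 * sin t * cos t) (at (t + z))"
        by (simp add: DERIV_shift add.commute)
      then show ?thesis by (simp add: DERIV_imp_deriv add.commute)
    qed
    have "deriv e y = h1 * ((cos x)\<^sup>2 - (sin x)\<^sup>2) + 2 * (h2 * sin x) * cos x"
      using d[of x] by (simp add: x_def)
    also have "\<dots> = - h1 * ((sin x)\<^sup>2 + (cos x)\<^sup>2)"
      unfolding h2 by algebra
    finally have "deriv e y = - h1" by simp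
    moreover have "deriv e z = h1" using d[of 0] by simp
    ultimately show False using e'pos[OF z] e'pos[OF y] by simp
  qed
  then obtain k :: int where "x = of_int k * pi" by (auto simp: sin_zero_iff_int2)
  then show ?thesis by (intro exI[of _ k]) (simp add: x_def)
qed

text \<open>After splitting off sin^2 at \<open>z\<close>, a second zero is a minimum of the
  remaining nonnegative quadratic form, hence double. So p is a positive multiple of sin^2 (x - z)
  sin^2 (x - \<beta>) and has no further zeros. Without a second zero, \<open>\<beta>\<close> is
  \<open>z + pi\<close>.\<close>

lemma zeros_structure:
  assumes z: "p z = 0"
  shows "\<exists>\<beta>. z < \<beta> \<and> \<beta> \<le> z + pi \<and> p \<beta> = 0 \<and> (\<forall>x. z < x \<longrightarrow> x < \<beta> \<longrightarrow> 0 < p x) \<and>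
    (\<forall>x. \<beta> < x \<longrightarrow> x < z + pi \<longrightarrow> 0 < p x)"
proof (cases "\<exists>\<beta>. z < \<beta> \<and> \<beta> < z + pi \<and> p \<beta> = 0")
  case False
  have "0 < p x" if "z < x" "x < z + pi" for x
    using False that p_nonneg[of x] by (metis order_le_less)
  then show ?thesis using z per_p[of z] by (intro exI[of _ "z + pi"]) auto
next
  case True
  then obtain \<beta> where \<beta>: "z < \<beta>" "\<beta> < z + pi" "p \<beta> = 0" by blast
  obtain a b c where f: "\<And>x. p (z + x) = (sin x)\<^sup>2 * (a * (cos x)\<^sup>2 + b * (cos x * sin x) + c * (sin x)\<^sup>2)"
    and a: "0 \<le> a" using zero_expansion[OF z] by blast
  define Q where "Q = (\<lambda>x. a * (cos x)\<^sup>2 + b * (cos x * sin x) + c * (sin x)\<^sup>2)"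
  have Qnn: "0 \<le> Q x" for x
  proof (cases "sin x = 0")
    case True
    then show ?thesis using a by (simp add: Q_def)
  next
    case False
    then show ?thesis using p_nonneg[of "z + x"] f[of x] by (simp add: Q_def zero_le_mult_iff)
  qed
  define x2 where "x2 = \<beta> - z"
  have s2: "0 < sin x2" using \<beta> by (intro sin_gt_zero) (auto simp: x2_def)
  have Q0: "Q x2 = 0" using f[of x2] \<beta> s2 by (simp add: x2_def Q_def)
  \<comment> \<open>\<open>B'\<close> and \<open>D'\<close> are the coefficients of \<open>Q\<close>
    re-expanded around its zero \<open>x2\<close>; \<open>B'\<close> is the slope of
    \<open>Q\<close> there.\<close>
  define B' where "B' = - 2 * a * cos x2 * sin x2 + b * ((cos x2)\<^sup>2 - (sin x2)\<^sup>2) + 2 * c * sin x2 * cos x2"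
  define D' where "D' = a * (sin x2)\<^sup>2 - b * (sin x2 * cos x2) + c * (cos x2)\<^sup>2"
  have Qx: "Q (x2 + y) = Q x2 * (cos y)\<^sup>2 + B' * (cos y * sin y) + D' * (sin y)\<^sup>2" for y
    unfolding Q_def B'_def D'_def sin_add cos_add by (simp add: algebra_simps power2_eq_square)
  have nn: "0 \<le> 0 * t\<^sup>2 + B' * t + D'" for t
  proof -
    obtain y where y: "0 < sin y" "cos y = t * sin y" by (rule angle_with_cot)
    have "Q (x2 + y) = (sin y)\<^sup>2 * (B' * t + D')"
      unfolding Qx Q0 y(2) by (simp add: algebra_simps power2_eq_square)
    then show ?thesis using Qnn[of "x2 + y"] y by (simp add: zero_le_mult_iff)
  qed
  have B': "B' = 0" by (rule quadratic_nonneg(2)[OF nn]) simp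
  have pf: "p (z + x) = D' * (sin x)\<^sup>2 * (sin (x - x2))\<^sup>2" for x
    using f[of x] Qx[of "x - x2"] Q0 B' by (simp add: Q_def mult.commute)
  have "D' \<noteq> 0"
  proof
    assume "D' = 0"
    then have "p x = 0" for x using pf[of "x - z"] by simp
    then show False using p_nonzero by simp
  qed
  then have D': "0 < D'" using nn[of 0] by simp
  have pp: "0 < p x" if "z < x" "x < z + pi" "x \<noteq> \<beta>" for x
  proof -
    have "0 < sin (x - z)" using that by (intro sin_gt_zero) auto
    moreover have "sin (x - \<beta>) \<noteq> 0"
    proof (cases "x < \<beta>")
      case True
      then have "0 < sin (\<beta> - x)" using that \<beta> by (intro sin_gt_zero) auto
      then show ?thesis using sin_minus[of "x - \<beta>"] by simp
    next
      case False
      then have "0 < sin (x - \<beta>)" using that \<beta> by (intro sin_gt_zero) auto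
      then show ?thesis by simp
    qed
    ultimately show ?thesis using pf[of "x - z"] D' by (simp add: x2_def)
  qed
  show ?thesis using \<beta> pp by (intro exI[of _ \<beta>]) auto
qed

lemma zeros_isolated: "\<forall>\<^sub>F x in at z. p x \<noteq> 0"
proof (cases "p z = 0")
  case False
  have "(p \<longlongrightarrow> p z) (at z)" using DERIV_isCont[OF dp] by (simp add: isCont_def)
  then show ?thesis using False by (rule tendsto_imp_eventually_ne)
next
  case True
  then obtain \<beta> where \<beta>: "z < \<beta>" "\<beta> \<le> z + pi" "p \<beta> = 0" "\<And>x. z < x \<Longrightarrow> x < \<beta> \<Longrightarrow> 0 < p x"
    "\<And>x. \<beta> < x \<Longrightarrow> x < z + pi \<Longrightarrow> 0 < p x" using zeros_structure by blast
  \<comment> \<open>The last zero before \<open>z + pi\<close>: positivity between it and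
    \<open>z + pi\<close>, shifted by a period, covers the left side of \<open>z\<close>.\<close>
  define l where "l = (if \<beta> = z + pi then z else \<beta>)"
  have l: "l < z + pi" using \<beta> by (simp add: l_def)
  have lp: "0 < p x" if "l < x" "x < z + pi" for x
    using \<beta>(4,5)[of x] that by (cases "\<beta> = z + pi") (simp_all add: l_def)
  have "\<forall>\<^sub>F x in at_right z. p x \<noteq> 0"
    unfolding eventually_at_right_field using \<beta> by (intro exI[of _ \<beta>]) (auto dest!: \<beta>(4))
  moreover have "\<forall>\<^sub>F x in at_left z. p x \<noteq> 0"
    unfolding eventually_at_left_field
  proof (intro exI[of _ "l - pi"] conjI allI impI)
    fix y assume "l - pi < y" "y < z"
    then have "0 < p (y + pi)" by (intro lp) auto
    then show "p y \<noteq> 0" using per_p[of y] by simp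
  qed (use l in simp)
  ultimately show ?thesis by (simp add: eventually_at_split)
qed

sublocale fokker_planck_finite p "deriv p" q "deriv q"
proof
  show "isCont (deriv p) x" for x by (rule DERIV_isCont[OF ddp])
  fix z
  assume z: "p z = 0"
  obtain a b c where f: "\<And>x. p (z + x) = (sin x)\<^sup>2 * (a * (cos x)\<^sup>2 + b * (cos x * sin x) + c * (sin x)\<^sup>2)"
    using zero_expansion[OF z] by blast
  \<comment> \<open>The quadratic form is at most the sum of the moduli of its coefficients, and
    \<bar>sin y\<bar> \<le> \<bar>y\<bar>.\<close>
  have "p x \<le> (\<bar>a\<bar> + \<bar>b\<bar> + \<bar>c\<bar>) * (x - z)\<^sup>2" for x
  proof -
    define y where "y = x - z"
    have "a * (cos y)\<^sup>2 + b * (cos y * sin y) + c * (sin y)\<^sup>2 \<le> \<bar>a\<bar> * 1 + \<bar>b\<bar> * 1 + \<bar>c\<bar> * 1"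
    proof (intro add_mono)
      have "\<bar>cos y * sin y\<bar> \<le> 1 * 1" unfolding abs_mult by (intro mult_mono) auto
      then have "\<bar>b * (cos y * sin y)\<bar> \<le> \<bar>b\<bar> * 1" unfolding abs_mult by (intro mult_left_mono) auto
      then show "b * (cos y * sin y) \<le> \<bar>b\<bar> * 1" by linarith
      show "a * (cos y)\<^sup>2 \<le> \<bar>a\<bar> * 1" by (intro mult_mono) (auto simp: abs_square_le_1)
      show "c * (sin y)\<^sup>2 \<le> \<bar>c\<bar> * 1" by (intro mult_mono) (auto simp: abs_square_le_1)
    qed
    then have "p x \<le> (sin y)\<^sup>2 * (\<bar>a\<bar> + \<bar>b\<bar> + \<bar>c\<bar>)"
      using f[of y] by (auto simp: y_def intro: mult_left_mono)
    also have "\<dots> \<le> y\<^sup>2 * (\<bar>a\<bar> + \<bar>b\<bar> + \<bar>c\<bar>)"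
      using abs_sin_x_le_abs_x[of y] by (intro mult_right_mono) (auto simp: abs_le_square_iff)
    finally show ?thesis by (simp add: y_def mult.commute)
  qed
  then show "\<exists>A. \<forall>x. p x \<le> A * (x - z)\<^sup>2" by blast
  assume "q z = 0"
  then show "\<exists>B>0. ((\<lambda>x. q x - deriv p x) has_real_derivative B) (at z)"
    using drift_derivative[OF z] DERIV_diff[OF dq ddp]
    by (intro exI[of _ "deriv q z - (deriv ^^ 2) p z"]) auto
next
  fix a b :: real
  show "finite {x \<in> {a..b}. p x = 0}"
  proof (rule ccontr)
    \<comment> \<open>Infinitely many zeros in a compact interval would accumulate, contradicting
      their isolation.\<close>
    assume "infinite {x \<in> {a..b}. p x = 0}"
    then obtain l where "l islimpt {x \<in> {a..b}. p x = 0}"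
      using compact_eq_Bolzano_Weierstrass[of "{a..b}"] compact_Icc by (metis (no_types, lifting) mem_Collect_eq subsetI)
    then have "l islimpt {x. p x = 0}" by (rule islimpt_subset) auto
    then show False using zeros_isolated[of l] by (simp add: islimpt_iff_eventually)
  qed
qed (use dp dq per_p per_p' per_q p_nonneg in auto)

lemma groundstate_exists:
  "\<exists>C \<rho>. solution C \<rho> \<and> groundstate p q \<rho> \<and> (\<forall>x. 0 \<le> \<rho> x) \<and>
    (\<forall>\<rho>'. groundstate p q \<rho>' \<longrightarrow> (AE x in lborel. \<rho>' x = \<rho> x)) \<and>
    (\<forall>z. p z = 0 \<longrightarrow> q z = 0 \<longrightarrow> C = 0)"
proof (cases "\<forall>x. 0 < p x")
  case True
  then show ?thesis by (intro nondegenerate_groundstate) blast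
next
  case False
  then obtain z where z: "p z = 0" using p_nonneg by (metis order_le_less)
  obtain \<beta> where \<beta>: "z < \<beta>" "\<beta> \<le> z + pi" "p \<beta> = 0" and pos1: "\<And>x. z < x \<Longrightarrow> x < \<beta> \<Longrightarrow> 0 < p x"
    and pos2: "\<And>x. \<beta> < x \<Longrightarrow> x < z + pi \<Longrightarrow> 0 < p x" using zeros_structure[OF z] by blast
  have zp: "p (z + pi) = 0" "q (z + pi) = q z" using z per_p per_q by auto
  \<comment> \<open>Zeros with q = 0 agree modulo pi, and \<open>\<beta>\<close> lies within one
    period of \<open>z\<close>.\<close>
  have both: "q z = 0 \<Longrightarrow> q \<beta> = 0 \<Longrightarrow> \<beta> = z + pi"
  proof -
    assume "q z = 0" "q \<beta> = 0"
    then obtain k :: int where k: "\<beta> = z + of_int k * pi"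
      using degenerate_zero_unique[OF z _ \<beta>(3)] by blast
    then have "0 < of_int k * pi" "of_int k * pi \<le> 1 * pi" using \<beta> by auto
    then have "0 < k" "k \<le> 1" by (simp_all add: zero_less_mult_iff del: mult_1)
    then show ?thesis using k by (cases "k = 1") auto
  qed
  consider "(0 < q z \<and> 0 < q \<beta>) \<or> (q z < 0 \<and> q \<beta> < 0)"
    | "0 \<le> q z" "q \<beta> \<le> 0" | "q z \<le> 0" "0 \<le> q \<beta>" "\<beta> \<noteq> z + pi" | "q z \<noteq> 0" "\<beta> = z + pi" "q z * q \<beta> \<le> 0"
    using zp by (metis linorder_le_cases linorder_not_le order_less_le)
  then show ?thesis
  proof cases
    case 1
    then show ?thesis by (intro rotating_groundstate[OF \<beta>(1,2) z \<beta>(3)]) (auto intro: pos1 pos2)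
  next
    case 2
    show ?thesis
    proof (rule trapping_groundstate[OF \<beta>(1,2) z \<beta>(3) pos1 pos2 2])
      show "q \<beta> < 0 \<or> 0 < q z" if "\<beta> < z + pi" using both 2 that by fastforce
      show "q z = 0 \<or> q \<beta> = 0 \<or> \<beta> < z + pi \<and> q \<beta> < 0 \<and> 0 < q z"
        using 2 \<beta>(2) zp by (cases "\<beta> = z + pi") auto
    qed auto
  next
    \<comment> \<open>The gaps exchange roles: the interval from \<open>\<beta>\<close> to
      \<open>z + pi\<close> traps, and its complement is the first gap shifted by a period.\<close>
    case 3
    then have lt: "\<beta> < z + pi" using \<beta> by simp
    show ?thesis
    proof (rule trapping_groundstate[OF lt _ \<beta>(3) zp(1) pos2])
      show "z + pi \<le> \<beta> + pi" using \<beta> by simp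
      show "0 < p x" if "z + pi < x" "x < \<beta> + pi" for x
        using pos1[of "x - pi"] that per_p[of "x - pi"] by simp
      show "0 \<le> q \<beta>" "q (z + pi) \<le> 0" using 3 zp by auto
      show "q (z + pi) < 0 \<or> 0 < q \<beta>" using both 3 zp by fastforce
      show "q \<beta> = 0 \<or> q (z + pi) = 0 \<or> z + pi < \<beta> + pi \<and> q (z + pi) < 0 \<and> 0 < q \<beta>"
        using 3 \<beta> zp by auto
    qed auto
  next
    \<comment> \<open>Void: \<open>q \<beta> = q z\<close> by periodicity, so the product is a
      positive square.\<close>
    case 4
    then show ?thesis using zp by (auto simp: mult_le_0_iff)
  qed
qed

section \<open>Smoothness of the groundstate\<close>

lemma smooth_at_nonzero:
  assumes sol: "solution C \<rho>" and x: "p x \<noteq> 0"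
  shows "smooth_at \<rho> x"
proof -
  have "open {x. p x \<noteq> 0}"
    using Ck_on_continuous[OF Ck_p[of 0]] by (intro open_Collect_neq continuous_on_const)
  then obtain r where r: "0 < r" "ball x r \<subseteq> {x. p x \<noteq> 0}" using x openE by blast
  have "Ck_on n \<rho> (ball x r)" for n
  proof (rule Ck_on_linear_ode[where A = "\<lambda>x. (q x - deriv p x) / p x" and B = "\<lambda>x. C / p x"])
    show "Ck_on n (\<lambda>x. (q x - deriv p x) / p x) (ball x r)" "Ck_on n (\<lambda>x. C / p x) (ball x r)" for n
      using r by (intro Ck_on_divide Ck_on_diff Ck_on_const Ck_on_subset[OF Ck_p] Ck_on_subset[OF Ck_p']
          Ck_on_subset[OF Ck_q] open_ball; auto)+
    fix y assume "y \<in> ball x r"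
    then have py: "p y \<noteq> 0" using r by auto
    then have "(\<rho> has_real_derivative (C - (deriv p y - q y) * \<rho> y) / p y) (at y)"
      using sol by (simp add: solution_def)
    then show "(\<rho> has_real_derivative (q y - deriv p y) / p y * \<rho> y + C / p y) (at y)"
      by (rule DERIV_cong) (use py in \<open>simp add: field_simps\<close>)
  qed simp
  then show ?thesis by (rule smooth_atI[OF r(1)])
qed

lemma punctured_ball: "\<exists>r>0. \<forall>x\<in>ball z r - {z}. p x \<noteq> 0"
  using zeros_isolated[of z] unfolding eventually_at by (auto simp: dist_commute)

text \<open>In p \<rho>' + (p' - q) \<rho> = C the zeroth-order coefficient at \<open>z\<close> is -
  q(z), so the singular bootstrap applies directly.\<close>

lemma smooth_at_irregular_zero:
  assumes sol: "solution C \<rho>" and z: "p z = 0" "q z \<noteq> 0"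
  shows "smooth_at \<rho> z"
proof -
  obtain r where r: "0 < r" "\<And>x. x \<in> ball z r - {z} \<Longrightarrow> p x \<noteq> 0" using punctured_ball by blast
  obtain A where A: "\<And>x. p x \<le> A * (x - z)\<^sup>2" using quad[OF z(1)] by blast
  have pos: "\<forall>\<^sub>F x in at z. 0 < 1 * p x"
    using zeros_isolated[of z] by eventually_elim (use p_nonneg in \<open>simp add: order_less_le\<close>)
  have "Ck_on n \<rho> (ball z r)" for n
  proof (rule Ck_on_singular_ode[where a = p and b = "\<lambda>x. deriv p x - q x" and f = "\<lambda>_. C" and s = 1 and t = 1])
    show "Ck_on n p (ball z r)" for n by (rule Ck_on_subset[OF Ck_p]) simp
    show "Ck_on n (\<lambda>x. deriv p x - q x) (ball z r)" for n
      by (rule Ck_on_subset[OF Ck_on_diff[OF open_UNIV Ck_p' Ck_q]]) simp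
    show "\<forall>\<^sub>F x in at z. \<bar>p x\<bar> \<le> A * (x - z)\<^sup>2" using A p_nonneg by simp
    show "continuous_on (ball z r) \<rho>"
      using sol by (auto simp: solution_def intro: continuous_at_imp_continuous_on)
    show "\<forall>\<^sub>F x in at_right z. 0 < 1 * p x" "\<forall>\<^sub>F x in at_left z. 0 < 1 * p x"
      using pos by (simp_all add: eventually_at_split)
    show "(\<rho> has_real_derivative (C - (deriv p x - q x) * \<rho> x) / p x) (at x)" if "x \<in> ball z r - {z}" for x
      using sol r(2)[OF that] by (simp add: solution_def)
    show "p x \<noteq> 0" if "x \<in> ball z r - {z}" for x by (rule r(2)[OF that])
  qed (use z p'_zero r in auto)
  then show ?thesis by (rule smooth_atI[OF r(1)])
qed

text \<open>Dividing the equation by \<open>sin (x - z)\<close> makes the zeroth-order coefficient nonzero at \<open>z\<close>.\<close>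
lemma smooth_at_order_4_zero:
  assumes sol: "solution 0 \<rho>" and f: "\<And>x. p (z + x) = c * sin x ^ 4" "0 < c" and qz: "q z = 0"
  shows "smooth_at \<rho> z"
proof -
  let ?s = "\<lambda>x. sin (x - z)" and ?c = "\<lambda>x. cos (x - z)"
  have pe: "p = (\<lambda>x. c * ?s x ^ 4)" using f(1)[of "_ - z"] by auto
  have z: "p z = 0" by (simp add: pe)
  have d1: "deriv p = (\<lambda>x. c * (4 * ?s x ^ 3 * ?c x))"
    unfolding pe by (intro ext DERIV_imp_deriv) (auto intro!: derivative_eq_intros)
  obtain h0 h1 h2 where h: "\<And>x. e (z + x) = h0 * (cos x)\<^sup>2 + h1 * (cos x * sin x) + h2 * (sin x)\<^sup>2"
    using quadratic[of z] by blast
  have "e z = 0" using q_eq[of z] qz p'_zero[OF z] by simp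
  then have h0: "h0 = 0" using h[of 0] by simp
  have ee: "e = (\<lambda>x. ?s x * (h1 * ?c x + h2 * ?s x))"
    using h[of "_ - z"] h0 by (auto simp: algebra_simps power2_eq_square)
  have "deriv e z = h1" unfolding ee by (intro DERIV_imp_deriv) (auto intro!: derivative_eq_intros)
  then have h1: "0 < h1"
    using excl_4[OF order_4_zero[OF f(1)]] f(2) \<open>e z = 0\<close> by simp
  \<comment> \<open>The quotient of q - p' by sin (x - z). At \<open>z\<close> it equals 2 h1 = 2
    e'(z), which is positive by the second exclusion.\<close>
  define N where "N = (\<lambda>x. 2 * (h1 * ?c x + h2 * ?s x) - 2 * c * (?s x ^ 2 * ?c x))"
  have qp: "q x - deriv p x = ?s x * N x" for x
    unfolding q_eq d1 ee N_def by (simp add: algebra_simps power2_eq_square power3_eq_cube)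
  define a where "a = (\<lambda>x. c * ?s x ^ 3)"
  define b where "b = (\<lambda>x. - 1 * N x)"
  have Cs: "Ck_on n ?s UNIV" "Ck_on n ?c UNIV" for n using Ck_on_sin_cos by auto
  have Ca: "Ck_on n a UNIV" for n unfolding a_def
    by (intro Ck_on_mult Ck_on_power Ck_on_const Cs open_UNIV)
  have Cb: "Ck_on n b UNIV" for n unfolding b_def N_def
    by (intro Ck_on_mult Ck_on_diff Ck_on_add Ck_on_power Ck_on_const Cs open_UNIV)
  have sr: "\<forall>\<^sub>F x in at_right z. 0 < ?s x"
    unfolding eventually_at_right_field
    by (intro exI[of _ "z + pi"]) (auto intro!: sin_gt_zero)
  have sl: "\<forall>\<^sub>F x in at_left z. ?s x < 0"
    unfolding eventually_at_left_field
  proof (intro exI[of _ "z - pi"] conjI allI impI)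
    fix x assume "z - pi < x" "x < z"
    then have "0 < sin (z - x)" by (intro sin_gt_zero) auto
    then show "?s x < 0" using sin_minus[of "x - z"] by simp
  qed simp
  obtain r where r: "0 < r" "\<And>x. x \<in> ball z r - {z} \<Longrightarrow> p x \<noteq> 0" using punctured_ball by blast
  have sn: "?s x \<noteq> 0" if "x \<in> ball z r - {z}" for x using r(2)[OF that] by (auto simp: pe)
  have "Ck_on n \<rho> (ball z r)" for n
  \<comment> \<open>After the division the leading coefficient is c sin^3, which changes sign at
    \<open>z\<close>; hence opposite sign constants on the two sides. The source term is 0 because
    the current vanishes; otherwise it would be singular.\<close>
  proof (rule Ck_on_singular_ode[where a = a and b = b and f = "\<lambda>_. 0" and s = 1 and t = "- 1" and A = c])
    show "Ck_on n a (ball z r)" "Ck_on n b (ball z r)" for n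
      by (rule Ck_on_subset[OF Ca] Ck_on_subset[OF Cb], simp)+
    have "deriv a z = 0" unfolding a_def by (intro DERIV_imp_deriv) (auto intro!: derivative_eq_intros)
    then show "a z = 0" "deriv a z = 0" by (auto simp: a_def)
    show "b z \<noteq> 0" using h1 by (simp add: b_def N_def)
    show "a x \<noteq> 0" if "x \<in> ball z r - {z}" for x using sn[OF that] f(2) by (simp add: a_def)
    show "\<forall>\<^sub>F x in at_right z. 0 < 1 * a x"
      using sr by eventually_elim (use f(2) in \<open>simp add: a_def\<close>)
    show "\<forall>\<^sub>F x in at_left z. 0 < - 1 * a x"
      using sl by eventually_elim
        (use f(2) in \<open>auto simp: a_def mult_less_0_iff zero_less_mult_iff power_less_zero_eq\<close>)
    have "\<bar>a x\<bar> \<le> c * (x - z)\<^sup>2" for x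
    proof -
      have "\<bar>a x\<bar> = c * ((?s x)\<^sup>2 * \<bar>?s x\<bar>)"
        using f(2) by (simp add: a_def abs_mult power3_eq_cube power2_eq_square)
      also have "\<dots> \<le> c * ((?s x)\<^sup>2 * 1)" using f(2) by (intro mult_left_mono) auto
      also have "\<dots> \<le> c * (x - z)\<^sup>2"
        using f(2) abs_sin_x_le_abs_x[of "x - z"] by (intro mult_left_mono) (auto simp: abs_le_square_iff)
      finally show ?thesis .
    qed
    then show "\<forall>\<^sub>F x in at z. \<bar>a x\<bar> \<le> c * (x - z)\<^sup>2" by simp
    show "continuous_on (ball z r) \<rho>"
      using sol by (auto simp: solution_def intro: continuous_at_imp_continuous_on)
    show "(\<rho> has_real_derivative (0 - b x * \<rho> x) / a x) (at x)" if x: "x \<in> ball z r - {z}" for x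
    proof -
      have "(\<rho> has_real_derivative (0 - (deriv p x - q x) * \<rho> x) / p x) (at x)"
        using sol r(2)[OF x] by (simp add: solution_def)
      moreover have "deriv p x - q x = - (?s x * N x)" using qp[of x] by simp
      moreover have "p x = ?s x * a x" by (simp add: pe a_def power3_eq_cube power4_eq_xxxx)
      ultimately show ?thesis using sn[OF x] by (simp add: b_def)
    qed
  qed (use r in auto)
  then show ?thesis by (rule smooth_atI[OF r(1)])
qed

text \<open>A zero of p with q = 0 is unique modulo pi and is the only candidate for the exceptional
  point. If it has order 4, or if there is none, the groundstate is smooth everywhere.\<close>

lemma groundstate_exists_unique_smooth:
  "\<exists>\<rho>. groundstate p q \<rho>
     \<and> (\<forall>\<rho>'. groundstate p q \<rho>' \<longrightarrow> (AE x in lborel. \<rho>' x = \<rho> x))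
     \<and> (\<forall>\<theta>. 0 \<le> \<rho> \<theta>)
     \<and> continuous_on UNIV \<rho>
     \<and> (\<exists>\<theta>h. \<forall>\<theta>. smooth_at \<rho> \<theta> \<or>
           ((\<exists>k::int. \<theta> = \<theta>h + of_int k * pi)
            \<and> zero_of_order p \<theta>h 2 \<and> deriv p \<theta>h = q \<theta>h \<and> (deriv ^^ 2) p \<theta>h < deriv q \<theta>h))"
proof -
  obtain C \<rho> where sol: "solution C \<rho>" and gs: "groundstate p q \<rho>" and nn: "\<forall>x. 0 \<le> \<rho> x"
    and uniq: "\<forall>\<rho>'. groundstate p q \<rho>' \<longrightarrow> (AE x in lborel. \<rho>' x = \<rho> x)"
    and C: "\<And>z. p z = 0 \<Longrightarrow> q z = 0 \<Longrightarrow> C = 0" using groundstate_exists by blast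
  have cont: "continuous_on UNIV \<rho>"
    using sol by (auto simp: solution_def intro: continuous_at_imp_continuous_on)
  have "\<exists>\<theta>h. \<forall>\<theta>. smooth_at \<rho> \<theta> \<or>
           ((\<exists>k::int. \<theta> = \<theta>h + of_int k * pi)
            \<and> zero_of_order p \<theta>h 2 \<and> deriv p \<theta>h = q \<theta>h \<and> (deriv ^^ 2) p \<theta>h < deriv q \<theta>h)"
  proof (cases "\<exists>z. p z = 0 \<and> q z = 0")
    case False
    then show ?thesis
      using smooth_at_nonzero[OF sol] smooth_at_irregular_zero[OF sol] by blast
  next
    case True
    then obtain z where z: "p z = 0" "q z = 0" by blast
    then have sol0: "solution 0 \<rho>" using sol C by blast
    obtain a b c where f: "\<And>x. p (z + x) = (sin x)\<^sup>2 * (a * (cos x)\<^sup>2 + b * (cos x * sin x) + c * (sin x)\<^sup>2)"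
      and a: "a = 0 \<longrightarrow> b = 0 \<and> 0 < c" using zero_expansion[OF z(1)] by blast
    show ?thesis
    proof (intro exI[of _ z] allI)
      fix \<theta>
      show "smooth_at \<rho> \<theta> \<or> ((\<exists>k::int. \<theta> = z + of_int k * pi)
            \<and> zero_of_order p z 2 \<and> deriv p z = q z \<and> (deriv ^^ 2) p z < deriv q z)"
      proof (cases "p \<theta> = 0 \<and> q \<theta> = 0")
        case False
        then show ?thesis
          using smooth_at_nonzero[OF sol] smooth_at_irregular_zero[OF sol] by blast
      next
        case True
        then obtain k :: int where k: "\<theta> = z + of_int k * pi" using degenerate_zero_unique z by blast
        show ?thesis
        proof (cases "a = 0")
          case False
          then show ?thesis
            using k order_2_zero[OF f] drift_derivative[OF z] p'_zero[OF z(1)] z by auto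
        next
          case a0: True
          have "p (\<theta> + x) = c * sin x ^ 4" for x
          proof -
            have "p (\<theta> + x) = p (z + x + of_int k * pi)" by (simp add: k algebra_simps)
            also have "\<dots> = p (z + x)" using periodic_pi_int[of p] per_p by blast
            also have "\<dots> = c * sin x ^ 4" using f[of x] a0 a by (simp add: power2_eq_square power4_eq_xxxx)
            finally show ?thesis .
          qed
          then show ?thesis using smooth_at_order_4_zero[OF sol0] a a0 True by blast
        qed
      qed
    qed
  qed
  then show ?thesis using gs nn uniq cont by blast
qed

end

section \<open>Coefficients of a second-order anomaly\<close>

text \<open>Unlike integrability, this property is stable under products, so that all second moments
  of matrix entries are covered.\<close>

definition bounded_measurable :: "'s measure \<Rightarrow> ('s \<Rightarrow> real) \<Rightarrow> bool" where
  "bounded_measurable M f \<longleftrightarrow> f \<in> borel_measurable M \<and> (\<exists>B. \<forall>\<sigma>\<in>space M. \<bar>f \<sigma>\<bar> \<le> B)"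

lemma bounded_measurable_const: "bounded_measurable M (\<lambda>_. c)"
  by (auto simp: bounded_measurable_def)

lemma bounded_measurable_add:
  assumes "bounded_measurable M f" "bounded_measurable M g"
  shows "bounded_measurable M (\<lambda>\<sigma>. f \<sigma> + g \<sigma>)"
proof -
  obtain B C where "\<forall>\<sigma>\<in>space M. \<bar>f \<sigma>\<bar> \<le> B" "\<forall>\<sigma>\<in>space M. \<bar>g \<sigma>\<bar> \<le> C"
    using assms by (auto simp: bounded_measurable_def)
  then have "\<forall>\<sigma>\<in>space M. \<bar>f \<sigma> + g \<sigma>\<bar> \<le> B + C" by fastforce
  then show ?thesis using assms by (auto simp: bounded_measurable_def)
qed

lemma bounded_measurable_mult:
  assumes "bounded_measurable M f" "bounded_measurable M g"
  shows "bounded_measurable M (\<lambda>\<sigma>. f \<sigma> * g \<sigma>)"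
proof -
  obtain B C where B: "\<forall>\<sigma>\<in>space M. \<bar>f \<sigma>\<bar> \<le> B" and C: "\<forall>\<sigma>\<in>space M. \<bar>g \<sigma>\<bar> \<le> C"
    using assms by (auto simp: bounded_measurable_def)
  have "\<bar>f \<sigma> * g \<sigma>\<bar> \<le> \<bar>B\<bar> * \<bar>C\<bar>" if "\<sigma> \<in> space M" for \<sigma>
    unfolding abs_mult using B C that by (intro mult_mono) force+
  then show ?thesis using assms by (auto simp: bounded_measurable_def)
qed

lemma (in prob_space) bounded_measurable_integrable:
  assumes "bounded_measurable M f" shows "integrable M f"
proof -
  obtain B where "\<forall>\<sigma>\<in>space M. \<bar>f \<sigma>\<bar> \<le> B" using assms by (auto simp: bounded_measurable_def)
  then show ?thesis using assms
    by (intro integrable_const_bound[of f B]) (auto simp: bounded_measurable_def)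
qed

text \<open>The random coefficients separate from the angle, so expectations become finite
  trigonometric sums and no differentiation under the integral is required.\<close>

lemma (in prob_space) expectation_square_form:
  assumes "bounded_measurable M a" "bounded_measurable M b" "bounded_measurable M d"
  shows "(\<integral>\<sigma>. (a \<sigma> * (cos x)\<^sup>2 + b \<sigma> * (cos x * sin x) + d \<sigma> * (sin x)\<^sup>2)\<^sup>2 \<partial>M) =
     (\<integral>\<sigma>. a \<sigma> * a \<sigma> \<partial>M) * cos x ^ 4 + 2 * (\<integral>\<sigma>. a \<sigma> * b \<sigma> \<partial>M) * (cos x ^ 3 * sin x)
     + ((\<integral>\<sigma>. b \<sigma> * b \<sigma> \<partial>M) + 2 * (\<integral>\<sigma>. a \<sigma> * d \<sigma> \<partial>M)) * ((cos x)\<^sup>2 * (sin x)\<^sup>2)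
     + 2 * (\<integral>\<sigma>. b \<sigma> * d \<sigma> \<partial>M) * (cos x * sin x ^ 3) + (\<integral>\<sigma>. d \<sigma> * d \<sigma> \<partial>M) * sin x ^ 4"
proof -
  have eq: "(a \<sigma> * (cos x)\<^sup>2 + b \<sigma> * (cos x * sin x) + d \<sigma> * (sin x)\<^sup>2)\<^sup>2 =
     cos x ^ 4 * (a \<sigma> * a \<sigma>) + 2 * (cos x ^ 3 * sin x) * (a \<sigma> * b \<sigma>)
     + (cos x)\<^sup>2 * (sin x)\<^sup>2 * (b \<sigma> * b \<sigma>) + 2 * ((cos x)\<^sup>2 * (sin x)\<^sup>2) * (a \<sigma> * d \<sigma>)
     + 2 * (cos x * sin x ^ 3) * (b \<sigma> * d \<sigma>) + sin x ^ 4 * (d \<sigma> * d \<sigma>)" for \<sigma>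
    by algebra
  have [simp]: "integrable M (\<lambda>\<sigma>. a \<sigma> * a \<sigma>)" "integrable M (\<lambda>\<sigma>. a \<sigma> * b \<sigma>)"
    "integrable M (\<lambda>\<sigma>. b \<sigma> * b \<sigma>)" "integrable M (\<lambda>\<sigma>. a \<sigma> * d \<sigma>)"
    "integrable M (\<lambda>\<sigma>. b \<sigma> * d \<sigma>)" "integrable M (\<lambda>\<sigma>. d \<sigma> * d \<sigma>)"
    by (intro bounded_measurable_integrable bounded_measurable_mult assms)+
  show ?thesis unfolding eq by simp (simp add: algebra_simps)
qed

lemma (in prob_space) expectation_quadratic_form:
  assumes "bounded_measurable M a" "bounded_measurable M b" "bounded_measurable M d"
  shows "(\<integral>\<sigma>. a \<sigma> * (cos x)\<^sup>2 + b \<sigma> * (cos x * sin x) + d \<sigma> * (sin x)\<^sup>2 \<partial>M) =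
     (\<integral>\<sigma>. a \<sigma> \<partial>M) * (cos x)\<^sup>2 + (\<integral>\<sigma>. b \<sigma> \<partial>M) * (cos x * sin x) + (\<integral>\<sigma>. d \<sigma> \<partial>M) * (sin x)\<^sup>2"
  using assms[THEN bounded_measurable_integrable] by simp

definition pfun' :: "real^2^2 \<Rightarrow> real \<Rightarrow> real" where
  "pfun' A \<theta> = - 2 * A$2$1 * (cos \<theta> * sin \<theta>) - 2 * A$1$2 * (sin \<theta> * cos \<theta>)
     - 2 * A$1$1 * ((cos \<theta>)\<^sup>2 - (sin \<theta>)\<^sup>2)"

lemma pfun_deriv: "(pfun A has_real_derivative pfun' A x) (at x)"
  unfolding pfun_def[abs_def] pfun'_def
  by (rule derivative_eq_intros refl)+ (simp only: cos_double, simp add: algebra_simps)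

lemma deriv_pfun: "deriv (pfun A) = pfun' A"
  using pfun_deriv DERIV_imp_deriv by blast

text \<open>A quadratic form in (cos, sin) in the frame rotated by \<open>z\<close>: its
  coefficients are the value at \<open>z\<close>, the slope at \<open>z\<close> and the value a
  quarter turn further on.\<close>

lemma pfun_expansion:
  "pfun A (z + x) = pfun A z * (cos x)\<^sup>2 + pfun' A z * (cos x * sin x) + pfun A (z + pi / 2) * (sin x)\<^sup>2"
  unfolding pfun_def pfun'_def sin_double
  by (simp add: sin_add cos_add algebra_simps power2_eq_square)

lemma pfun_0: "pfun A 0 = A$2$1" "pfun' A 0 = - 2 * A$1$1" "pfun A (pi / 2) = - A$1$2"
  by (simp_all add: pfun_def pfun'_def)

lemma bounded_measurable_entry:
  fixes P :: "'s \<Rightarrow> real^2^2"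
  assumes "P \<in> borel_measurable M" "\<forall>\<sigma>\<in>space M. norm (P \<sigma>) \<le> B"
  shows "bounded_measurable M (\<lambda>\<sigma>. P \<sigma> $ i $ j)"
proof -
  have "continuous_on UNIV (\<lambda>A::real^2^2. A $ i $ j)" by (intro continuous_intros)
  then have "(\<lambda>A::real^2^2. A $ i $ j) \<in> borel_measurable borel" by (rule borel_measurable_continuous_onI)
  then have "(\<lambda>\<sigma>. P \<sigma> $ i $ j) \<in> borel_measurable M"
    using measurable_compose[OF assms(1)] by blast
  moreover have "\<bar>P \<sigma> $ i $ j\<bar> \<le> B" if "\<sigma> \<in> space M" for \<sigma>
  proof -
    have "\<bar>P \<sigma> $ i $ j\<bar> \<le> norm (P \<sigma> $ i)" by (rule component_le_norm_cart)
    also have "\<dots> \<le> norm (P \<sigma>)" by (rule Finite_Cartesian_Product.norm_nth_le)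
    finally show ?thesis using assms(2) that by force
  qed
  ultimately show ?thesis by (auto simp: bounded_measurable_def)
qed

lemma bounded_measurable_pfun:
  fixes P :: "'s \<Rightarrow> real^2^2"
  assumes "P \<in> borel_measurable M" "\<forall>\<sigma>\<in>space M. norm (P \<sigma>) \<le> B"
  shows "bounded_measurable M (\<lambda>\<sigma>. pfun (P \<sigma>) z)" "bounded_measurable M (\<lambda>\<sigma>. pfun' (P \<sigma>) z)"
proof -
  note be = bounded_measurable_entry[OF assms]
  have "bounded_measurable M (\<lambda>\<sigma>. P \<sigma>$2$1 * (cos z)\<^sup>2 + P \<sigma>$1$2 * (- (sin z)\<^sup>2) + P \<sigma>$1$1 * (- sin (2 * z)))"
    by (intro bounded_measurable_add bounded_measurable_mult be bounded_measurable_const)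
  then show "bounded_measurable M (\<lambda>\<sigma>. pfun (P \<sigma>) z)" by (simp add: pfun_def)
  have "bounded_measurable M (\<lambda>\<sigma>. P \<sigma>$2$1 * (- 2 * (cos z * sin z)) + P \<sigma>$1$2 * (- 2 * (sin z * cos z))
     + P \<sigma>$1$1 * (- 2 * ((cos z)\<^sup>2 - (sin z)\<^sup>2)))"
    by (intro bounded_measurable_add bounded_measurable_mult be bounded_measurable_const)
  then show "bounded_measurable M (\<lambda>\<sigma>. pfun' (P \<sigma>) z)" by (simp add: pfun'_def algebra_simps)
qed

lemma anomaly_trig_coefficients:
  fixes M :: "'s measure" and P :: "nat \<Rightarrow> 's \<Rightarrow> real^2^2"
  assumes "prob_space M"
    and meas: "P 1 \<in> borel_measurable M" "P K \<in> borel_measurable M"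
    and bdd1: "\<forall>\<sigma>\<in>space M. norm (P 1 \<sigma>) \<le> B1" and bddK: "\<forall>\<sigma>\<in>space M. norm (P K \<sigma>) \<le> BK"
    and sl2: "\<forall>\<sigma>\<in>space M. P 1 \<sigma> $ 1 $ 1 + P 1 \<sigma> $ 2 $ 2 = 0"
    and nondeg: "measure M {\<sigma>\<in>space M. P 1 \<sigma> = 0} < 1"
    and not_I: "\<not> (\<exists>\<theta>. zero_of_order (pcoef M P) \<theta> 2 \<and> deriv (pcoef M P) \<theta> = 0
                    \<and> qcoef M P K \<theta> = 0
                    \<and> (deriv ^^ 2) (pcoef M P) \<theta> \<ge> deriv (qcoef M P K) \<theta>)"
    and not_II: "\<not> (\<exists>\<theta>. zero_of_order (pcoef M P) \<theta> 4
                    \<and> integral\<^sup>L M (\<lambda>\<sigma>. pfun (P K \<sigma>) \<theta>) = 0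
                    \<and> integral\<^sup>L M (\<lambda>\<sigma>. deriv (pfun (P K \<sigma>)) \<theta>) \<le> 0)"
  shows "trig_coefficients (pcoef M P) (\<lambda>x. \<integral>\<sigma>. pfun (P K \<sigma>) x \<partial>M) (qcoef M P K)"
proof -
  interpret prob_space M by fact
  note b1 = bounded_measurable_pfun[OF meas(1) bdd1]
  note bK = bounded_measurable_pfun[OF meas(2) bddK]
  let ?p = "pcoef M P" and ?e = "\<lambda>x. \<integral>\<sigma>. pfun (P K \<sigma>) x \<partial>M"
  have px: "?p (z + x) =
     (\<integral>\<sigma>. pfun (P 1 \<sigma>) z * pfun (P 1 \<sigma>) z \<partial>M) * cos x ^ 4
     + 2 * (\<integral>\<sigma>. pfun (P 1 \<sigma>) z * pfun' (P 1 \<sigma>) z \<partial>M) * (cos x ^ 3 * sin x)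
     + ((\<integral>\<sigma>. pfun' (P 1 \<sigma>) z * pfun' (P 1 \<sigma>) z \<partial>M)
        + 2 * (\<integral>\<sigma>. pfun (P 1 \<sigma>) z * pfun (P 1 \<sigma>) (z + pi / 2) \<partial>M)) * ((cos x)\<^sup>2 * (sin x)\<^sup>2)
     + 2 * (\<integral>\<sigma>. pfun' (P 1 \<sigma>) z * pfun (P 1 \<sigma>) (z + pi / 2) \<partial>M) * (cos x * sin x ^ 3)
     + (\<integral>\<sigma>. pfun (P 1 \<sigma>) (z + pi / 2) * pfun (P 1 \<sigma>) (z + pi / 2) \<partial>M) * sin x ^ 4" for z x
    unfolding pcoef_def pfun_expansion[of _ z x] by (rule expectation_square_form[OF b1 b1(1)])
  have ex: "?e (z + x) = ?e z * (cos x)\<^sup>2 + (\<integral>\<sigma>. pfun' (P K \<sigma>) z \<partial>M) * (cos x * sin x)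
      + ?e (z + pi / 2) * (sin x)\<^sup>2" for z x
    unfolding pfun_expansion[of _ z x] by (rule expectation_quadratic_form[OF bK bK(1)])
  \<comment> \<open>The slope at \<open>z\<close> is read off as the mixed coefficient of the
    expansion around \<open>z\<close>.\<close>
  have de: "deriv ?e z = (\<integral>\<sigma>. pfun' (P K \<sigma>) z \<partial>M)" for z
  proof -
    obtain h0 h2 where h: "\<And>x. ?e (z + x) = h0 * (cos x)\<^sup>2
        + (\<integral>\<sigma>. pfun' (P K \<sigma>) z \<partial>M) * (cos x * sin x) + h2 * (sin x)\<^sup>2"
      using ex by blast
    have "((\<lambda>x. ?e (z + x)) has_real_derivative (\<integral>\<sigma>. pfun' (P K \<sigma>) z \<partial>M)) (at 0)"
      unfolding h by (rule derivative_eq_intros refl | simp)+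
    then have "(?e has_real_derivative (\<integral>\<sigma>. pfun' (P K \<sigma>) z \<partial>M)) (at z)"
      using DERIV_shift[of ?e _ 0 z] by (simp add: add.commute)
    then show ?thesis by (rule DERIV_imp_deriv)
  qed
  have dp: "deriv ?p z = 2 * (\<integral>\<sigma>. pfun (P 1 \<sigma>) z * pfun' (P 1 \<sigma>) z \<partial>M)" for z
  proof -
    have "((\<lambda>x. ?p (z + x)) has_real_derivative 2 * (\<integral>\<sigma>. pfun (P 1 \<sigma>) z * pfun' (P 1 \<sigma>) z \<partial>M)) (at 0)"
      unfolding px by (rule derivative_eq_intros refl | simp)+
    then have "(?p has_real_derivative 2 * (\<integral>\<sigma>. pfun (P 1 \<sigma>) z * pfun' (P 1 \<sigma>) z \<partial>M)) (at z)"
      using DERIV_shift[of ?p _ 0 z] by (simp add: add.commute)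
    then show ?thesis by (rule DERIV_imp_deriv)
  qed
  \<comment> \<open>If p vanished identically, p_1 would vanish almost surely at 0, pi/2 and pi/4.
    These angles determine the entries c, b and then a, and trace 0 gives the last entry, so P_1 = 0
    almost surely, against nondegeneracy.\<close>
  have nonzero: "\<exists>x. ?p x \<noteq> 0"
  proof (rule ccontr)
    assume "\<not> (\<exists>x. ?p x \<noteq> 0)"
    then have p0: "?p x = 0" for x by blast
    have z: "AE \<sigma> in M. pfun (P 1 \<sigma>) x = 0" for x
    proof -
      have "integrable M (\<lambda>\<sigma>. (pfun (P 1 \<sigma>) x)\<^sup>2)"
        unfolding power2_eq_square by (intro bounded_measurable_integrable bounded_measurable_mult b1)
      then have "AE \<sigma> in M. (pfun (P 1 \<sigma>) x)\<^sup>2 = 0"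
        using p0[of x] integral_nonneg_eq_0_iff_AE[of M "\<lambda>\<sigma>. (pfun (P 1 \<sigma>) x)\<^sup>2"]
        by (simp add: pcoef_def)
      then show ?thesis by simp
    qed
    have "AE \<sigma> in M. P 1 \<sigma> = 0"
      using z[of 0] z[of "pi / 2"] z[of "pi / 4"] AE_space
    proof eventually_elim
      case (elim \<sigma>)
      have "P 1 \<sigma> $ 2 $ 1 = 0" "P 1 \<sigma> $ 1 $ 2 = 0" using elim by (auto simp: pfun_0)
      moreover from this have "P 1 \<sigma> $ 1 $ 1 = 0" using elim by (simp add: pfun_def)
      moreover from this have "P 1 \<sigma> $ 2 $ 2 = 0" using sl2 elim by auto
      ultimately show ?case by (simp add: vec_eq_iff forall_2)
    qed
    then have "measure M {\<sigma>\<in>space M. P 1 \<sigma> = 0} = 1"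
      using meas(1) by (intro prob_Collect_eq_1[THEN iffD2]) auto
    then show False using nondeg by simp
  qed
  show ?thesis
  proof
    show "\<exists>g0 g1 g2 g3 g4. \<forall>x. ?p (z + x) =
      g0 * cos x ^ 4 + g1 * (cos x ^ 3 * sin x) + g2 * ((cos x)\<^sup>2 * (sin x)\<^sup>2)
      + g3 * (cos x * sin x ^ 3) + g4 * sin x ^ 4" for z
      using px[of z] by blast
    show "\<exists>h0 h1 h2. \<forall>x. ?e (z + x) = h0 * (cos x)\<^sup>2 + h1 * (cos x * sin x) + h2 * (sin x)\<^sup>2" for z
      using ex[of z] by blast
    show "qcoef M P K x = 2 * ?e x + deriv ?p x / 2" for x
      by (simp add: qcoef_def deriv_pfun dp)
    show "0 \<le> ?p x" for x by (simp add: pcoef_def)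
    show "\<exists>x. ?p x \<noteq> 0" by (rule nonzero)
    show "(deriv ^^ 2) ?p z < deriv (qcoef M P K) z" if "zero_of_order ?p z 2" "qcoef M P K z = 0" for z
    proof -
      have "deriv ?p z = 0" using that(1) by (auto simp: zero_of_order_def dest!: spec[of _ 1])
      then show ?thesis using not_I that by force
    qed
    show "0 < deriv ?e z" if "zero_of_order ?p z 4" "?e z = 0" for z
      using not_II that by (force simp: de deriv_pfun)
  qed
qed

theorem theorem2:
  fixes M :: "'s measure" and P :: "nat \<Rightarrow> 's \<Rightarrow> real^2^2"
    and \<eta> :: "nat \<Rightarrow> real" and K :: nat
  assumes prob: "prob_space M"
    and meas: "\<forall>k\<ge>1. P k \<in> borel_measurable M"
    and bdd: "\<forall>k\<ge>1. \<exists>B. \<forall>\<sigma>\<in>space M. norm (P k \<sigma>) \<le> B"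
    and sl2: "\<forall>k\<ge>1. \<forall>\<sigma>\<in>space M. P k \<sigma> $ 1 $ 1 + P k \<sigma> $ 2 $ 2 = 0"
    and eta_pos: "0 < \<eta> 1"
    and eta_incr: "\<forall>k\<ge>1. \<eta> k < \<eta> (Suc k)"
    and K_ge: "1 \<le> K"
    and eta_K: "\<eta> K = 2 * \<eta> 1"
    and eta_K1: "\<eta> (Suc K) \<le> \<eta> 1 + \<eta> 2"
    and nondeg: "\<forall>k. 1 \<le> k \<and> k < K \<longrightarrow> measure M {\<sigma>\<in>space M. P k \<sigma> = 0} < 1"
    and anomaly: "\<forall>k. 1 \<le> k \<and> k < K \<longrightarrow>
                    (\<forall>i j. integral\<^sup>L M (\<lambda>\<sigma>. P k \<sigma> $ i $ j) = 0)"
    and not_I: "\<not> (\<exists>\<theta>. zero_of_order (pcoef M P) \<theta> 2 \<and> deriv (pcoef M P) \<theta> = 0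
                    \<and> qcoef M P K \<theta> = 0
                    \<and> (deriv ^^ 2) (pcoef M P) \<theta> \<ge> deriv (qcoef M P K) \<theta>)"
    and not_II: "\<not> (\<exists>\<theta>. zero_of_order (pcoef M P) \<theta> 4
                    \<and> integral\<^sup>L M (\<lambda>\<sigma>. pfun (P K \<sigma>) \<theta>) = 0
                    \<and> integral\<^sup>L M (\<lambda>\<sigma>. deriv (pfun (P K \<sigma>)) \<theta>) \<le> 0)"
  shows "\<exists>\<rho>. groundstate (pcoef M P) (qcoef M P K) \<rho>
           \<and> (\<forall>\<rho>'. groundstate (pcoef M P) (qcoef M P K) \<rho>' \<longrightarrow> (AE x in lborel. \<rho>' x = \<rho> x))
           \<and> (\<forall>\<theta>. 0 \<le> \<rho> \<theta>)
           \<and> continuous_on UNIV \<rho>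
           \<and> (\<exists>\<theta>h. \<forall>\<theta>. smooth_at \<rho> \<theta> \<or>
                 ((\<exists>k::int. \<theta> = \<theta>h + of_int k * pi)
                  \<and> zero_of_order (pcoef M P) \<theta>h 2
                  \<and> deriv (pcoef M P) \<theta>h = qcoef M P K \<theta>h
                  \<and> (deriv ^^ 2) (pcoef M P) \<theta>h < deriv (qcoef M P K) \<theta>h))"
proof -
  \<comment> \<open>From \<open>\<eta> K = 2 * \<eta> 1\<close> with \<open>\<eta> 1 > 0\<close>;
    hence the nondegeneracy assumption for k < K includes k = 1.\<close>
  have "K \<noteq> 1" using eta_K eta_pos by auto
  then have "1 < K" using K_ge by simp
  then have nd: "measure M {\<sigma>\<in>space M. P 1 \<sigma> = 0} < 1" using nondeg by simp
  obtain B1 BK where B: "\<forall>\<sigma>\<in>space M. norm (P 1 \<sigma>) \<le> B1" "\<forall>\<sigma>\<in>space M. norm (P K \<sigma>) \<le> BK"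
    using bdd K_ge by (meson order_refl)
  have "P 1 \<in> borel_measurable M" "P K \<in> borel_measurable M"
    "\<forall>\<sigma>\<in>space M. P 1 \<sigma> $ 1 $ 1 + P 1 \<sigma> $ 2 $ 2 = 0" using meas sl2 K_ge by auto
  from anomaly_trig_coefficients[OF prob this(1,2) B this(3) nd not_I not_II]
  show ?thesis by (rule trig_coefficients.groundstate_exists_unique_smooth)
qed

end
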